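(* Let $k\ge 3$, $n$ and $z\ge 1$ be integers, let $\mathcal{H}$ be the set of all $k$-uniform unicyclic hypergraphs of order $n$ with matching number $\alpha(G)\ge z$, and let $\rho_{max}=\max\{\rho(G): G\in\mathcal{H}\}$. Let $G\in\mathcal{H}$ with $\rho(G)=\rho_{max}$, and let $m=n/(k-1)$ be the number of edges of $G$. Then $m\ge z+1$, and: (1) if $m=z+1$, then $G\cong \mathscr{U}(n,k;0;0,z-1;0,0)$; (2) if $m\ge z+2$ and $1\le z\le 2$, then $G\cong \mathscr{U}(n,k;z-1;0,0;0,0)$; (3) if $m\ge z+2$ and $3\le z\le k$, then $G\cong \mathscr{U}(n,k;1;z-2,0;0,0)$; (4) if $m\ge z+2$ and $k+1\le z\le 2k-2$, then $G\cong \mathscr{U}(n,k;1;k-2,z-k;0,0)$; (5) if $m\ge z+2$ and $2k-1\le z\le m-2-\lceil\frac{m-2k}{k-1}\rceil$, then $G\cong \mathscr{U}(n,k;1;k-2,k-2;t,w)$, where $t=\lfloor\frac{z-2k+2}{k-1}\rfloor$ and $w=z-2k+2-\lfloor\frac{z-2k+2}{k-1}\rfloor(k-1)$.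
   Context: Hypergraphs are simple (no repeated edges); a hypergraph is $k$-uniform if every edge is a $k$-subset of the vertex set. The degree of a vertex is the number of edges containing it. A path of length $q$ is an alternating sequence $v_1e_1v_2\cdots v_qe_qv_{q+1}$ of distinct vertices and distinct edges with $v_i,v_{i+1}\in e_i$; a cycle of length $q$ is $v_1e_1v_2\cdots v_qe_qv_1$ with distinct vertices $v_1,\dots,v_q$, distinct edges and $v_i,v_{i+1}\in e_i$ (indices mod $q$). A connected $k$-uniform hypergraph with $n$ vertices and $m$ edges is unicyclic if $n-1=(k-1)m-1$ (equivalently it is connected and has exactly one cycle); thus $m=n/(k-1)$. A matching is a set of pairwise disjoint edges; $\alpha(G)$ is the maximum size of a matching. The adjacency tensor $\mathcal{A}(G)$ of a $k$-uniform hypergraph on vertex set $[n]$ is the order-$k$, dimension-$n$ tensor with $\mathcal{A}_{i_1\cdots i_k}=\frac{1}{(k-1)!}$ if $\{i_1,\dots,i_k\}$ is an edge and $0$ otherwise; $\lambda\in\mathbb{C}$ is an eigenvalue if $\mathcal{A}X^{k-1}=\lambda X^{[k-1]}$ for some nonzero $X\in\mathbb{C}^n$, where $(\mathcal{A}X^{k-1})_i=\sum_{i_2,\dots,i_k}\mathcal{A}_{ii_2\cdots i_k}x_{i_2}\cdots x_{i_k}$ and $X^{[k-1]}=(x_1^{k-1},\dots,x_n^{k-1})$; the spectral radius $\rho(G)$ is the maximum modulus of the eigenvalues. Attaching a pendant edge to a vertex $v$ means adding a new edge consisting of $v$ and $k-1$ new vertices. The hypergraph $\mathscr{U}(n,k;f;r,s;t,w)$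 (with $f\le 1$, $r,s,w\le k-2$, all parameters nonnegative integers) is the $k$-uniform unicyclic hypergraph of order $n$ (with $m=n/(k-1)$ edges) obtained from a 2-cycle $v_1e_1v_2e_2v_1$ (two $k$-edges $e_1,e_2$ with $e_1\cap e_2=\{v_1,v_2\}$) by: (1) attaching $f$ pendant edges to $v_2$; (2) attaching one pendant edge to each of $r$ vertices of $e_1\setminus\{v_1,v_2\}$; (3) attaching one pendant edge to each of $s$ vertices of $e_2\setminus\{v_1,v_2\}$; (4) adding $t$ new edges each containing $v_1$ and $k-1$ new vertices, and attaching exactly one pendant edge to each of these $k-1$ vertices of each such edge; (5) adding $\lceil w/(k-1)\rceil$ further new edges (one if $w\ge1$, none if $w=0$) containing $v_1$ and $k-1$ new vertices, with exactly one pendant edge attached to each vertex of a $w$-subset of its vertices other than $v_1$; (6) attaching $m-f-r-s-t-t(k-1)-w-\lceil\frac{w}{k-1}\rceil-2$ pendant edges to $v_1$. *)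

theory Defs
  imports Complex_Main
begin

record 'a hypergraph =
  verts :: "'a set"
  edges :: "'a set set"

definition uniform_hypergraph :: "nat \<Rightarrow> 'a hypergraph \<Rightarrow> bool" where
  "uniform_hypergraph k G \<longleftrightarrow>
     finite (verts G) \<and> (\<forall>e\<in>edges G. e \<subseteq> verts G \<and> card e = k)"

text \<open>The path \<open>v\<^sub>1 e\<^sub>1 v\<^sub>2 \<dots> v\<^sub>q e\<^sub>q v\<^sub>q\<^sub>+\<^sub>1\<close> is given by its list of vertices and its list of
  edges; length \<open>q = 0\<close> (a single vertex) is allowed.\<close>

definition hg_path :: "'a hypergraph \<Rightarrow> 'a list \<Rightarrow> 'a set list \<Rightarrow> bool" where
  "hg_path G vs es \<longleftrightarrow>
     length vs = length es + 1 \<and> distinct vs \<and> distinct es \<and>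
     set vs \<subseteq> verts G \<and> set es \<subseteq> edges G \<and>
     (\<forall>i<length es. vs ! i \<in> es ! i \<and> vs ! (i + 1) \<in> es ! i)"

definition hg_connected :: "'a hypergraph \<Rightarrow> bool" where
  "hg_connected G \<longleftrightarrow> verts G \<noteq> {} \<and>
     (\<forall>u\<in>verts G. \<forall>v\<in>verts G. \<exists>vs es. hg_path G vs es \<and> hd vs = u \<and> last vs = v)"

definition unicyclic :: "nat \<Rightarrow> 'a hypergraph \<Rightarrow> bool" where
  "unicyclic k G \<longleftrightarrow> uniform_hypergraph k G \<and> hg_connected G \<and>
     int (card (verts G)) - 1 = (int k - 1) * int (card (edges G)) - 1"

definition hg_matching :: "'a hypergraph \<Rightarrow> 'a set set \<Rightarrow> bool" where
  "hg_matching G M \<longleftrightarrow> M \<subseteq> edges G \<and> pairwise disjnt M"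

definition matching_number :: "'a hypergraph \<Rightarrow> nat" where
  "matching_number G = Max {card M | M. hg_matching G M}"

definition hg_iso :: "'a hypergraph \<Rightarrow> 'b hypergraph \<Rightarrow> bool" (infix \<open>\<cong>\<close> 50) where
  "G \<cong> H \<longleftrightarrow>
     (\<exists>\<phi>. bij_betw \<phi> (verts G) (verts H) \<and> (\<lambda>e. \<phi> ` e) ` edges G = edges H)"

text \<open>A tensor of order \<open>k\<close> whose indices range over \<open>V\<close> is a function on lists of length \<open>k\<close>
  over \<open>V\<close>.\<close>

definition adjacency_tensor :: "nat \<Rightarrow> 'a hypergraph \<Rightarrow> 'a list \<Rightarrow> complex" where
  "adjacency_tensor k G is = (if set is \<in> edges G then 1 / fact (k - 1) else 0)"

definition tensor_apply ::
  "'a set \<Rightarrow> nat \<Rightarrow> ('a list \<Rightarrow> complex) \<Rightarrow> ('a \<Rightarrow> complex) \<Rightarrow> 'a \<Rightarrow> complex" where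
  "tensor_apply V k A X i =
     (\<Sum>is | length is = k - 1 \<and> set is \<subseteq> V. A (i # is) * prod_list (map X is))"

definition tensor_eigenvalue :: "'a set \<Rightarrow> nat \<Rightarrow> ('a list \<Rightarrow> complex) \<Rightarrow> complex \<Rightarrow> bool" where
  "tensor_eigenvalue V k A c \<longleftrightarrow>
     (\<exists>X. (\<exists>i\<in>V. X i \<noteq> 0) \<and> (\<forall>i\<in>V. tensor_apply V k A X i = c * X i ^ (k - 1)))"

text \<open>\<open>GREATEST\<close> is used instead of \<open>Max\<close> because the latter is meaningful only once the set of
  eigenvalues is known to be finite.\<close>

definition spectral_radius :: "nat \<Rightarrow> 'a hypergraph \<Rightarrow> real" where
  "spectral_radius k G =
     (GREATEST \<rho>. \<exists>c. tensor_eigenvalue (verts G) k (adjacency_tensor k G) c \<and> \<rho> = cmod c)"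

definition unicyclic_matching_class :: "nat \<Rightarrow> nat \<Rightarrow> nat \<Rightarrow> 'a hypergraph set" where
  "unicyclic_matching_class n k z =
     {G. unicyclic k G \<and> card (verts G) = n \<and> matching_number G \<ge> z}"

text \<open>All hypergraphs in the construction below have vertex set \<open>{..<N}\<close>, so that
  \<open>N, N + 1, \<dots>\<close> are new vertices.\<close>

definition attach_edge :: "nat \<Rightarrow> nat \<Rightarrow> nat hypergraph \<Rightarrow> nat hypergraph" where
  "attach_edge k v G = (let N = card (verts G); new = {N..<N + (k - 1)} in
     \<lparr>verts = verts G \<union> new, edges = insert (insert v new) (edges G)\<rparr>)"

text \<open>A new edge at \<open>v\<close>, together with one pendant edge at each of \<open>j\<close> of its \<open>k - 1\<close> new
  vertices.\<close>

definition attach_branch :: "nat \<Rightarrow> nat \<Rightarrow> nat \<Rightarrow> nat hypergraph \<Rightarrow> nat hypergraph" where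
  "attach_branch k j v G =
     (let N = card (verts G) in fold (attach_edge k) [N..<N + j] (attach_edge k v G))"

text \<open>The 2-cycle has \<open>v\<^sub>1 = 0\<close>, \<open>v\<^sub>2 = 1\<close>, \<open>e\<^sub>1 - {v\<^sub>1, v\<^sub>2} = {2..<k}\<close> and
  \<open>e\<^sub>2 - {v\<^sub>1, v\<^sub>2} = {k..<2 * k - 2}\<close>.\<close>

definition two_cycle :: "nat \<Rightarrow> nat hypergraph" where
  "two_cycle k =
     \<lparr>verts = {..<2 * k - 2}, edges = {{0, 1} \<union> {2..<k}, {0, 1} \<union> {k..<2 * k - 2}}\<rparr>"

definition used_edges_U :: "nat \<Rightarrow> nat \<Rightarrow> nat \<Rightarrow> nat \<Rightarrow> nat \<Rightarrow> nat \<Rightarrow> nat" where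
  "used_edges_U k f r s t w =
     f + r + s + t + t * (k - 1) + w + nat \<lceil>real w / real (k - 1)\<rceil> + 2"

definition hypergraph_U ::
  "nat \<Rightarrow> nat \<Rightarrow> nat \<Rightarrow> nat \<Rightarrow> nat \<Rightarrow> nat \<Rightarrow> nat \<Rightarrow> nat hypergraph" where
  "hypergraph_U n k f r s t w =
     (let m = n div (k - 1);
          G1 = (attach_edge k 1 ^^ f) (two_cycle k);
          G2 = fold (attach_edge k) [2..<2 + r] G1;
          G3 = fold (attach_edge k) [k..<k + s] G2;
          G4 = (attach_branch k (k - 1) 0 ^^ t) G3;
          G5 = (attach_branch k w 0 ^^ nat \<lceil>real w / real (k - 1)\<rceil>) G4
      in (attach_edge k 0 ^^ (m - used_edges_U k f r s t w)) G5)"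

text \<open>The parameters for which \<open>\<U>(n,k;f;r,s;t,w)\<close> is defined; in particular \<open>n / (k - 1)\<close> and
  the number of pendant edges attached last to \<open>v\<^sub>1\<close> are natural numbers.\<close>

definition admissible_U ::
  "nat \<Rightarrow> nat \<Rightarrow> nat \<Rightarrow> nat \<Rightarrow> nat \<Rightarrow> nat \<Rightarrow> nat \<Rightarrow> bool" where
  "admissible_U n k f r s t w \<longleftrightarrow>
     f \<le> 1 \<and> r \<le> k - 2 \<and> s \<le> k - 2 \<and> w \<le> k - 2 \<and>
     (k - 1) dvd n \<and> used_edges_U k f r s t w \<le> n div (k - 1)"

definition iso_to_U ::
  "'a hypergraph \<Rightarrow> nat \<Rightarrow> nat \<Rightarrow> nat \<Rightarrow> nat \<Rightarrow> nat \<Rightarrow> nat \<Rightarrow> nat \<Rightarrow> bool" where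
  "iso_to_U G n k f r s t w \<longleftrightarrow>
     admissible_U n k f r s t w \<and> G \<cong> hypergraph_U n k f r s t w"

end

theory Submission
  imports Defs "HOL-Analysis.Analysis" "HOL-Combinatorics.Multiset_Permutations"
begin

text \<open>
  The spectral radius is the maximum of \<open>k * (\<Sum>e\<in>E. \<Prod>v\<in>e. x v)\<close> over nonnegative \<open>x\<close> with
  \<open>(\<Sum>v. x v ^ k) = 1\<close>, attained at a positive eigenvector when the hypergraph is connected.
  Substituting \<open>y v = x v ^ k\<close> turns the product over an edge into a geometric mean.

  Let \<open>u\<close> carry the largest weight of an extremal \<open>G\<close>, and let \<open>M\<close> be a matching of size \<open>z\<close>.
  Moving an edge to \<open>u\<close> increases the radius, so every edge outside \<open>M\<close>, and exactly one edge
  of \<open>M\<close>, contains \<open>u\<close>. A count of vertices then leaves one defect; the two cases in which the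
  cycle avoids \<open>u\<close> are removed by further moves. What remains is a star at \<open>u\<close> in which two edges
  share a second vertex \<open>v\<close>, with at most one pendant edge at each other vertex of the star. Its
  radius \<open>\<rho>\<close> satisfies \<open>\<rho> ^ k = \<beta> ^ f * (\<beta> powr (r/2) + \<beta> powr (s/2))\<^sup>2 + (\<Sum>c. \<beta> ^ j c)\<close> with
  \<open>\<beta> = 1 / (1 - 1 / \<rho> ^ k)\<close>, where \<open>f, r, s, j c\<close> count the pendant edges at \<open>v\<close>, on the two cycle
  edges and on the other star edges. Exchange arguments show that filling \<open>v\<close>, then one cycle edge,
  then the other, then the remaining star edges one by one maximises the right-hand side.
\<close>

section \<open>Spectral radius of a uniform hypergraph\<close>

text \<open>Radii are never computed. Every comparison takes place at the radius \<rho> of the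
  extremal hypergraph: once \<open>u\<close> has weight 1, the eigenvalue equations away from
  \<open>u\<close> determine all other weights, and the side on which the remaining equation at
  \<open>u\<close> fails tells on which side of \<rho> the radius of a competitor lies. The base
  \<beta> arises from eliminating a pendant edge from the equation at its root. The defect is one
  because n = (k-1)m, while a hypertree has one vertex more. The constraint \<alpha> \<ge> z shapes
  the optimisation. Since z-1 edges avoid \<open>u\<close>, a matching of size z needs a star edge
  without pendant edges. Exchanges could violate this, so the maximum is first taken over all
  distributions, and only its optimum is shown to leave a star edge free; the upper bound on z in
  the last case provides the room. If m = z+1, the star consists of the two cycle edges alone, one
  of them must stay free, and all pendant edges are forced onto the other. That is why this case
  does not follow the general filling order.\<close>

lemma compact_pointwise_box:
  fixes K :: "'a \<Rightarrow> real set"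
  assumes "\<And>i. compact (K i)"
  shows "compact {x. \<forall>i. x i \<in> K i}"
proof -
  \<comment> \<open>Tychonoff's theorem for the topology of pointwise convergence.\<close>
  have "compactin (product_topology (\<lambda>i. euclidean) UNIV) (Pi\<^sub>E UNIV K)"
    using assms by (subst compactin_PiE) auto
  moreover have "Pi\<^sub>E UNIV K = {x. \<forall>i. x i \<in> K i}"
    by auto
  ultimately show ?thesis
    by (simp add: euclidean_product_topology)
qed

lemma sum_powers_pos:
  fixes x :: "'a \<Rightarrow> real"
  assumes "finite V" "\<forall>v\<in>V. 0 \<le> x v" "i \<in> V" "x i \<noteq> 0"
  shows "0 < (\<Sum>v\<in>V. x v ^ k)"
proof -
  have "0 < x i" using assms by (metis order_less_le)
  then have "0 < x i ^ k" by simp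
  also have "\<dots> \<le> (\<Sum>v\<in>V. x v ^ k)"
    by (rule member_le_sum) (use assms in auto)
  finally show ?thesis .
qed

text \<open>Both sides are homogeneous of degree \<open>k\<close>, so it suffices to maximise on the
  unit sphere of the \<open>k\<close>-norm and to rescale; vectors vanishing on \<open>V\<close> are
  treated apart.\<close>

lemma edge_form_max_exists:
  fixes V :: "'a set" and E :: "'a set set"
  assumes fV: "finite V" and ne: "V \<noteq> {}" and k: "k \<ge> 2"
    and E: "\<forall>e\<in>E. e \<subseteq> V \<and> card e = k"
  obtains x :: "'a \<Rightarrow> real" where "\<forall>v. 0 \<le> x v" "(\<Sum>v\<in>V. x v ^ k) = 1"
    "\<forall>y. (\<forall>v\<in>V. 0 \<le> y v) \<longrightarrow>
       (\<Sum>e\<in>E. \<Prod>v\<in>e. y v) \<le> (\<Sum>e\<in>E. \<Prod>v\<in>e. x v) * (\<Sum>v\<in>V. y v ^ k)"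
proof -
  let ?P = "\<lambda>y::'a \<Rightarrow> real. (\<Sum>e\<in>E. \<Prod>v\<in>e. y v)"
  let ?N = "\<lambda>y::'a \<Rightarrow> real. (\<Sum>v\<in>V. y v ^ k)"
  \<comment> \<open>Coordinates outside \<open>V\<close> are frozen at 0, which keeps the box
    compact over any vertex type.\<close>
  define B where "B = {x::'a \<Rightarrow> real. \<forall>i. x i \<in> (if i \<in> V then {0..1} else {0})}"
  have cont: "continuous_on UNIV (\<lambda>x::'a \<Rightarrow> real. x i)" for i
    by simp
  have cN: "continuous_on UNIV ?N"
    by (intro continuous_on_sum continuous_on_power cont)
  have cP: "continuous_on UNIV ?P"
    by (intro continuous_on_sum continuous_on_prod cont)
  have "compact B" unfolding B_def
    by (rule compact_pointwise_box) auto
  moreover have "closed (?N -` {1})"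
    using cN by (intro closed_vimage) auto
  ultimately have comp: "compact (B \<inter> ?N -` {1})"
    by (rule compact_Int_closed)
  obtain i0 where i0: "i0 \<in> V" using ne by auto
  define x0 where "x0 = (\<lambda>i. if i = i0 then 1 else 0 :: real)"
  have "?N x0 = (\<Sum>v\<in>V. if v = i0 then 1 else 0)"
    by (rule sum.cong) (use k in \<open>auto simp: x0_def\<close>)
  then have "x0 \<in> B \<inter> ?N -` {1}"
    using i0 fV by (auto simp: B_def x0_def)
  then obtain x where x: "x \<in> B \<inter> ?N -` {1}" and mx: "\<forall>y\<in>B \<inter> ?N -` {1}. ?P y \<le> ?P x"
    using continuous_attains_sup[OF comp _ continuous_on_subset[OF cP]] by blast
  have x_nonneg: "\<forall>v. 0 \<le> x v"
  proof
    fix v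
    have "x v \<in> (if v \<in> V then {0..1} else {0})" using x unfolding B_def by blast
    then show "0 \<le> x v" by (auto split: if_splits)
  qed
  have "?P y \<le> ?P x * ?N y" if y: "\<forall>v\<in>V. 0 \<le> y v" for y
  proof (cases "\<forall>v\<in>V. y v = 0")
    case True
    have "?P y = 0"
    proof (rule sum.neutral, rule ballI)
      fix e assume e: "e \<in> E"
      then have "finite e" "e \<noteq> {}" "e \<subseteq> V"
        using E k fV by (auto intro: finite_subset)
      then show "(\<Prod>v\<in>e. y v) = 0" using True by auto
    qed
    moreover have "?N y = 0" using True k by simp
    ultimately show ?thesis by simp
  next
    case False
    then obtain i where "i \<in> V" "y i \<noteq> 0" by auto
    then have pos: "?N y > 0"
      using sum_powers_pos[OF fV y] by blast
    define r where "r = root k (?N y)"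
    have r: "r > 0" "r ^ k = ?N y"
      using pos k by (auto simp: r_def real_root_pow_pos2 order_less_imp_le)
    define z where "z = (\<lambda>i. if i \<in> V then y i / r else 0)"
    have N1: "?N z = 1"
    proof -
      have "?N z = (\<Sum>v\<in>V. y v ^ k / r ^ k)"
        by (rule sum.cong) (auto simp: z_def power_divide)
      also have "\<dots> = ?N y / r ^ k" by (simp add: sum_divide_distrib)
      finally show ?thesis using r pos by simp
    qed
    have zV: "0 \<le> z i" for i using y r by (auto simp: z_def)
    have "z i \<le> 1" if "i \<in> V" for i
    proof -
      have "z i ^ k \<le> ?N z"
        by (rule member_le_sum) (use that zV fV in auto)
      then have "z i ^ k \<le> 1 ^ k" using N1 by simp
      then show ?thesis using k power_le_imp_le_base[of "z i" "k-1" 1] zV by simp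
    qed
    then have "z \<in> B \<inter> ?N -` {1}"
      using N1 y r by (auto simp: B_def z_def)
    then have "?P z \<le> ?P x" using mx by blast
    moreover have "?P z = ?P y / r ^ k"
    proof -
      have "?P z = (\<Sum>e\<in>E. (\<Prod>v\<in>e. y v) / r ^ k)"
      proof (rule sum.cong[OF refl])
        fix e assume e: "e \<in> E"
        have "(\<Prod>v\<in>e. z v) = (\<Prod>v\<in>e. y v / r)"
          by (rule prod.cong) (use e E in \<open>auto simp: z_def\<close>)
        then show "(\<Prod>v\<in>e. z v) = (\<Prod>v\<in>e. y v) / r ^ k"
          using e E by (simp add: prod_dividef)
      qed
      then show ?thesis by (simp add: sum_divide_distrib)
    qed
    ultimately show ?thesis using r pos by (simp add: field_simps)
  qed
  then show ?thesis using that[of x] x x_nonneg by auto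
qed

text \<open>Only the coordinate \<open>i\<close> is varied: the slack \<open>g\<close> of the bound
  is then a polynomial in \<open>s\<close>, nonnegative for \<open>s \<ge> 0\<close> and zero at
  \<open>x i\<close>. Inside the domain its derivative vanishes; at the boundary the linear term has
  to vanish, since \<open>s ^ k\<close> is of higher order.\<close>

lemma edge_form_critical:
  fixes V :: "'a set" and E :: "'a set set" and x :: "'a \<Rightarrow> real"
  assumes fV: "finite V" and k: "k \<ge> 2"
    and E: "\<forall>e\<in>E. e \<subseteq> V \<and> card e = k"
    and x: "\<forall>v\<in>V. 0 \<le> x v"
    and bound: "\<forall>y. (\<forall>v\<in>V. 0 \<le> y v) \<longrightarrow>
       real k * (\<Sum>e\<in>E. \<Prod>v\<in>e. y v) \<le> c * (\<Sum>v\<in>V. y v ^ k)"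
    and eq: "real k * (\<Sum>e\<in>E. \<Prod>v\<in>e. x v) = c * (\<Sum>v\<in>V. x v ^ k)"
    and i: "i \<in> V"
  shows "(\<Sum>e | e \<in> E \<and> i \<in> e. \<Prod>w\<in>e - {i}. x w) = c * x i ^ (k - 1)"
proof -
  have fE: "finite E" using E fV by (meson Pow_iff finite_Pow_iff finite_subset subsetI)
  have fe: "finite e" if "e \<in> E" for e using that E fV by (meson finite_subset)
  define b where "b = (\<Sum>e | e \<in> E \<and> i \<in> e. \<Prod>w\<in>e - {i}. x w)"
  define P0 where "P0 = (\<Sum>e | e \<in> E \<and> i \<notin> e. \<Prod>w\<in>e. x w)"
  define N0 where "N0 = (\<Sum>v\<in>V-{i}. x v ^ k)"
  have P: "(\<Sum>e\<in>E. \<Prod>v\<in>e. (x(i := s)) v) = P0 + s * b" for s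
  proof -
    have split: "E = {e. e \<in> E \<and> i \<notin> e} \<union> {e. e \<in> E \<and> i \<in> e}" by auto
    have "(\<Sum>e\<in>E. \<Prod>v\<in>e. (x(i := s)) v)
        = (\<Sum>e | e \<in> E \<and> i \<notin> e. \<Prod>v\<in>e. (x(i := s)) v)
        + (\<Sum>e | e \<in> E \<and> i \<in> e. \<Prod>v\<in>e. (x(i := s)) v)"
      by (subst split, rule sum.union_disjoint) (use fE in auto)
    also have "(\<Sum>e | e \<in> E \<and> i \<notin> e. \<Prod>v\<in>e. (x(i := s)) v) = P0"
      unfolding P0_def by (rule sum.cong[OF refl], rule prod.cong) auto
    also have "(\<Sum>e | e \<in> E \<and> i \<in> e. \<Prod>v\<in>e. (x(i := s)) v) = s * b"
      unfolding b_def sum_distrib_left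
    proof (rule sum.cong[OF refl])
      fix e assume e: "e \<in> {e. e \<in> E \<and> i \<in> e}"
      then have "(\<Prod>v\<in>e. (x(i := s)) v) = s * (\<Prod>v\<in>e-{i}. (x(i := s)) v)"
        using fe by (simp add: prod.remove[of e i])
      also have "(\<Prod>v\<in>e-{i}. (x(i := s)) v) = (\<Prod>v\<in>e-{i}. x v)"
        by (rule prod.cong) auto
      finally show "(\<Prod>v\<in>e. (x(i := s)) v) = s * (\<Prod>w\<in>e - {i}. x w)" .
    qed
    finally show ?thesis .
  qed
  have N: "(\<Sum>v\<in>V. (x(i := s)) v ^ k) = s ^ k + N0" for s
  proof -
    have "(\<Sum>v\<in>V. (x(i := s)) v ^ k) = s ^ k + (\<Sum>v\<in>V-{i}. (x(i := s)) v ^ k)"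
      using sum.remove[OF fV i, of "\<lambda>v. (x(i := s)) v ^ k"] by simp
    also have "(\<Sum>v\<in>V-{i}. (x(i := s)) v ^ k) = N0"
      unfolding N0_def by (rule sum.cong) auto
    finally show ?thesis .
  qed
  define g where "g = (\<lambda>s. c * (s ^ k + N0) - real k * (P0 + s * b))"
  have g0: "g (x i) = 0" using P[of "x i"] N[of "x i"] eq by (simp add: g_def)
  have gpos: "0 \<le> g s" if "0 \<le> s" for s
    using bound[rule_format, of "x(i := s)"] that x P[of s] N[of s] by (simp add: g_def)
  have b0: "b \<ge> 0" unfolding b_def
    by (intro sum_nonneg prod_nonneg) (use x E in auto)
  show ?thesis
  proof (cases "x i = 0")
    case True
    have "b = 0"
    proof (rule ccontr)
      assume "b \<noteq> 0"
      then have b: "b > 0" using b0 by simp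
      \<comment> \<open>So small that \<open>\<bar>c\<bar> * s\<close> stays below \<open>b\<close>:
        the linear loss then beats the gain of order \<open>s ^ k\<close>.\<close>
      define s where "s = min 1 (b / (\<bar>c\<bar> + 1))"
      have s: "s > 0" "s \<le> 1" "s \<le> b / (\<bar>c\<bar> + 1)" using b by (auto simp: s_def)
      have "c * N0 = real k * P0" using g0 True k by (simp add: g_def zero_power)
      then have "0 \<le> c * s ^ k - real k * (s * b)"
        using gpos[of s] s by (simp add: g_def algebra_simps)
      moreover have "s ^ k = s * s ^ (k - 1)" using k by (cases k) auto
      ultimately have "0 \<le> s * (c * s ^ (k-1) - real k * b)"
        by (simp add: algebra_simps)
      then have "real k * b \<le> c * s ^ (k-1)" using s by (simp add: zero_le_mult_iff)
      also have "\<dots> \<le> \<bar>c\<bar> * s ^ (k-1)" using s by (intro mult_right_mono) auto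
      also have "\<dots> \<le> \<bar>c\<bar> * s ^ 1"
        by (intro mult_left_mono power_decreasing) (use s k in auto)
      also have "\<dots> \<le> \<bar>c\<bar> * (b / (\<bar>c\<bar> + 1))" using s by (intro mult_left_mono) auto
      also have "\<dots> < b" using b by (simp add: field_simps)
      also have "b \<le> real k * b" using b k by simp
      finally show False by simp
    qed
    then show ?thesis using True k by (simp add: b_def)
  next
    case False
    then have xi: "x i > 0" using x i by (auto simp: order_less_le)
    have "(g has_real_derivative (c * (real k * x i ^ (k-1)) - real k * b)) (at (x i))"
      unfolding g_def by (auto intro!: derivative_eq_intros)
    then have "c * (real k * x i ^ (k-1)) - real k * b = 0"
      by (rule DERIV_local_min[of _ _ _ "x i"]) (use xi gpos g0 in auto)
    then have "real k * (c * x i ^ (k-1) - b) = 0" by (simp add: algebra_simps)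
    then show ?thesis using k by (simp add: b_def)
  qed
qed

text \<open>A list \<open>i # is\<close> whose set is an edge has no repetition, since its length
  equals the size of the edge. The (k-1)! orderings of \<open>e - {i}\<close> cancel the factor in
  the tensor.\<close>

lemma tensor_apply_adjacency_tensor:
  assumes G: "uniform_hypergraph k G" and k: "k \<ge> 2" and i: "i \<in> verts G"
  shows "tensor_apply (verts G) k (adjacency_tensor k G) X i
    = (\<Sum>e | e \<in> edges G \<and> i \<in> e. \<Prod>w\<in>e - {i}. X w)"
proof -
  let ?V = "verts G" and ?E = "edges G"
  have fV: "finite ?V" and E: "\<And>e. e \<in> ?E \<Longrightarrow> e \<subseteq> ?V \<and> card e = k \<and> finite e"
    using G finite_subset by (auto simp: uniform_hypergraph_def)
  have fE: "finite ?E" using E fV by (meson Pow_iff finite_Pow_iff finite_subset subsetI)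
  let ?L = "{is. length is = k - 1 \<and> set is \<subseteq> ?V}"
  have fL: "finite ?L" using finite_lists_length_eq[OF fV, of "k-1"] by (simp add: conj_commute)
  have U: "{is \<in> ?L. set (i # is) \<in> ?E}
    = (\<Union>e\<in>{e. e \<in> ?E \<and> i \<in> e}. permutations_of_set (e - {i}))" (is "?A = ?B")
  proof
    show "?A \<subseteq> ?B"
    proof
      fix xs assume xs: "xs \<in> ?A"
      let ?e = "set (i # xs)"
      have e: "?e \<in> ?E" and l: "length xs = k - 1" using xs by auto
      have "card ?e = length (i # xs)" using E[OF e] l k by auto
      then have d: "distinct (i # xs)" by (rule card_distinct)
      then have "xs \<in> permutations_of_set (?e - {i})"
        by (auto simp: permutations_of_set_def)
      then show "xs \<in> ?B" using e by force
    qed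
    show "?B \<subseteq> ?A"
    proof
      fix xs assume "xs \<in> ?B"
      then obtain e where e: "e \<in> ?E" "i \<in> e" "set xs = e - {i}" "distinct xs"
        by (auto simp: permutations_of_set_def)
      have "length xs = k - 1" using e E[OF e(1)] distinct_card[of xs] by simp
      moreover have "set (i # xs) = e" using e by auto
      ultimately show "xs \<in> ?A" using e E[OF e(1)] by auto
    qed
  qed
  have "tensor_apply ?V k (adjacency_tensor k G) X i
      = (\<Sum>is\<in>?L. if set (i # is) \<in> ?E then 1 / fact (k-1) * prod_list (map X is) else 0)"
    unfolding tensor_apply_def adjacency_tensor_def by (rule sum.cong) auto
  also have "\<dots> = (\<Sum>is\<in>{is \<in> ?L. set (i # is) \<in> ?E}. 1 / fact (k-1) * prod_list (map X is))"
    by (rule sum.inter_filter[symmetric, OF fL])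
  also have "\<dots> = (\<Sum>e | e \<in> ?E \<and> i \<in> e. \<Sum>is\<in>permutations_of_set (e - {i}).
      1 / fact (k-1) * prod_list (map X is))"
    unfolding U
  proof (rule sum.UNION_disjoint)
    show "\<forall>e\<in>{e. e \<in> ?E \<and> i \<in> e}. \<forall>e'\<in>{e. e \<in> ?E \<and> i \<in> e}. e \<noteq> e' \<longrightarrow>
        permutations_of_set (e - {i}) \<inter> permutations_of_set (e' - {i}) = {}"
      by (auto simp: permutations_of_set_def)
  qed (use fE E in auto)
  also have "\<dots> = (\<Sum>e | e \<in> ?E \<and> i \<in> e. \<Prod>w\<in>e - {i}. X w)"
  proof (rule sum.cong[OF refl])
    fix e assume e: "e \<in> {e. e \<in> ?E \<and> i \<in> e}"
    have "(\<Sum>is\<in>permutations_of_set (e - {i}). 1 / fact (k-1) * prod_list (map X is))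
        = (\<Sum>is\<in>permutations_of_set (e - {i}). 1 / fact (k-1) * (\<Prod>w\<in>e - {i}. X w))"
    proof (rule sum.cong[OF refl])
      fix xs assume "xs \<in> permutations_of_set (e - {i})"
      then have "set xs = e - {i}" "distinct xs" by (auto simp: permutations_of_set_def)
      then have "prod_list (map X xs) = (\<Prod>w\<in>e - {i}. X w)"
        using prod.distinct_set_conv_list[of xs X] by simp
      then show "1 / fact (k-1) * prod_list (map X xs) = 1 / fact (k-1) * (\<Prod>w\<in>e - {i}. X w)"
        by simp
    qed
    also have "\<dots> = (\<Prod>w\<in>e - {i}. X w)"
      using e E by simp
    finally show "(\<Sum>is\<in>permutations_of_set (e - {i}). 1 / fact (k-1) * prod_list (map X is))
        = (\<Prod>w\<in>e - {i}. X w)" .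
  qed
  finally show ?thesis .
qed

text \<open>The maximiser is a real eigenvector for \<open>c\<close>. Conversely, the moduli of any
  complex eigenvector form a test vector: multiplying the equation at \<open>i\<close> by the
  modulus of \<open>X i\<close> and summing over \<open>i\<close> counts each edge \<open>k\<close>
  times. So the \<open>GREATEST\<close> is attained.\<close>

lemma spectral_radius_variational:
  assumes G: "uniform_hypergraph k G" and k: "k \<ge> 2" and ne: "verts G \<noteq> {}"
  obtains x where "\<forall>v. 0 \<le> x v" "(\<Sum>v\<in>verts G. x v ^ k) = 1"
    "spectral_radius k G = real k * (\<Sum>e\<in>edges G. \<Prod>v\<in>e. x v)"
    "\<forall>y. (\<forall>v\<in>verts G. 0 \<le> y v) \<longrightarrow> real k * (\<Sum>e\<in>edges G. \<Prod>v\<in>e. y v)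
       \<le> spectral_radius k G * (\<Sum>v\<in>verts G. y v ^ k)"
proof -
  let ?V = "verts G" and ?E = "edges G"
  have fV: "finite ?V" and E: "\<forall>e\<in>?E. e \<subseteq> ?V \<and> card e = k"
    using G by (auto simp: uniform_hypergraph_def)
  have fE: "finite ?E" using E fV by (meson Pow_iff finite_Pow_iff finite_subset subsetI)
  have fe: "finite e" if "e \<in> ?E" for e using that E fV by (meson finite_subset)
  obtain x :: "'a \<Rightarrow> real" where x: "\<forall>v. 0 \<le> x v" "(\<Sum>v\<in>?V. x v ^ k) = 1"
    and mx: "\<forall>y. (\<forall>v\<in>?V. 0 \<le> y v) \<longrightarrow>
       (\<Sum>e\<in>?E. \<Prod>v\<in>e. y v) \<le> (\<Sum>e\<in>?E. \<Prod>v\<in>e. x v) * (\<Sum>v\<in>?V. y v ^ k)"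
    by (rule edge_form_max_exists[OF fV ne k E])
  define c where "c = real k * (\<Sum>e\<in>?E. \<Prod>v\<in>e. x v)"
  have bound: "\<forall>y. (\<forall>v\<in>?V. 0 \<le> y v) \<longrightarrow>
       real k * (\<Sum>e\<in>?E. \<Prod>v\<in>e. y v) \<le> c * (\<Sum>v\<in>?V. y v ^ k)"
    using mx by (auto simp: c_def mult.assoc intro!: mult_left_mono)
  have c0: "c \<ge> 0" unfolding c_def by (intro mult_nonneg_nonneg sum_nonneg prod_nonneg) (use x in auto)
  have crit: "(\<Sum>e | e \<in> ?E \<and> i \<in> e. \<Prod>w\<in>e - {i}. x w) = c * x i ^ (k - 1)" if "i \<in> ?V" for i
    using edge_form_critical[OF fV k E _ bound _ that] x by (simp add: c_def)
  have "\<exists>j\<in>?V. x j \<noteq> 0"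
  proof (rule ccontr)
    assume "\<not> ?thesis"
    then have "(\<Sum>v\<in>?V. x v ^ k) = 0" using k by (intro sum.neutral) auto
    then show False using x(2) by simp
  qed
  then obtain j where j: "j \<in> ?V" "x j \<noteq> 0" by blast
  have ev: "tensor_eigenvalue ?V k (adjacency_tensor k G) (of_real c)"
    unfolding tensor_eigenvalue_def
  proof (intro exI conjI ballI)
    show "\<exists>i\<in>?V. complex_of_real (x i) \<noteq> 0" using j by auto
    fix i assume i: "i \<in> ?V"
    show "tensor_apply ?V k (adjacency_tensor k G) (\<lambda>i. complex_of_real (x i)) i
      = of_real c * of_real (x i) ^ (k - 1)"
      unfolding tensor_apply_adjacency_tensor[OF G k i]
      using arg_cong[OF crit[OF i], of complex_of_real] by simp
  qed
  have le: "cmod d \<le> c" if d: "tensor_eigenvalue ?V k (adjacency_tensor k G) d" for d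
  proof -
    obtain X where X: "\<exists>i\<in>?V. X i \<noteq> 0"
      and eq: "\<forall>i\<in>?V. tensor_apply ?V k (adjacency_tensor k G) X i = d * X i ^ (k - 1)"
      using d unfolding tensor_eigenvalue_def by blast
    have deg: "(\<Sum>i\<in>?V. \<Sum>e | e \<in> ?E \<and> i \<in> e. \<Prod>w\<in>e. cmod (X w))
        = real k * (\<Sum>e\<in>?E. \<Prod>w\<in>e. cmod (X w))"
    proof -
      have "(\<Sum>i\<in>?V. \<Sum>e | e \<in> ?E \<and> i \<in> e. \<Prod>w\<in>e. cmod (X w))
        = (\<Sum>e\<in>?E. \<Sum>i | i \<in> ?V \<and> i \<in> e. \<Prod>w\<in>e. cmod (X w))"
        by (rule sum.swap_restrict[OF fV fE])
      also have "\<dots> = (\<Sum>e\<in>?E. real k * (\<Prod>w\<in>e. cmod (X w)))"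
      proof (rule sum.cong[OF refl])
        fix e assume e: "e \<in> ?E"
        then have "{i. i \<in> ?V \<and> i \<in> e} = e" using E by auto
        then show "(\<Sum>i | i \<in> ?V \<and> i \<in> e. \<Prod>w\<in>e. cmod (X w)) = real k * (\<Prod>w\<in>e. cmod (X w))"
          using e E by simp
      qed
      finally show ?thesis by (simp add: sum_distrib_left)
    qed
    have "cmod d * cmod (X i) ^ k \<le> (\<Sum>e | e \<in> ?E \<and> i \<in> e. \<Prod>w\<in>e. cmod (X w))" if i: "i \<in> ?V" for i
    proof -
      have kk: "cmod (X i) ^ k = cmod (X i) ^ (k-1) * cmod (X i)"
        using k by (cases k) auto
      have "cmod d * cmod (X i) ^ k = cmod (d * X i ^ (k-1)) * cmod (X i)"
        unfolding kk by (simp add: norm_mult norm_power)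
      also have "d * X i ^ (k-1) = (\<Sum>e | e \<in> ?E \<and> i \<in> e. \<Prod>w\<in>e - {i}. X w)"
        using eq i tensor_apply_adjacency_tensor[OF G k i, of X] by simp
      also have "cmod \<dots> * cmod (X i) \<le> (\<Sum>e | e \<in> ?E \<and> i \<in> e. cmod (\<Prod>w\<in>e - {i}. X w)) * cmod (X i)"
        by (intro mult_right_mono norm_sum) auto
      also have "\<dots> = (\<Sum>e | e \<in> ?E \<and> i \<in> e. \<Prod>w\<in>e. cmod (X w))"
        unfolding sum_distrib_right
        by (rule sum.cong[OF refl]) (auto simp: fe prod.remove prod_norm[symmetric] norm_mult mult.commute)
      finally show ?thesis .
    qed
    then have "(\<Sum>i\<in>?V. cmod d * cmod (X i) ^ k)
        \<le> (\<Sum>i\<in>?V. \<Sum>e | e \<in> ?E \<and> i \<in> e. \<Prod>w\<in>e. cmod (X w))"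
      by (rule sum_mono)
    also have "\<dots> \<le> c * (\<Sum>v\<in>?V. cmod (X v) ^ k)"
      unfolding deg using bound by simp
    finally have "cmod d * (\<Sum>v\<in>?V. cmod (X v) ^ k) \<le> c * (\<Sum>v\<in>?V. cmod (X v) ^ k)"
      by (simp add: sum_distrib_left)
    moreover have "(\<Sum>v\<in>?V. cmod (X v) ^ k) > 0"
      using X sum_powers_pos[OF fV, of "\<lambda>v. cmod (X v)"] by auto
    ultimately show ?thesis by simp
  qed
  have "spectral_radius k G = c"
    unfolding spectral_radius_def
  proof (rule Greatest_equality)
    show "\<exists>d. tensor_eigenvalue ?V k (adjacency_tensor k G) d \<and> c = cmod d"
      using ev c0 by (intro exI[of _ "of_real c"]) auto
  qed (use le in auto)
  then show ?thesis using that[of x] x bound by (simp add: c_def)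
qed

section \<open>Connectedness and cuts\<close>

text \<open>\<open>X\<close> is a union of components. Paths enter only through the cut criterion
  \<open>hg_connected_iff\<close>; everything later works with cuts.\<close>

definition splits :: "'a set set \<Rightarrow> 'a set \<Rightarrow> bool" where
  "splits E X \<longleftrightarrow> (\<forall>e\<in>E. e \<subseteq> X \<or> e \<inter> X = {})"

text \<open>Vertices and edges of a path are distinct, so appending can fail. If \<open>w\<close>
  already lies on the path, the path is truncated at \<open>w\<close>; if \<open>e\<close> was
  already used, it is cut at \<open>e\<close> and leaves through \<open>w\<close>.\<close>

lemma hg_path_extend:
  assumes p: "hg_path G vs es" and e: "e \<in> edges G" "last vs \<in> e" "w \<in> e" "w \<in> verts G"
  obtains vs' es' where "hg_path G vs' es'" "hd vs' = hd vs" "last vs' = w"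
proof -
  have len: "length vs = length es + 1" and d: "distinct vs" "distinct es"
    and sub: "set vs \<subseteq> verts G" "set es \<subseteq> edges G"
    and inc: "\<And>i. i < length es \<Longrightarrow> vs ! i \<in> es ! i \<and> vs ! (i + 1) \<in> es ! i"
    using p by (auto simp: hg_path_def)
  have vne: "vs \<noteq> []" using len by auto
  consider (in_path) i where "i < length vs" "w = vs ! i"
    | (old_edge) i where "w \<notin> set vs" "i < length es" "e = es ! i"
    | (new_edge) "w \<notin> set vs" "e \<notin> set es"
    by (metis in_set_conv_nth)
  then show ?thesis
  proof cases
    case in_path
    have "hg_path G (take (i+1) vs) (take i es)"
      unfolding hg_path_def using len d sub inc in_path
      by (auto simp: distinct_take dest: in_set_takeD)
    moreover have "hd (take (i+1) vs) = hd vs" using vne by (simp add: hd_take)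
    moreover have "last (take (i+1) vs) = w"
      using in_path by (simp add: take_Suc_conv_app_nth)
    ultimately show ?thesis by (rule that)
  next
    case old_edge
    let ?vs = "take (i+1) vs @ [w]" and ?es = "take (i+1) es"
    have "?vs ! j \<in> ?es ! j \<and> ?vs ! (j + 1) \<in> ?es ! j" if "j < length ?es" for j
    proof (cases "j = i")
      case True
      then show ?thesis using old_edge len inc[of i] e by (simp add: nth_append)
    next
      case False
      then show ?thesis using that old_edge len inc[of j] by (auto simp: nth_append)
    qed
    then have "hg_path G ?vs ?es"
      unfolding hg_path_def using len d sub old_edge e
      by (auto simp: distinct_take dest: in_set_takeD)
    moreover have "hd ?vs = hd vs" using vne by (cases vs) auto
    ultimately show ?thesis using that by simp
  next
    case new_edge
    let ?vs = "vs @ [w]" and ?es = "es @ [e]"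
    have "?vs ! j \<in> ?es ! j \<and> ?vs ! (j + 1) \<in> ?es ! j" if "j < length ?es" for j
    proof (cases "j = length es")
      case True
      then show ?thesis using len e vne by (simp add: nth_append last_conv_nth)
    next
      case False
      then show ?thesis using that len inc[of j] by (auto simp: nth_append)
    qed
    then have "hg_path G ?vs ?es"
      unfolding hg_path_def using len d sub new_edge e by auto
    moreover have "hd ?vs = hd vs" using vne by simp
    ultimately show ?thesis using that by simp
  qed
qed

lemma hg_connected_iff:
  assumes G: "\<forall>e\<in>edges G. e \<subseteq> verts G"
  shows "hg_connected G \<longleftrightarrow> verts G \<noteq> {} \<and>
    (\<forall>X\<subseteq>verts G. splits (edges G) X \<longrightarrow> X = {} \<or> X = verts G)"
proof (intro iffI conjI allI impI)
  assume c: "hg_connected G"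
  then show "verts G \<noteq> {}" by (simp add: hg_connected_def)
  fix X assume X: "X \<subseteq> verts G" "splits (edges G) X"
  show "X = {} \<or> X = verts G"
  proof (rule ccontr)
    assume "\<not> ?thesis"
    then obtain u v where uv: "u \<in> X" "v \<in> verts G" "v \<notin> X" using X by auto
    then obtain vs es where p: "hg_path G vs es" "hd vs = u" "last vs = v"
      using c X unfolding hg_connected_def by blast
    have "vs ! i \<in> X" if "i < length vs" for i
      using that
    proof (induction i)
      case 0
      then show ?case using p uv by (simp add: hd_conv_nth)
    next
      case (Suc i)
      then have "vs ! i \<in> es ! i" "vs ! Suc i \<in> es ! i" "es ! i \<in> edges G"
        using p(1) unfolding hg_path_def by auto
      then show ?case using Suc X(2) unfolding splits_def by fastforce
    qed
    moreover have "vs \<noteq> []" using p(1) by (auto simp: hg_path_def)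
    ultimately have "last vs \<in> X" by (simp add: last_conv_nth)
    then show False using p uv by simp
  qed
next
  assume r: "verts G \<noteq> {} \<and> (\<forall>X\<subseteq>verts G. splits (edges G) X \<longrightarrow> X = {} \<or> X = verts G)"
  have "\<exists>vs es. hg_path G vs es \<and> hd vs = u \<and> last vs = v" if uv: "u \<in> verts G" "v \<in> verts G" for u v
  proof -
    define X where "X = {w \<in> verts G. \<exists>vs es. hg_path G vs es \<and> hd vs = u \<and> last vs = w}"
    have "hg_path G [u] []" using uv by (simp add: hg_path_def)
    then have "u \<in> X" unfolding X_def using uv by fastforce
    moreover have "splits (edges G) X"
      unfolding splits_def
    proof (intro ballI)
      fix e assume e: "e \<in> edges G"
      show "e \<subseteq> X \<or> e \<inter> X = {}"
      proof (cases "e \<inter> X = {}")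
        case False
        then obtain w vs es where w: "w \<in> e" "hg_path G vs es" "hd vs = u" "last vs = w"
          unfolding X_def by blast
        have "w' \<in> X" if "w' \<in> e" for w'
        proof -
          have "w' \<in> verts G" using that e G by auto
          then show ?thesis using hg_path_extend[OF w(2) e] w that unfolding X_def by blast
        qed
        then show ?thesis by auto
      qed auto
    qed
    moreover have "X \<subseteq> verts G" by (auto simp: X_def)
    ultimately have "X = verts G" using r by blast
    then show ?thesis using uv unfolding X_def by blast
  qed
  then show "hg_connected G" using r by (simp add: hg_connected_def)
qed

lemma hg_connected_cross:
  assumes G: "\<forall>e\<in>edges G. e \<subseteq> verts G" and "hg_connected G"
    and "X \<subseteq> verts G" "X \<noteq> {}" "X \<noteq> verts G"
  obtains e where "e \<in> edges G" "\<not> e \<subseteq> X" "e \<inter> X \<noteq> {}"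
proof -
  have "\<not> splits (edges G) X" using assms hg_connected_iff[OF G] by blast
  then show ?thesis using that unfolding splits_def by blast
qed

section \<open>Perron vectors\<close>

definition gmean :: "nat \<Rightarrow> ('a \<Rightarrow> real) \<Rightarrow> 'a set \<Rightarrow> real" where
  "gmean k y e = root k (\<Prod>v\<in>e. y v)"

lemma gmean_eq_prod_root: "k > 0 \<Longrightarrow> gmean k y e = (\<Prod>v\<in>e. root k (y v))"
  unfolding gmean_def by (induction e rule: infinite_finite_induct) (auto simp: real_root_mult)

lemma gmean_nonneg: "k > 0 \<Longrightarrow> \<forall>v\<in>e. 0 \<le> y v \<Longrightarrow> 0 \<le> gmean k y e"
  unfolding gmean_def by (simp add: prod_nonneg)

lemma gmean_pos: "k > 0 \<Longrightarrow> \<forall>v\<in>e. 0 < y v \<Longrightarrow> 0 < gmean k y e"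
  unfolding gmean_def by (simp add: prod_pos)

lemma gmean_pow: "k > 0 \<Longrightarrow> \<forall>v\<in>e. 0 \<le> y v \<Longrightarrow> gmean k y e ^ k = (\<Prod>v\<in>e. y v)"
  unfolding gmean_def by (simp add: prod_nonneg real_root_pow_pos2)

lemma gmean_eqI: "k > 0 \<Longrightarrow> 0 \<le> c \<Longrightarrow> (\<Prod>v\<in>e. y v) = c ^ k \<Longrightarrow> gmean k y e = c"
  unfolding gmean_def by (simp add: real_root_power_cancel)

lemma gmean_cong: "(\<And>v. v \<in> e \<Longrightarrow> y v = y' v) \<Longrightarrow> gmean k y e = gmean k y' e"
  unfolding gmean_def by (simp cong: prod.cong)

lemma uniform_finite:
  assumes "uniform_hypergraph k G"
  shows "finite (verts G)" "finite (edges G)" "e \<in> edges G \<Longrightarrow> finite e"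
    "e \<in> edges G \<Longrightarrow> e \<subseteq> verts G" "e \<in> edges G \<Longrightarrow> card e = k"
proof -
  show V: "finite (verts G)" and "e \<in> edges G \<Longrightarrow> e \<subseteq> verts G" "e \<in> edges G \<Longrightarrow> card e = k"
    using assms by (auto simp: uniform_hypergraph_def)
  then show "e \<in> edges G \<Longrightarrow> finite e" by (meson finite_subset)
  have "edges G \<subseteq> Pow (verts G)" using assms by (auto simp: uniform_hypergraph_def)
  then show "finite (edges G)" using V by (meson finite_Pow_iff finite_subset)
qed

text \<open>In the variables \<open>y v = x v ^ k\<close> the eigenvalue equation at
  \<open>v\<close>, multiplied by \<open>x v\<close>, says that the load is the radius times
  \<open>y v\<close>. No powers remain, and all vertices of degree one in the same edge carry the
  same weight.\<close>

abbreviation load :: "nat \<Rightarrow> 'a hypergraph \<Rightarrow> ('a \<Rightarrow> real) \<Rightarrow> 'a \<Rightarrow> real" where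
  "load k G y v \<equiv> \<Sum>e | e \<in> edges G \<and> v \<in> e. gmean k y e"

lemma sum_vertex_edge_swap:
  fixes g :: "'a set \<Rightarrow> real" and h :: "'a \<Rightarrow> real"
  assumes G: "uniform_hypergraph k G"
  shows "(\<Sum>v\<in>verts G. h v * (\<Sum>e | e \<in> edges G \<and> v \<in> e. g e)) = (\<Sum>e\<in>edges G. g e * (\<Sum>v\<in>e. h v))"
proof -
  note f = uniform_finite[OF G]
  have "(\<Sum>v\<in>verts G. h v * (\<Sum>e | e \<in> edges G \<and> v \<in> e. g e))
      = (\<Sum>v\<in>verts G. \<Sum>e | e \<in> edges G \<and> v \<in> e. h v * g e)"
    by (simp add: sum_distrib_left)
  also have "\<dots> = (\<Sum>e\<in>edges G. \<Sum>v | v \<in> verts G \<and> v \<in> e. h v * g e)"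
    by (rule sum.swap_restrict[OF f(1,2)])
  also have "\<dots> = (\<Sum>e\<in>edges G. g e * (\<Sum>v\<in>e. h v))"
  proof (rule sum.cong[OF refl])
    fix e assume "e \<in> edges G"
    then have "{v. v \<in> verts G \<and> v \<in> e} = e" using f(4) by auto
    then show "(\<Sum>v | v \<in> verts G \<and> v \<in> e. h v * g e) = g e * (\<Sum>v\<in>e. h v)"
      by (simp add: sum_distrib_left mult.commute)
  qed
  finally show ?thesis .
qed

lemma sum_degree_swap:
  fixes g :: "'a set \<Rightarrow> real"
  assumes G: "uniform_hypergraph k G"
  shows "(\<Sum>v\<in>verts G. \<Sum>e | e \<in> edges G \<and> v \<in> e. g e) = real k * (\<Sum>e\<in>edges G. g e)"
proof -
  have "(\<Sum>e\<in>edges G. g e * (\<Sum>v\<in>e. 1)) = (\<Sum>e\<in>edges G. g e * real k)"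
    by (rule sum.cong) (use uniform_finite(5)[OF G] in auto)
  then show ?thesis
    using sum_vertex_edge_swap[OF G, of "\<lambda>_. 1" g] by (simp add: sum_distrib_left mult.commute)
qed

section \<open>Variational bounds in terms of vertex weights\<close>

lemma spectral_radius_bound:
  assumes G: "uniform_hypergraph k G" and k: "k \<ge> 2" and ne: "verts G \<noteq> {}"
    and y: "\<forall>v\<in>verts G. 0 \<le> y v"
  shows "real k * (\<Sum>e\<in>edges G. gmean k y e) \<le> spectral_radius k G * (\<Sum>v\<in>verts G. y v)"
proof -
  obtain x where b: "\<forall>y. (\<forall>v\<in>verts G. 0 \<le> y v) \<longrightarrow> real k * (\<Sum>e\<in>edges G. \<Prod>v\<in>e. y v)
       \<le> spectral_radius k G * (\<Sum>v\<in>verts G. y v ^ k)"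
    by (rule spectral_radius_variational[OF G k ne])
  have "(\<Sum>v\<in>verts G. root k (y v) ^ k) = (\<Sum>v\<in>verts G. y v)"
    by (rule sum.cong) (use y k in \<open>auto simp: real_root_pow_pos2\<close>)
  then show ?thesis
    using b[rule_format, of "\<lambda>v. root k (y v)"] y k by (simp add: gmean_eq_prod_root)
qed

text \<open>Equality in the bound makes \<open>y\<close> a maximiser, and maximisers are critical
  points.\<close>

lemma spectral_radius_extremal:
  assumes G: "uniform_hypergraph k G" and k: "k \<ge> 2" and ne: "verts G \<noteq> {}"
    and y: "\<forall>v\<in>verts G. 0 \<le> y v"
    and eq: "real k * (\<Sum>e\<in>edges G. gmean k y e) = spectral_radius k G * (\<Sum>v\<in>verts G. y v)"
    and i: "i \<in> verts G"
  shows "load k G y i = spectral_radius k G * y i"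
proof -
  let ?x = "\<lambda>v. root k (y v)"
  obtain x where b: "\<forall>y. (\<forall>v\<in>verts G. 0 \<le> y v) \<longrightarrow> real k * (\<Sum>e\<in>edges G. \<Prod>v\<in>e. y v)
       \<le> spectral_radius k G * (\<Sum>v\<in>verts G. y v ^ k)"
    by (rule spectral_radius_variational[OF G k ne])
  have xk: "?x v ^ k = y v" if "v \<in> verts G" for v
    using y k that by (simp add: real_root_pow_pos2)
  have "(\<Sum>e | e \<in> edges G \<and> i \<in> e. \<Prod>w\<in>e - {i}. ?x w) = spectral_radius k G * ?x i ^ (k - 1)"
    using G by (intro edge_form_critical[OF _ k _ _ b _ i])
      (use y eq xk k in \<open>auto simp: uniform_hypergraph_def gmean_eq_prod_root\<close>)
  then have "(\<Sum>e | e \<in> edges G \<and> i \<in> e. \<Prod>w\<in>e - {i}. ?x w) * ?x i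
      = spectral_radius k G * (?x i ^ (k - 1) * ?x i)" by simp
  moreover have "?x i ^ (k-1) * ?x i = y i"
    using xk[OF i] k by (cases k) (auto simp: mult.commute)
  moreover have "(\<Sum>e | e \<in> edges G \<and> i \<in> e. \<Prod>w\<in>e - {i}. ?x w) * ?x i
      = load k G y i"
    unfolding sum_distrib_right
    by (rule sum.cong[OF refl])
      (use k uniform_finite(3)[OF G] in \<open>auto simp: gmean_eq_prod_root prod.remove mult.commute\<close>)
  ultimately show ?thesis by simp
qed

definition perron :: "nat \<Rightarrow> 'a hypergraph \<Rightarrow> ('a \<Rightarrow> real) \<Rightarrow> bool" where
  "perron k G y \<longleftrightarrow> (\<forall>v\<in>verts G. 0 < y v) \<and>
     (\<forall>v\<in>verts G. load k G y v = spectral_radius k G * y v)"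

text \<open>A maximiser cannot vanish on part of a connected hypergraph: some edge crosses the zero
  set \<open>Z\<close>, and raising its \<open>j\<close> zero coordinates to \<epsilon> gains order
  \<open>\<epsilon> ^ j\<close> with \<open>j < k\<close>, while the norm grows only by order
  \<open>\<epsilon> ^ k\<close>.\<close>

lemma perron_exists:
  assumes G: "uniform_hypergraph k G" and k: "k \<ge> 2" and conn: "hg_connected G"
  obtains y where "perron k G y"
proof -
  let ?V = "verts G" and ?E = "edges G"
  note f = uniform_finite[OF G]
  have ne: "?V \<noteq> {}" using conn by (simp add: hg_connected_def)
  obtain x where x: "\<forall>v. 0 \<le> x v" "(\<Sum>v\<in>?V. x v ^ k) = 1"
    and c: "spectral_radius k G = real k * (\<Sum>e\<in>?E. \<Prod>v\<in>e. x v)"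
    and b: "\<forall>y. (\<forall>v\<in>?V. 0 \<le> y v) \<longrightarrow> real k * (\<Sum>e\<in>?E. \<Prod>v\<in>e. y v)
       \<le> spectral_radius k G * (\<Sum>v\<in>?V. y v ^ k)"
    by (rule spectral_radius_variational[OF G k ne])
  define Z where "Z = {v \<in> ?V. x v = 0}"
  have Z: "Z = {}"
  proof (rule ccontr)
    assume Zne: "Z \<noteq> {}"
    have "Z \<noteq> ?V"
    proof
      assume "Z = ?V"
      then have "(\<Sum>v\<in>?V. x v ^ k) = 0" using k by (intro sum.neutral) (auto simp: Z_def)
      then show False using x by simp
    qed
    moreover have "\<forall>e\<in>?E. e \<subseteq> ?V" "Z \<subseteq> ?V" using f by (auto simp: Z_def)
    ultimately obtain e where e: "e \<in> ?E" "\<not> e \<subseteq> Z" "e \<inter> Z \<noteq> {}"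
      using hg_connected_cross[OF _ conn _ Zne] by metis
    have sub: "e \<subseteq> ?V" and fe: "finite e" and ce: "card e = k" using e f by auto
    define c0 where "c0 = (\<Prod>v\<in>e - Z. x v)"
    have "x v > 0" if "v \<in> e - Z" for v
    proof -
      have "x v \<noteq> 0" using that sub by (auto simp: Z_def)
      then show ?thesis using x(1)[rule_format, of v] by linarith
    qed
    then have c0: "c0 > 0" unfolding c0_def by (intro prod_pos) auto
    define \<rho> where "\<rho> = spectral_radius k G"
    have rho0: "\<rho> \<ge> 0" unfolding \<rho>_def c
      by (intro mult_nonneg_nonneg sum_nonneg prod_nonneg) (use x in auto)
    \<comment> \<open>\<open>\<epsilon> \<le> 1\<close> bounds \<open>\<epsilon> ^ (k - j)\<close>
      by \<epsilon>, and \<open>\<rho> * \<epsilon> < c0\<close> makes the gain win.\<close>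
    define \<epsilon> where "\<epsilon> = min 1 (c0 / (\<rho> + 1))"
    have eps: "\<epsilon> > 0" "\<epsilon> \<le> 1" "\<epsilon> \<le> c0 / (\<rho> + 1)" using c0 rho0 by (auto simp: \<epsilon>_def)
    define j where "j = card (e \<inter> Z)"
    have j: "1 \<le> j" "j < k"
      using e fe ce psubset_card_mono[of e "e \<inter> Z"] by (auto simp: j_def Suc_le_eq card_gt_0_iff)
    define y where "y = (\<lambda>v. if v \<in> e \<inter> Z then \<epsilon> else x v)"
    have yx: "x v \<le> y v" "0 \<le> y v" for v using eps x by (auto simp: y_def Z_def)
    have Pe: "(\<Prod>v\<in>e. y v) = \<epsilon> ^ j * c0"
    proof -
      have "(\<Prod>v\<in>e. y v) = (\<Prod>v\<in>e - Z. y v) * (\<Prod>v\<in>e \<inter> Z. y v)"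
        using prod.Int_Diff[OF fe, of y Z] by (simp add: mult.commute)
      moreover have "(\<Prod>v\<in>e - Z. y v) = c0" unfolding c0_def by (rule prod.cong) (auto simp: y_def)
      moreover have "(\<Prod>v\<in>e \<inter> Z. y v) = (\<Prod>v\<in>e \<inter> Z. \<epsilon>)" by (rule prod.cong) (auto simp: y_def)
      ultimately show ?thesis by (simp add: j_def)
    qed
    have "(\<Prod>v\<in>e. x v) = 0" using e fe by (auto simp: Z_def prod_zero_iff)
    moreover have "(\<Sum>g\<in>?E-{e}. \<Prod>v\<in>g. x v) \<le> (\<Sum>g\<in>?E-{e}. \<Prod>v\<in>g. y v)"
      by (intro sum_mono prod_mono) (use x yx in auto)
    ultimately have P: "(\<Sum>g\<in>?E. \<Prod>v\<in>g. x v) + \<epsilon> ^ j * c0 \<le> (\<Sum>g\<in>?E. \<Prod>v\<in>g. y v)"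
      using sum.remove[OF f(2) e(1), of "\<lambda>g. \<Prod>v\<in>g. x v"]
        sum.remove[OF f(2) e(1), of "\<lambda>g. \<Prod>v\<in>g. y v"] Pe by simp
    have N: "(\<Sum>v\<in>?V. y v ^ k) = 1 + real j * \<epsilon> ^ k"
    proof -
      have "(\<Sum>v\<in>?V. y v ^ k) = (\<Sum>v\<in>?V. x v ^ k + (if v \<in> e \<inter> Z then \<epsilon> ^ k else 0))"
        by (rule sum.cong) (use k in \<open>auto simp: y_def Z_def zero_power\<close>)
      also have "\<dots> = 1 + (\<Sum>v\<in>?V. if v \<in> e \<inter> Z then \<epsilon> ^ k else 0)"
        using x by (simp add: sum.distrib)
      also have "(\<Sum>v\<in>?V. if v \<in> e \<inter> Z then \<epsilon> ^ k else 0) = (\<Sum>v\<in>{v\<in>?V. v \<in> e \<inter> Z}. \<epsilon> ^ k)"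
        by (rule sum.inter_filter[symmetric, OF f(1)])
      also have "{v\<in>?V. v \<in> e \<inter> Z} = e \<inter> Z" using sub by auto
      finally show ?thesis by (simp add: j_def)
    qed
    have "real k * (\<Sum>g\<in>?E. \<Prod>v\<in>g. y v) \<le> \<rho> * (1 + real j * \<epsilon> ^ k)"
      using b[rule_format, of y] yx N by (simp add: \<rho>_def)
    moreover have "\<rho> + real k * (\<epsilon> ^ j * c0) \<le> real k * (\<Sum>g\<in>?E. \<Prod>v\<in>g. y v)"
      using mult_left_mono[OF P, of "real k"] by (simp add: \<rho>_def c algebra_simps)
    ultimately have "real k * (\<epsilon> ^ j * c0) \<le> \<rho> * (real j * \<epsilon> ^ k)"
      by (simp add: algebra_simps)
    moreover have "\<epsilon> ^ k = \<epsilon> ^ j * \<epsilon> ^ (k - j)" using j by (simp flip: power_add)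
    ultimately have "\<epsilon> ^ j * (real k * c0) \<le> \<epsilon> ^ j * (\<rho> * (real j * \<epsilon> ^ (k-j)))"
      by (simp add: algebra_simps)
    then have "real k * c0 \<le> \<rho> * (real j * \<epsilon> ^ (k-j))" using eps by simp
    also have "\<dots> \<le> \<rho> * (real j * \<epsilon> ^ 1)"
      by (intro mult_left_mono power_decreasing) (use eps j rho0 in auto)
    also have "\<dots> \<le> \<rho> * (real j * (c0 / (\<rho> + 1)))"
      using eps rho0 by (intro mult_left_mono) auto
    also have "\<dots> = real j * (\<rho> / (\<rho> + 1) * c0)" by simp
    also have "\<dots> \<le> real j * (1 * c0)"
      using rho0 c0 by (intro mult_left_mono mult_right_mono) auto
    also have "\<dots> < real k * c0" using j c0 by simp
    finally show False by simp
  qed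
  have pos: "\<forall>v\<in>?V. 0 < x v ^ k"
  proof
    fix v assume "v \<in> ?V"
    then have "x v \<noteq> 0" using Z by (auto simp: Z_def)
    then have "x v > 0" using x(1)[rule_format, of v] by linarith
    then show "0 < x v ^ k" by simp
  qed
  have gm: "gmean k (\<lambda>v. x v ^ k) e = (\<Prod>v\<in>e. x v)" for e
    using k x by (simp add: gmean_eq_prod_root real_root_power_cancel)
  have "perron k G (\<lambda>v. x v ^ k)"
    unfolding perron_def
  proof (intro conjI ballI)
    fix v assume v: "v \<in> ?V"
    show "load k G (\<lambda>v. x v ^ k) v = spectral_radius k G * x v ^ k"
      by (rule spectral_radius_extremal[OF G k ne _ _ v])
        (use pos x c in \<open>auto simp: gm order_less_imp_le\<close>)
  qed (use pos in auto)
  then show ?thesis by (rule that)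
qed

lemma perron_total:
  assumes G: "uniform_hypergraph k G" and y: "perron k G y"
  shows "real k * (\<Sum>e\<in>edges G. gmean k y e) = spectral_radius k G * (\<Sum>v\<in>verts G. y v)"
  using sum_degree_swap[OF G, of "gmean k y"] y by (simp add: perron_def sum_distrib_left)

text \<open>The totals alone give a weak inequality. In the equality case \<open>y\<close> would be
  extremal and satisfy all eigenvalue equations, which the vertex \<open>i\<close>
  contradicts.\<close>

lemma spectral_radius_less_test_vector:
  assumes G: "uniform_hypergraph k G" and k: "k \<ge> 2"
    and y: "\<forall>v\<in>verts G. 0 < y v"
    and le: "\<rho> * (\<Sum>v\<in>verts G. y v) \<le> real k * (\<Sum>e\<in>edges G. gmean k y e)"
    and i: "i \<in> verts G" "load k G y i \<noteq> \<rho> * y i"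
  shows "\<rho> < spectral_radius k G"
proof (rule ccontr)
  assume "\<not> ?thesis"
  then have le': "spectral_radius k G \<le> \<rho>" by simp
  have ne: "verts G \<noteq> {}" using i by auto
  have y0: "\<forall>v\<in>verts G. 0 \<le> y v" using y by (auto simp: less_imp_le)
  have pos: "(\<Sum>v\<in>verts G. y v) > 0"
    by (rule sum_pos) (use uniform_finite(1)[OF G] ne y in auto)
  have b: "real k * (\<Sum>e\<in>edges G. gmean k y e) \<le> spectral_radius k G * (\<Sum>v\<in>verts G. y v)"
    by (rule spectral_radius_bound[OF G k ne y0])
  then have "\<rho> * (\<Sum>v\<in>verts G. y v) \<le> spectral_radius k G * (\<Sum>v\<in>verts G. y v)" using le by simp
  then have "spectral_radius k G = \<rho>" using le' pos by simp
  then have "load k G y i = \<rho> * y i"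
    using spectral_radius_extremal[OF G k ne y0 _ i(1)] b le by simp
  then show False using i by simp
qed

text \<open>After rescaling to product 1 it is \<open>ln t \<le> t - 1\<close>, summed over the
  edge.\<close>

lemma arith_gmean:
  assumes e: "finite e" "card e = k" and k: "k > 0" and a: "\<forall>v\<in>e. 0 < a v"
  shows "real k * gmean k a e \<le> (\<Sum>v\<in>e. a v)"
proof -
  let ?t = "gmean k a e"
  have t: "?t > 0" using gmean_pos k a by blast
  have "(\<Prod>v\<in>e. a v / ?t) = (\<Prod>v\<in>e. a v) / ?t ^ k" using e by (simp add: prod_dividef)
  also have "\<dots> = 1" using gmean_pow[of k e a] t k a by (metis div_self less_imp_le order_less_irrefl zero_less_power)
  finally have "ln (\<Prod>v\<in>e. a v / ?t) = 0" by simp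
  then have "0 = (\<Sum>v\<in>e. ln (a v / ?t))" using e a t by (subst (asm) ln_prod) auto
  also have "\<dots> \<le> (\<Sum>v\<in>e. a v / ?t - 1)"
    by (intro sum_mono ln_le_minus_one) (use a t in auto)
  also have "\<dots> = (\<Sum>v\<in>e. a v) / ?t - real k"
    using e by (simp add: sum_subtractf sum_divide_distrib)
  finally show ?thesis using t by (simp add: field_simps)
qed

text \<open>An upper bound of Collatz-Wielandt type: the Perron vector \<open>z\<close> is compared
  with \<open>y\<close> through the ratios \<open>z v / y v\<close>, to which the
  arithmetic-geometric mean inequality is applied on each edge, weighted by
  \<open>gmean k y e\<close>. Positivity of \<open>z\<close> carries the one strict inequality over
  to the sum.\<close>

lemma spectral_radius_less_supersolution:
  assumes G: "uniform_hypergraph k G" and k: "k \<ge> 2" and conn: "hg_connected G"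
    and y: "\<forall>v\<in>verts G. 0 < y v"
    and le: "\<forall>v\<in>verts G. load k G y v \<le> \<rho> * y v"
    and i: "i \<in> verts G" "load k G y i < \<rho> * y i"
  shows "spectral_radius k G < \<rho>"
proof -
  note f = uniform_finite[OF G]
  obtain z where z: "perron k G z" by (rule perron_exists[OF G k conn])
  have zp: "0 < z v" if "v \<in> verts G" for v using z that by (simp add: perron_def)
  have "spectral_radius k G * (\<Sum>v\<in>verts G. z v) = real k * (\<Sum>e\<in>edges G. gmean k z e)"
    using perron_total[OF G z] by simp
  also have "\<dots> = (\<Sum>e\<in>edges G. real k * gmean k z e)" by (rule sum_distrib_left)
  also have "\<dots> \<le> (\<Sum>e\<in>edges G. gmean k y e * (\<Sum>v\<in>e. z v / y v))"
  proof (rule sum_mono)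
    fix e assume e: "e \<in> edges G"
    have sub: "e \<subseteq> verts G" using f e by auto
    have "gmean k z e = gmean k (\<lambda>v. y v * (z v / y v)) e"
      by (rule gmean_cong) (use y sub in \<open>auto simp: less_imp_neq[symmetric]\<close>)
    also have "\<dots> = gmean k y e * gmean k (\<lambda>v. z v / y v) e"
      by (simp add: gmean_def prod.distrib real_root_mult flip: times_divide_eq_right)
    finally have "real k * gmean k z e = gmean k y e * (real k * gmean k (\<lambda>v. z v / y v) e)" by simp
    also have "\<dots> \<le> gmean k y e * (\<Sum>v\<in>e. z v / y v)"
      by (intro mult_left_mono arith_gmean gmean_nonneg)
        (use e f k sub y zp in \<open>auto simp: less_imp_le subset_iff\<close>)
    finally show "real k * gmean k z e \<le> gmean k y e * (\<Sum>v\<in>e. z v / y v)" .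
  qed
  also have "\<dots> = (\<Sum>v\<in>verts G. z v / y v * load k G y v)"
    by (rule sum_vertex_edge_swap[OF G, symmetric])
  also have "\<dots> < (\<Sum>v\<in>verts G. z v / y v * (\<rho> * y v))"
  proof (rule sum_strict_mono_ex1[OF f(1)])
    show "\<forall>v\<in>verts G. z v / y v * load k G y v \<le> z v / y v * (\<rho> * y v)"
    proof
      fix v assume v: "v \<in> verts G"
      show "z v / y v * load k G y v \<le> z v / y v * (\<rho> * y v)"
        by (rule mult_left_mono) (use le y zp[OF v] v in \<open>auto simp: less_imp_le\<close>)
    qed
    show "\<exists>v\<in>verts G. z v / y v * load k G y v < z v / y v * (\<rho> * y v)"
      by (rule bexI[OF _ i(1)], rule mult_strict_left_mono) (use i zp y in auto)
  qed
  also have "\<dots> = \<rho> * (\<Sum>v\<in>verts G. z v)"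
    unfolding sum_distrib_left by (rule sum.cong) (use y in \<open>auto simp: less_imp_neq[symmetric]\<close>)
  finally have "spectral_radius k G * (\<Sum>v\<in>verts G. z v) < \<rho> * (\<Sum>v\<in>verts G. z v)" .
  moreover have "(\<Sum>v\<in>verts G. z v) \<ge> 0" by (intro sum_nonneg) (use zp in \<open>auto simp: less_imp_le\<close>)
  ultimately show ?thesis by (meson mult_less_cancel_right not_less)
qed

section \<open>Moving an edge in a unicyclic hypergraph\<close>

text \<open>An edge crossing a set adds at most \<open>k - 1\<close> new vertices. \<open>Q\<close>
  retains just this count, and a largest set with \<open>Q\<close> cannot be crossed by an edge, so
  it is the whole vertex set.\<close>

lemma connected_card_verts_le:
  assumes G: "uniform_hypergraph k G" and k: "k \<ge> 1" and conn: "hg_connected G"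
  shows "card (verts G) \<le> (k - 1) * card (edges G) + 1"
proof -
  let ?V = "verts G" and ?E = "edges G"
  note f = uniform_finite[OF G]
  obtain u where u: "u \<in> ?V" using conn by (auto simp: hg_connected_def)
  define Q where "Q = (\<lambda>X. X \<subseteq> ?V \<and> X \<noteq> {} \<and> (\<exists>F\<subseteq>?E. \<Union>F \<subseteq> X \<and> card X \<le> (k-1) * card F + 1))"
  have "Q {u}" unfolding Q_def using u by (auto intro!: exI[of _ "{}"])
  moreover have "\<forall>X. Q X \<longrightarrow> card X \<le> card ?V" unfolding Q_def using f(1) by (auto intro: card_mono)
  ultimately obtain X where X: "Q X" and mx: "\<forall>Y. Q Y \<longrightarrow> card Y \<le> card X"
    using ex_has_greatest_nat[of Q "{u}" card "Suc (card ?V)"] by (auto simp: less_Suc_eq_le)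
  obtain F where F: "F \<subseteq> ?E" "\<Union>F \<subseteq> X" "card X \<le> (k-1) * card F + 1"
    and XV: "X \<subseteq> ?V" "X \<noteq> {}" using X unfolding Q_def by auto
  have fin: "finite X" "finite F" using XV F f finite_subset by metis+
  have XV': "X = ?V"
  proof (rule ccontr)
    assume "X \<noteq> ?V"
    then obtain e where e: "e \<in> ?E" "\<not> e \<subseteq> X" "e \<inter> X \<noteq> {}"
      using hg_connected_cross[OF _ conn XV] f(4) by metis
    have eF: "e \<notin> F" using e F by auto
    have fe: "finite e" "card e = k" "e \<subseteq> ?V" using e f by auto
    have "card (e - X) < card e" using e fe by (intro psubset_card_mono) auto
    moreover have "card (X \<union> e) = card X + card (e - X)"
      using card_Un_disjoint[of X "e - X"] fin fe by (simp add: Un_Diff_cancel)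
    ultimately have "card (X \<union> e) \<le> (k-1) * card (insert e F) + 1"
      using F fe fin eF by simp
    then have "Q (X \<union> e)" unfolding Q_def using F e XV fe
      by (intro conjI exI[of _ "insert e F"]) auto
    then have "card (X \<union> e) \<le> card X" using mx by blast
    moreover have "card X < card (X \<union> e)" using e fin fe by (intro psubset_card_mono) auto
    ultimately show False by simp
  qed
  have "card F \<le> card ?E" using F(1) f(2) by (intro card_mono)
  then have "(k-1) * card F \<le> (k-1) * card ?E" by (rule mult_le_mono2)
  then show ?thesis using F(3) unfolding XV' by linarith
qed

text \<open>Two vertices are linked if no union of connected components separates them; this avoids
  manipulating paths.\<close>

definition linked :: "'a set set \<Rightarrow> 'a \<Rightarrow> 'a \<Rightarrow> bool" where
  "linked E u w \<longleftrightarrow> (\<forall>X. splits E X \<longrightarrow> (u \<in> X \<longleftrightarrow> w \<in> X))"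

lemma linked_edge: "e \<in> E \<Longrightarrow> u \<in> e \<Longrightarrow> w \<in> e \<Longrightarrow> linked E u w"
  unfolding linked_def splits_def by blast

text \<open>If \<open>e\<close> missed all vertices that stay linked to \<open>u\<close> after its
  deletion, these vertices would form a cut of \<open>G\<close>.\<close>

lemma linked_endpoint_exists:
  assumes G: "uniform_hypergraph k G" and k: "k \<ge> 1" and conn: "hg_connected G"
    and e: "e \<in> edges G" and u: "u \<in> verts G"
  obtains v where "v \<in> e" "linked (edges G - {e}) u v"
proof -
  let ?V = "verts G" and ?E = "edges G"
  note f = uniform_finite[OF G]
  define R where "R = {w \<in> ?V. linked (?E - {e}) u w}"
  have "e \<inter> R \<noteq> {}"
  proof
    assume eR: "e \<inter> R = {}"
    have ne: "e \<noteq> {}" using f(5)[OF e] k by auto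
    have "R \<subseteq> ?V" "R \<noteq> {}" "R \<noteq> ?V"
      using u eR ne f(4)[OF e] by (auto simp: R_def linked_def)
    then obtain g where g: "g \<in> ?E" "\<not> g \<subseteq> R" "g \<inter> R \<noteq> {}"
      using hg_connected_cross[OF _ conn] f(4) by metis
    then obtain a b where ab: "a \<in> g" "a \<in> R" "b \<in> g" "b \<notin> R" by auto
    have "g \<in> ?E - {e}" using g eR by auto
    then have "linked (?E - {e}) a b" using ab linked_edge by metis
    moreover have "b \<in> ?V" using ab g f(4) by auto
    ultimately show False using ab by (auto simp: R_def linked_def)
  qed
  then show ?thesis using that by (auto simp: R_def)
qed

definition move_edge :: "'a hypergraph \<Rightarrow> 'a set \<Rightarrow> 'a \<Rightarrow> 'a \<Rightarrow> 'a hypergraph" where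
  "move_edge G e v t = \<lparr>verts = verts G, edges = insert (insert t (e - {v})) (edges G - {e})\<rparr>"

text \<open>After deleting \<open>e\<close> no cut separates \<open>t\<close> from \<open>v\<close>,
  so every cut of the new hypergraph is one of the old. Were the new edge already present,
  \<open>G\<close> without \<open>e\<close> would be connected with m-1 edges, too few for (k-1)m
  vertices when k is at least 3.\<close>

lemma move_edge_unicyclic:
  assumes G: "unicyclic k G" and k: "k \<ge> 3" and e: "e \<in> edges G" "v \<in> e"
    and t: "t \<in> verts G" "t \<notin> e" and lk: "linked (edges G - {e}) t v"
  shows "insert t (e - {v}) \<notin> edges G" "unicyclic k (move_edge G e v t)"
proof -
  let ?V = "verts G" and ?E = "edges G" and ?e = "insert t (e - {v})"
  have U: "uniform_hypergraph k G" and conn: "hg_connected G"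
    and cnt: "int (card ?V) - 1 = (int k - 1) * int (card ?E) - 1"
    using G by (auto simp: unicyclic_def)
  note f = uniform_finite[OF U]
  have ce: "card ?e = k" using e f t k by (simp add: card_insert_if)
  have cE: "card (?E - {e}) = card ?E - 1" "card ?E \<ge> 1"
    using e f by (auto simp: card_gt_0_iff Suc_le_eq)
  have conn': "?V \<noteq> {} \<and> (\<forall>X\<subseteq>?V. splits ?E X \<longrightarrow> X = {} \<or> X = ?V)"
    using hg_connected_iff[of G] f(4) conn by blast
  have both: "splits ?E X" if X: "splits (insert ?e (?E - {e})) X" for X
  proof -
    have s: "splits (?E - {e}) X" "?e \<subseteq> X \<or> ?e \<inter> X = {}" using X by (auto simp: splits_def)
    then have "t \<in> X \<longleftrightarrow> v \<in> X" using lk by (auto simp: linked_def)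
    then have "e \<subseteq> X \<or> e \<inter> X = {}" using s(2) by blast
    then show ?thesis using s(1) by (auto simp: splits_def)
  qed
  show new: "?e \<notin> ?E"
  proof
    assume eE: "?e \<in> ?E"
    let ?H = "\<lparr>verts = ?V, edges = ?E - {e}\<rparr>"
    have "?e \<noteq> e" using t by auto
    then have "insert ?e (?E - {e}) = ?E - {e}" using eE by auto
    then have "\<forall>X\<subseteq>?V. splits (?E - {e}) X \<longrightarrow> X = {} \<or> X = ?V" using both conn' by metis
    then have "hg_connected ?H" using conn' f(4) by (subst hg_connected_iff) auto
    moreover have "uniform_hypergraph k ?H" using U by (auto simp: uniform_hypergraph_def)
    ultimately have "card ?V \<le> (k-1) * (card ?E - 1) + 1"
      using connected_card_verts_le[of k ?H] k cE by simp
    then have "int (card ?V) \<le> int ((k-1) * (card ?E - 1) + 1)" by (rule zle_int[THEN iffD2])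
    also have "\<dots> = (int k - 1) * (int (card ?E) - 1) + 1" using k cE by (simp add: of_nat_diff)
    finally show False using cnt k by (simp add: algebra_simps)
  qed
  have "uniform_hypergraph k (move_edge G e v t)"
    using U e t ce by (auto simp: uniform_hypergraph_def move_edge_def)
  moreover have "hg_connected (move_edge G e v t)"
    using conn' both f(4) e t by (subst hg_connected_iff) (auto simp: move_edge_def)
  moreover have "card (insert ?e (?E - {e})) = card ?E" using new cE f by simp
  ultimately show "unicyclic k (move_edge G e v t)"
    using cnt by (auto simp: unicyclic_def move_edge_def)
qed

text \<open>The old Perron vector serves as test vector: the total does not drop because
  \<open>y v \<le> y t\<close>, and strictness comes from \<open>t\<close>, whose load grows by the
  value of the new edge.\<close>

lemma move_edge_spectral_radius:
  assumes G: "uniform_hypergraph k G" and k: "k \<ge> 2" and y: "perron k G y"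
    and e: "e \<in> edges G" "v \<in> e"
    and t: "t \<in> verts G" "t \<notin> e" and new: "insert t (e - {v}) \<notin> edges G"
    and le: "y v \<le> y t"
  shows "spectral_radius k G < spectral_radius k (move_edge G e v t)"
proof -
  let ?V = "verts G" and ?E = "edges G" and ?e = "insert t (e - {v})"
  note f = uniform_finite[OF G]
  have pos: "\<forall>v\<in>?V. 0 < y v" using y by (simp add: perron_def)
  have U: "uniform_hypergraph k (move_edge G e v t)"
    using G e t f(3)[OF e(1)] k by (auto simp: uniform_hypergraph_def move_edge_def card_insert_if)
  have fe: "finite e" "e \<subseteq> ?V" using f e by auto
  have "(\<Prod>w\<in>e. y w) = y v * (\<Prod>w\<in>e - {v}. y w)" using fe e by (simp add: prod.remove)
  also have "\<dots> \<le> y t * (\<Prod>w\<in>e - {v}. y w)"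
    using le by (intro mult_right_mono prod_nonneg) (use fe pos in \<open>auto simp: less_imp_le subset_iff\<close>)
  also have "\<dots> = (\<Prod>w\<in>?e. y w)" using fe t by simp
  finally have ge: "gmean k y e \<le> gmean k y ?e" unfolding gmean_def using k by simp
  have ep: "gmean k y ?e > 0" by (rule gmean_pos) (use k fe pos t in \<open>auto simp: subset_iff\<close>)
  have "(\<Sum>g\<in>insert ?e (?E - {e}). gmean k y g) \<ge> (\<Sum>g\<in>?E. gmean k y g)"
    using f(2) new ge sum.remove[OF f(2) e(1), of "gmean k y"] by simp
  then have tot: "real k * (\<Sum>g\<in>?E. gmean k y g) \<le> real k * (\<Sum>g\<in>insert ?e (?E - {e}). gmean k y g)"
    by (rule mult_left_mono) simp
  have "{g. g \<in> insert ?e (?E - {e}) \<and> t \<in> g} = insert ?e {g. g \<in> ?E \<and> t \<in> g}" using t by auto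
  then have deg: "(\<Sum>g | g \<in> insert ?e (?E - {e}) \<and> t \<in> g. gmean k y g)
      = gmean k y ?e + spectral_radius k G * y t"
    using new f(2) y t by (simp add: perron_def)
  show ?thesis
    by (rule spectral_radius_less_test_vector[OF U k, of y _ t])
      (use tot deg ep pos t perron_total[OF G y] in \<open>auto simp: move_edge_def\<close>)
qed

section \<open>The star of a vertex of maximal weight\<close>

lemma pairwise_disjnt_insertI:
  assumes "\<And>g. g \<in> N \<Longrightarrow> disjnt e g" "pairwise disjnt N"
  shows "pairwise disjnt (insert e N)"
  unfolding pairwise_insert using assms by (simp add: disjnt_sym)

lemma matching_number_ge:
  assumes "finite (edges G)" "hg_matching G M"
  shows "card M \<le> matching_number G"
proof -
  have "{card M | M. hg_matching G M} \<subseteq> card ` Pow (edges G)" by (auto simp: hg_matching_def)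
  then have "finite {card M | M. hg_matching G M}" using assms by (meson finite_Pow_iff finite_imageI finite_subset)
  then show ?thesis unfolding matching_number_def using assms by (intro Max_ge) auto
qed

lemma matching_number_attained:
  assumes "finite (edges G)" "z \<le> matching_number G"
  obtains M where "hg_matching G M" "card M = z"
proof -
  have "{card M | M. hg_matching G M} \<subseteq> card ` Pow (edges G)" by (auto simp: hg_matching_def)
  then have "finite {card M | M. hg_matching G M}" using assms by (meson finite_Pow_iff finite_imageI finite_subset)
  moreover have "hg_matching G {}" by (simp add: hg_matching_def)
  ultimately have "matching_number G \<in> {card M | M. hg_matching G M}"
    unfolding matching_number_def by (intro Max_in) auto
  then obtain M where M: "hg_matching G M" "card M = matching_number G" by auto
  then obtain N where "N \<subseteq> M" "card N = z" using assms obtain_subset_with_card_n[of z M] by metis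
  then show ?thesis using that[of N] M by (auto simp: hg_matching_def intro: pairwise_subset)
qed

locale extremal_unicyclic =
  fixes k n z :: nat and G :: "'a hypergraph"
  assumes k: "k \<ge> 3" and z: "z \<ge> 1"
    and G: "G \<in> unicyclic_matching_class n k z"
    and G_max: "\<forall>G' \<in> (unicyclic_matching_class n k z :: 'a hypergraph set). spectral_radius k G' \<le> spectral_radius k G"
begin

abbreviation "V \<equiv> verts G"
abbreviation "E \<equiv> edges G"
abbreviation "\<rho> \<equiv> spectral_radius k G"

lemma uni: "unicyclic k G" and cardV: "card V = n"
  using G by (auto simp: unicyclic_matching_class_def)

lemma U: "uniform_hypergraph k G" and conn: "hg_connected G"
  using uni by (auto simp: unicyclic_def)

lemmas fin = uniform_finite[OF U]

lemma k2: "k \<ge> 2" using k by simp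

lemma count: "card V = (k - 1) * card E"
proof -
  have "int (card V) = (int k - 1) * int (card E)" using uni by (simp add: unicyclic_def)
  also have "\<dots> = int ((k-1) * card E)" using k by (simp add: of_nat_diff)
  finally show ?thesis by (metis of_nat_eq_iff)
qed

lemma not_better:
  fixes G' :: "'a hypergraph"
  assumes "unicyclic k G'" "card (verts G') = n" "hg_matching G' M" "z \<le> card M"
  shows "spectral_radius k G' \<le> \<rho>"
proof -
  have "z \<le> matching_number G'"
    using matching_number_ge[OF _ assms(3)] assms(1,4) uniform_finite(2)[of k G']
    by (fastforce simp: unicyclic_def)
  then show ?thesis using assms G_max by (auto simp: unicyclic_matching_class_def)
qed

lemma no_move:
  assumes "perron k G y" "e \<in> E" "v \<in> e" "t \<in> V" "t \<notin> e" "linked (E - {e}) t v" "y v \<le> y t"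
    and M: "hg_matching (move_edge G e v t) M" "z \<le> card M"
  shows False
proof -
  note m = move_edge_unicyclic[OF uni k assms(2-6)]
  have "\<rho> < spectral_radius k (move_edge G e v t)"
    by (rule move_edge_spectral_radius[OF U k2 assms(1-5) m(1) assms(7)])
  moreover have "spectral_radius k (move_edge G e v t) \<le> \<rho>"
    by (rule not_better[OF m(2) _ M]) (simp add: move_edge_def cardV)
  ultimately show False by simp
qed

text \<open>An edge may be moved to \<open>u\<close> only if a matching of size \<open>z\<close>
  survives. An edge outside \<open>M\<close> leaves \<open>M\<close> alone, and an edge of
  \<open>M\<close> can be replaced by its image as long as \<open>M\<close> does not cover
  \<open>u\<close>. Hence \<open>M\<close> consists of \<open>e0\<close> and all edges avoiding
  \<open>u\<close>.\<close>

lemma star_structure: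
  obtains y u e0 where "perron k G y" "u \<in> V" "\<forall>v\<in>V. y v \<le> y u" "e0 \<in> E" "u \<in> e0"
    "pairwise disjnt (insert e0 {e \<in> E. u \<notin> e})" "card {e \<in> E. u \<notin> e} = z - 1"
proof -
  obtain y where y: "perron k G y" by (rule perron_exists[OF U k2 conn])
  have ne: "V \<noteq> {}" using conn by (simp add: hg_connected_def)
  obtain u where u: "u \<in> V" "\<forall>v\<in>V. y v \<le> y u"
    using fin(1) ne Max_in[of "y ` V"] Max_ge[of "y ` V"] by fastforce
  obtain M where M: "hg_matching G M" "card M = z"
    using matching_number_attained[OF fin(2)] G by (auto simp: unicyclic_matching_class_def)
  have ME: "M \<subseteq> E" "pairwise disjnt M" using M by (auto simp: hg_matching_def)
  \<comment> \<open>Connectedness dictates which endpoint \<open>v\<close> may be detached, so a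
    matching has to be supplied for every \<open>v\<close> in \<open>e\<close>.\<close>
  have mv: False if e: "e \<in> E" "u \<notin> e"
    and M': "\<And>v. v \<in> e \<Longrightarrow> \<exists>M'. hg_matching (move_edge G e v u) M' \<and> z \<le> card M'" for e
  proof -
    obtain v where v: "v \<in> e" "linked (E - {e}) u v"
      by (rule linked_endpoint_exists[OF U _ conn e(1) u(1)]) (use k in auto)
    have "y v \<le> y u" using v e fin(4) u by auto
    then show False using no_move[OF y e(1) v(1) u(1) e(2) v(2)] M'[OF v(1)] by blast
  qed
  have star: "u \<in> e" if "e \<in> E" "e \<notin> M" for e
  proof (rule ccontr)
    assume "u \<notin> e"
    moreover have "hg_matching (move_edge G e v u) M" for v
      using ME that by (auto simp: hg_matching_def move_edge_def)
    ultimately show False using mv[OF that(1)] M by blast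
  qed
  have "\<exists>e0\<in>M. u \<in> e0"
  proof (rule ccontr)
    assume no: "\<not> ?thesis"
    have "M \<noteq> {}" using M z by auto
    then obtain e where e: "e \<in> M" by auto
    have "\<exists>M'. hg_matching (move_edge G e v u) M' \<and> z \<le> card M'" if v: "v \<in> e" for v
    proof (intro exI conjI)
      let ?M = "insert (insert u (e - {v})) (M - {e})"
      have "disjnt (insert u (e - {v})) g" if "g \<in> M - {e}" for g
        using that no ME(2) e by (auto simp: pairwise_def disjnt_def)
      then show "hg_matching (move_edge G e v u) ?M"
        using ME by (auto simp: hg_matching_def move_edge_def pairwise_insert disjnt_sym
            intro: pairwise_subset)
      have "insert u (e - {v}) \<notin> M" using no by auto
      then have "card ?M = card M"
        using e M z by (metis DiffD1 card.remove card_insert_disjoint card_gt_0_iff finite_Diff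
            less_le_trans zero_less_one)
      then show "z \<le> card ?M" using M by simp
    qed
    then show False using mv[of e] e ME no by blast
  qed
  then obtain e0 where e0: "e0 \<in> M" "u \<in> e0" by auto
  have MF: "M = insert e0 {e \<in> E. u \<notin> e}"
  proof (intro set_eqI iffI)
    fix e assume e: "e \<in> M"
    show "e \<in> insert e0 {e \<in> E. u \<notin> e}"
      using e e0 ME by (auto simp: pairwise_def disjnt_def)
  qed (use star e0 in auto)
  moreover have "card M = Suc (card {e \<in> E. u \<notin> e})"
    using fin(2) e0 by (subst MF) (simp add: card_insert_if)
  ultimately show ?thesis
    using that[OF y u, of e0] e0 ME M by auto
qed

end

section \<open>Local estimates for a Perron vector\<close>

lemma perron_edge_pos:
  assumes G: "uniform_hypergraph k G" and k: "k > 0" and y: "perron k G y" and e: "e \<in> edges G"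
  shows "0 < gmean k y e"
  by (rule gmean_pos) (use k y e uniform_finite(4)[OF G] in \<open>auto simp: perron_def subset_iff\<close>)

lemma perron_edge_le:
  assumes G: "uniform_hypergraph k G" and k: "k > 0" and y: "perron k G y"
    and F: "F \<subseteq> {e. e \<in> edges G \<and> v \<in> e}" and v: "v \<in> verts G"
  shows "(\<Sum>e\<in>F. gmean k y e) \<le> spectral_radius k G * y v"
proof -
  have "(\<Sum>e\<in>F. gmean k y e) \<le> load k G y v"
    by (rule sum_mono2)
      (use F uniform_finite(2)[OF G] perron_edge_pos[OF G k y] in \<open>auto simp: less_imp_le\<close>)
  then show ?thesis using y v by (simp add: perron_def)
qed

lemma perron_radius_pos:
  assumes G: "uniform_hypergraph k G" and k: "k > 0" and y: "perron k G y" and e: "e \<in> edges G"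
  shows "0 < spectral_radius k G"
proof -
  have "e \<noteq> {}" using uniform_finite(5)[OF G e] k by auto
  then obtain v where v: "v \<in> e" "v \<in> verts G" using uniform_finite(4)[OF G e] by auto
  have "gmean k y e \<le> spectral_radius k G * y v"
    using perron_edge_le[OF G k y, of "{e}" v] v e by simp
  then have "0 < spectral_radius k G * y v" using perron_edge_pos[OF G k y e] by simp
  moreover have "y v > 0" using y v by (simp add: perron_def)
  ultimately show ?thesis by (simp add: zero_less_mult_iff)
qed

text \<open>Each of the other \<open>k - 1\<close> vertices of \<open>e\<close> carries at least the
  value of the edge divided by the radius, while the product of all \<open>k\<close> weights is the
  \<open>k\<close>-th power of that value.\<close>

lemma perron_neighbour:
  assumes G: "uniform_hypergraph k G" and k: "k > 0" and y: "perron k G y"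
    and e: "e \<in> edges G" "u \<in> e"
  shows "y u \<le> spectral_radius k G ^ (k - 1) * gmean k y e"
proof -
  let ?r = "spectral_radius k G" and ?g = "gmean k y e"
  note f = uniform_finite[OF G]
  have r: "?r > 0" by (rule perron_radius_pos[OF G k y e(1)])
  have g: "?g > 0" by (rule perron_edge_pos[OF G k y e(1)])
  have sub: "e \<subseteq> verts G" and fe: "finite e" and ce: "card e = k" using f e by auto
  have pos: "y v > 0" if "v \<in> e" for v using that sub y by (auto simp: perron_def)
  have "(\<Prod>v\<in>e - {u}. ?g / ?r) \<le> (\<Prod>v\<in>e - {u}. y v)"
  proof (rule prod_mono)
    fix v assume v: "v \<in> e - {u}"
    then have "?g \<le> ?r * y v" using perron_edge_le[OF G k y, of "{e}" v] sub e by auto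
    then show "0 \<le> ?g / ?r \<and> ?g / ?r \<le> y v" using r g by (simp add: field_simps)
  qed
  then have le: "(?g / ?r) ^ (k-1) \<le> (\<Prod>v\<in>e - {u}. y v)" using fe ce e by simp
  have "y u * (?g / ?r) ^ (k-1) \<le> y u * (\<Prod>v\<in>e - {u}. y v)"
    using le pos[OF e(2)] by simp
  also have "\<dots> = ?g ^ k" using gmean_pow[of k e y] k pos fe e by (simp add: prod.remove less_imp_le)
  also have "\<dots> = ?g * ?g ^ (k-1)" using k by (cases k) auto
  finally have "y u * ?g ^ (k-1) / ?r ^ (k-1) \<le> ?g * ?g ^ (k-1)" by (simp add: power_divide)
  then have "(y u / ?r ^ (k-1)) * ?g ^ (k-1) \<le> ?g * ?g ^ (k-1)" by simp
  then have "y u / ?r ^ (k-1) \<le> ?g" using g by (meson mult_right_le_imp_le zero_less_power)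
  then show ?thesis using r by (simp add: field_simps)
qed

text \<open>A second edge at \<open>v\<close> keeps the value of \<open>e\<close> strictly below the
  radius times \<open>y v\<close>; with \<open>perron_neighbour\<close> the \<open>k\<close>-th
  power of the radius exceeds 1.\<close>

lemma perron_radius_gt_1:
  assumes G: "uniform_hypergraph k G" and k: "k > 0" and y: "perron k G y"
    and e: "e \<in> edges G" "g \<in> edges G" "e \<noteq> g" "v \<in> e" "v \<in> g"
  shows "spectral_radius k G > 1"
proof -
  let ?r = "spectral_radius k G"
  have v: "v \<in> verts G" using e uniform_finite(4)[OF G] by auto
  have r: "?r > 0" by (rule perron_radius_pos[OF G k y e(1)])
  have "gmean k y e + gmean k y g \<le> ?r * y v"
    using perron_edge_le[OF G k y, of "{e,g}" v] v e by simp
  then have "gmean k y e < ?r * y v" using perron_edge_pos[OF G k y e(2)] by simp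
  then have "?r ^ (k-1) * gmean k y e < ?r ^ (k-1) * (?r * y v)" using r by simp
  then have "y v < ?r ^ (k-1) * (?r * y v)"
    using perron_neighbour[OF G k y e(1,4)] by simp
  also have "\<dots> = ?r ^ k * y v" using k by (cases k) auto
  finally have "1 < ?r ^ k" using y v by (simp add: perron_def)
  then show ?thesis using r by (meson less_imp_le not_less power_le_one)
qed

lemma hub_connected:
  assumes "\<forall>e\<in>edges G. e \<subseteq> verts G" "verts G \<subseteq> \<Union>(edges G)" "u \<in> verts G"
    and "\<forall>e\<in>edges G. u \<in> e \<or> (\<exists>g\<in>edges G. u \<in> g \<and> g \<inter> e \<noteq> {})"
  shows "hg_connected G"
proof (subst hg_connected_iff[OF assms(1)], intro conjI allI impI)
  fix X assume X: "X \<subseteq> verts G" "splits (edges G) X"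
  have star: "g \<subseteq> X \<longleftrightarrow> u \<in> X" "g \<inter> X \<noteq> {} \<longleftrightarrow> u \<in> X" if "g \<in> edges G" "u \<in> g" for g
  proof -
    have "g \<subseteq> X \<or> g \<inter> X = {}" using X(2) that(1) by (simp add: splits_def)
    then show "g \<subseteq> X \<longleftrightarrow> u \<in> X" "g \<inter> X \<noteq> {} \<longleftrightarrow> u \<in> X" using that(2) by auto
  qed
  have side: "x \<in> X \<longleftrightarrow> u \<in> X" if e: "e \<in> edges G" "x \<in> e" for e x
  proof -
    have s: "e \<subseteq> X \<or> e \<inter> X = {}" using X(2) e(1) by (simp add: splits_def)
    obtain x' where x': "x' \<in> e" "x' \<in> X \<longleftrightarrow> u \<in> X"
    proof (cases "u \<in> e")
      case False
      then obtain g x' where g: "g \<in> edges G" "u \<in> g" "x' \<in> g" "x' \<in> e" using assms(4) e(1) by blast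
      then have "x' \<in> X \<longleftrightarrow> u \<in> X" using star[OF g(1,2)] by blast
      then show ?thesis using that g(4) by blast
    qed (use that in blast)
    then show ?thesis using s e(2) by blast
  qed
  have "x \<in> X \<longleftrightarrow> u \<in> X" if "x \<in> verts G" for x
    using side assms(2) that by blast
  then show "X = {} \<or> X = verts G" using X(1) by (cases "u \<in> X") blast+
qed (use assms in auto)

locale extremal_star = extremal_unicyclic k n z G
  for k n z :: nat and G :: "'a hypergraph" +
  fixes y :: "'a \<Rightarrow> real" and u :: 'a and e0 :: "'a set"
  assumes y: "perron k G y" and u: "u \<in> V" "\<forall>v\<in>V. y v \<le> y u" and e0: "e0 \<in> E" "u \<in> e0"
    and M: "pairwise disjnt (insert e0 {e \<in> E. u \<notin> e})" and cardF: "card {e \<in> E. u \<notin> e} = z - 1"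
begin

abbreviation "star \<equiv> {e \<in> E. u \<in> e}"
abbreviation "F \<equiv> {e \<in> E. u \<notin> e}"
abbreviation "S \<equiv> \<Union>star"

lemma finite_star_F: "finite star" "finite F" "finite S"
  using fin by auto

lemma F_disjoint: "f \<in> F \<Longrightarrow> g \<in> F \<Longrightarrow> f \<noteq> g \<Longrightarrow> f \<inter> g = {}"
  and F_e0: "f \<in> F \<Longrightarrow> f \<inter> e0 = {}"
  using M e0(2) by (auto simp: pairwise_def disjnt_def)

lemma card_matching: "card (insert e0 F) = z"
  using finite_star_F(2) e0 cardF z by simp

text \<open>Edges of \<open>F\<close> are pairwise disjoint, so an edge joining \<open>f\<close> to
  the rest passes through \<open>u\<close>.\<close>

lemma F_meets_star:
  assumes "f \<in> F"
  obtains e x where "e \<in> star" "x \<in> e" "x \<in> f"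
proof -
  have "f \<subseteq> V" "f \<noteq> {}" "f \<noteq> V" using assms fin(4,5)[of f] u k by auto
  then obtain e where e: "e \<in> E" "\<not> e \<subseteq> f" "e \<inter> f \<noteq> {}"
    using hg_connected_cross[OF _ conn] fin(4) by metis
  then have "u \<in> e" using F_disjoint[OF assms, of e] by auto
  then show ?thesis using that e by auto
qed

lemma verts_covered: "V = S \<union> \<Union>F"
proof
  show "V \<subseteq> S \<union> \<Union>F"
  proof
    fix v assume v: "v \<in> V"
    show "v \<in> S \<union> \<Union>F"
    proof (rule ccontr)
      assume no: "v \<notin> S \<union> \<Union>F"
      have "{v} \<noteq> V"
      proof
        assume "{v} = V"
        then have "card e0 \<le> 1" using fin(4)[OF e0(1)] by (metis card_mono card.empty card_insert_disjoint empty_iff finite.emptyI finite.insertI One_nat_def)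
        then show False using fin(5)[OF e0(1)] k by simp
      qed
      then obtain e where "e \<in> E" "e \<inter> {v} \<noteq> {}"
        using hg_connected_cross[OF _ conn, of "{v}"] fin(4) v by (metis empty_subsetI insert_not_empty insert_subset)
      then show False using no by auto
    qed
  qed
qed (use fin(4) in auto)

text \<open>The excesses measure the distance from a hypertree. Starting from \<open>u\<close>,
  every edge contributes \<open>k - 1\<close> vertices up to the overlaps counted here, so
  \<open>card V\<close> is \<open>(k - 1) * card E + 1\<close> minus this sum; for a unicyclic
  hypergraph the sum is therefore 1.\<close>

lemma excess_count:
  "(\<Sum>f\<in>F. card (f \<inter> S) - 1) + (\<Sum>v\<in>S - {u}. card {e \<in> star. v \<in> e} - 1) = 1"
proof -
  note fs = finite_star_F
  let ?d = "\<lambda>v. card {e \<in> star. v \<in> e}"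
  have ffin: "finite f" "card f = k" if "f \<in> E" for f using fin that by auto
  have "(\<Sum>v\<in>S - {u}. ?d v) = (\<Sum>v\<in>S - {u}. \<Sum>e | e \<in> star \<and> v \<in> e. 1)" by simp
  also have "\<dots> = (\<Sum>e\<in>star. \<Sum>v | v \<in> S - {u} \<and> v \<in> e. 1)"
    by (rule sum.swap_restrict) (use fs in auto)
  also have "\<dots> = (\<Sum>e\<in>star. k - 1)"
  proof (rule sum.cong[OF refl])
    fix e assume e: "e \<in> star"
    then have "{v. v \<in> S - {u} \<and> v \<in> e} = e - {u}" by auto
    then show "(\<Sum>v | v \<in> S - {u} \<and> v \<in> e. 1) = k - 1" using e ffin[of e] by simp
  qed
  finally have 1: "(\<Sum>v\<in>S - {u}. ?d v) = (k-1) * card star" by simp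
  \<comment> \<open>The truncated difference is exact since each vertex of \<open>S\<close> lies in
    a star edge. Fact 6 needs the same care, and there \<open>F_meets_star\<close> supplies the
    common vertex.\<close>
  have 2: "(\<Sum>v\<in>S - {u}. ?d v) = (\<Sum>v\<in>S - {u}. ?d v - 1) + card (S - {u})"
  proof -
    have "?d v = (?d v - 1) + 1" if "v \<in> S - {u}" for v
    proof -
      have "finite {e \<in> star. v \<in> e}" "{e \<in> star. v \<in> e} \<noteq> {}" using fs(1) that by (auto intro: finite_subset[OF _ fs(1)])
      then show ?thesis by (simp add: card_gt_0_iff Suc_le_eq)
    qed
    then have "(\<Sum>v\<in>S - {u}. ?d v) = (\<Sum>v\<in>S - {u}. (?d v - 1) + 1)" by (rule sum.cong[OF refl])
    then show ?thesis by (simp only: sum.distrib card_eq_sum)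
  qed
  have 3: "card S = card (S - {u}) + 1"
    using e0 fs by (subst card.remove[of S u]) auto
  have 4: "card V = card S + (\<Sum>f\<in>F. card (f - S))"
  proof -
    have "V = S \<union> (\<Union>f\<in>F. f - S)" using verts_covered by auto
    moreover have "finite (\<Union>f\<in>F. f - S)" using fs(2) ffin by auto
    moreover have "S \<inter> (\<Union>f\<in>F. f - S) = {}" by auto
    ultimately have "card V = card S + card (\<Union>f\<in>F. f - S)"
      using card_Un_disjoint[OF fs(3), of "\<Union>f\<in>F. f - S"] by simp
    also have "card (\<Union>f\<in>F. f - S) = (\<Sum>f\<in>F. card (f - S))"
      by (rule card_UN_disjoint) (use fs ffin F_disjoint in blast)+
    finally show ?thesis .
  qed
  have 5: "(\<Sum>f\<in>F. card (f - S)) + (\<Sum>f\<in>F. card (f \<inter> S)) = k * card F"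
  proof -
    have "(\<Sum>f\<in>F. card (f - S)) + (\<Sum>f\<in>F. card (f \<inter> S)) = (\<Sum>f\<in>F. card (f - S) + card (f \<inter> S))"
      by (simp add: sum.distrib)
    also have "\<dots> = (\<Sum>f\<in>F. k)"
    proof (rule sum.cong[OF refl])
      fix f assume "f \<in> F"
      then show "card (f - S) + card (f \<inter> S) = k"
        using ffin[of f] card_Int_Diff[of f S] by simp
    qed
    finally show ?thesis by simp
  qed
  have 6: "(\<Sum>f\<in>F. card (f \<inter> S)) = (\<Sum>f\<in>F. card (f \<inter> S) - 1) + card F"
  proof -
    have "card (f \<inter> S) = (card (f \<inter> S) - 1) + 1" if fF: "f \<in> F" for f
    proof -
      obtain e x where "e \<in> star" "x \<in> e" "x \<in> f" by (rule F_meets_star[OF fF])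
      then have "f \<inter> S \<noteq> {}" by auto
      then show ?thesis using fs by (simp add: card_gt_0_iff Suc_le_eq)
    qed
    then have "(\<Sum>f\<in>F. card (f \<inter> S)) = (\<Sum>f\<in>F. (card (f \<inter> S) - 1) + 1)" by (rule sum.cong[OF refl])
    then show ?thesis by (simp only: sum.distrib card_eq_sum)
  qed
  have "E = star \<union> F" by auto
  then have "card E = card star + card F" using card_Un_disjoint[of star F] fs by force
  then have 7: "card V = (k-1) * card star + (k-1) * card F" using count by (simp add: algebra_simps)
  have "k * card F = (k-1) * card F + card F" using k by (cases k) auto
  then show ?thesis using 1 2 3 4 5 6 7 by linarith
qed

text \<open>Together with \<open>u\<close> the edges \<open>a\<close>, \<open>f\<close>,
  \<open>b\<close> form a triangle. The star edge at the lighter of \<open>p\<close>,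
  \<open>q\<close> is moved to the heavier one, while \<open>f\<close> keeps the two linked. As
  \<open>a\<close> and \<open>b\<close> meet \<open>f\<close>, neither is \<open>e0\<close>, so the
  matching is untouched.\<close>

lemma no_cycle_of_length_3:
  assumes f: "f \<in> F" "p \<in> f" "q \<in> f" and ab: "a \<in> star" "b \<in> star" "a \<noteq> b" "p \<in> a" "q \<in> b"
    "p \<notin> b" "q \<notin> a"
  shows False
proof -
  have no: False if g: "g \<in> star" "x \<in> f" "x' \<in> f" "x \<in> g" "x' \<in> V" "x' \<notin> g" "y x \<le> y x'" for g x x'
  proof (rule no_move[OF y _ g(4,5,6) _ g(7)])
    show "g \<in> E" using g by simp
    show "linked (E - {g}) x' x" by (rule linked_edge[of f]) (use f g in auto)
    have "g \<noteq> e0" using F_e0[OF f(1)] g by auto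
    then show "hg_matching (move_edge G g x x') (insert e0 F)"
      using M g e0 by (auto simp: hg_matching_def move_edge_def)
  qed (simp add: card_matching)
  have "p \<in> V" "q \<in> V" using f fin(4) by auto
  then show False
    using no[of b q p] no[of a p q] f ab by (meson linear)
qed

text \<open>The 2-cycle \<open>a, f1\<close> through \<open>p, q\<close> is replaced by the 2-cycle \<open>a, e1\<close> through \<open>u, q\<close>, with
  \<open>e1 = e0 - r + q\<close> and \<open>f2 = f1 - q + r\<close> for a vertex \<open>r\<close> of \<open>e0\<close>. The Perron vector itself need not
  witness the gain: the weights of the vertices of degree one of \<open>e1\<close> and \<open>f2\<close> are recomputed
  from their eigenvalue equations.\<close>

lemma no_cycle_off_centre:
  assumes star: "\<forall>e\<in>star. \<forall>e'\<in>star. e \<noteq> e' \<longrightarrow> e \<inter> e' = {u}"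
    and f1: "f1 \<in> F" "f1 \<inter> S = {p, q}" "p \<noteq> q" and a: "a \<in> star" "p \<in> a" "q \<in> a"
  shows False
proof -
  have k0: "k > 0" using k by simp
  obtain r where r: "r \<in> e0" "r \<noteq> u"
    using fin(3,5)[OF e0(1)] k by (metis One_nat_def card.empty card_insert_disjoint empty_iff finite.emptyI
        insert_iff is_singletonI' is_singleton_altdef not_numeral_le_zero numeral_le_one_iff semiring_norm(70) e0(2) One_nat_def)
  have pq: "p \<in> f1" "q \<in> f1" "p \<in> S" "q \<in> S" using f1 by auto
  have f1E: "f1 \<in> E" "u \<notin> f1" and aE: "a \<in> E" "u \<in> a" using f1 a by auto
  have ae0: "a \<noteq> e0" "p \<notin> e0" "q \<notin> e0" using F_e0[OF f1(1)] pq a by auto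
  have df: "f1 \<inter> e0 = {}" by (rule F_e0[OF f1(1)])
  have rf: "r \<notin> f1" using df r by auto
  have only_e0: "e = e0" if "e \<in> E" "x \<in> e" "x \<in> e0" "x \<noteq> u" for e x
    using star F_e0 that e0 by (cases "u \<in> e") blast+
  have only_f1: "e = f1" if "e \<in> E" "x \<in> e" "x \<in> f1" "x \<noteq> p" "x \<noteq> q" for e x
    using F_disjoint[OF f1(1)] f1 that by (cases "u \<in> e") blast+
  have only_pq: "e = f1 \<or> e = a" if "e \<in> E" "x \<in> e" "x \<in> {p,q}" for e x
  proof (cases "u \<in> e")
    case True
    then show ?thesis using star that a f1E pq by (metis (no_types, lifting) IntI empty_iff insert_iff mem_Collect_eq)
  next
    case False
    then show ?thesis using F_disjoint[OF f1(1), of e] that pq by auto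
  qed
  define Y where "Y = y p"
  have pos: "0 < y v" if "v \<in> V" for v using y that by (simp add: perron_def)
  have eqn: "load k G y v = \<rho> * y v" if "v \<in> V" for v
    using y that by (simp add: perron_def)
  have V: "p \<in> V" "q \<in> V" "u \<in> V" "r \<in> V" using f1E fin(4) pq u e0 r by auto
  have rho: "\<rho> > 1"
    by (rule perron_radius_gt_1[OF U k0 y f1E(1) aE(1), of p]) (use f1E aE a pq in auto)
  define g0 where "g0 = gmean k y e0"
  define gF where "gF = gmean k y f1"
  have gpos: "g0 > 0" "gF > 0" "gmean k y a > 0"
    using perron_edge_pos[OF U k0 y] e0 f1E aE by (auto simp: g0_def gF_def)
  have y0: "\<rho> * y x = g0" if "x \<in> e0 - {u}" for x
  proof -
    have "{e. e \<in> E \<and> x \<in> e} = {e0}" using only_e0 that e0 by auto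
    moreover have "x \<in> V" using fin(4)[OF e0(1)] that by auto
    ultimately show ?thesis using eqn[of x] by (simp add: g0_def)
  qed
  have yF: "\<rho> * y x = gF" if "x \<in> f1 - {p,q}" for x
  proof -
    have "{e. e \<in> E \<and> x \<in> e} = {f1}" using only_f1 that f1E by auto
    moreover have "x \<in> V" using fin(4)[OF f1E(1)] that by auto
    ultimately show ?thesis using eqn[of x] by (simp add: gF_def)
  qed
  have yp: "\<rho> * y x = gF + gmean k y a" if "x \<in> {p,q}" for x
  proof -
    have "{e. e \<in> E \<and> x \<in> e} = {f1, a}" using only_pq that f1E aE pq a by auto
    moreover have "f1 \<noteq> a" using f1E aE by auto
    moreover have "x \<in> V" using that V by auto
    ultimately show ?thesis using eqn[of x] by (simp add: gF_def)
  qed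
  have "\<rho> * y p = \<rho> * y q" using yp by simp
  then have yq: "y p = Y" "y q = Y" using rho by (auto simp: Y_def)
  have Ypos: "Y > 0" using pos V by (simp add: Y_def)
  \<comment> \<open>The vertices of degree one in an edge share one weight, so the value of the edge
    is fixed by its other vertices. In terms of \<open>c\<close> and of the square roots
    \<open>g\<close>, \<open>h\<close> below, all edge values involved become monomials.\<close>
  define c where "c = 1 / sqrt (\<rho> ^ k)"
  have c: "c > 0" "\<rho> ^ k * c\<^sup>2 = 1" using rho by (auto simp: c_def power_divide)
  have "c < 1"
  proof -
    have "\<rho> ^ k > 1" using rho k by (simp add: one_less_power)
    then show ?thesis by (simp add: c_def)
  qed
  define g where "g = sqrt (y u)"
  define h where "h = sqrt Y"
  have gh: "g > 0" "h > 0" "g\<^sup>2 = y u" "h\<^sup>2 = Y" "h \<le> g"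
    using pos V Ypos u(2) by (auto simp: g_def h_def less_imp_le Y_def)
  have kk: "\<rho> ^ k = \<rho> * \<rho> ^ (k-1)" "\<rho> ^ (k-1) = \<rho> * \<rho> ^ (k-2)"
  proof -
    obtain j where "k = Suc (Suc j)" using k by (metis Suc_diff_Suc numeral_2_eq_2 k2 le_add_diff_inverse plus_nat.simps(2) add_0)
    then show "\<rho> ^ k = \<rho> * \<rho> ^ (k-1)" "\<rho> ^ (k-1) = \<rho> * \<rho> ^ (k-2)" by simp_all
  qed
  have fine: "finite e0" "card e0 = k" "finite f1" "card f1 = k" using fin e0 f1E by auto
  \<comment> \<open>All vertices of \<open>e0\<close> except \<open>u\<close> have degree one and
    weight \<open>g0 / \<rho>\<close>, which leaves an equation for \<open>g0\<close> alone. For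
    \<open>f1\<close> the exceptions are \<open>p\<close> and \<open>q\<close>.\<close>
  have g0': "g0 = \<rho> * c\<^sup>2 * g\<^sup>2"
  proof -
    have "g0 ^ k = (\<Prod>v\<in>e0. y v)"
      unfolding g0_def by (rule gmean_pow) (use k0 pos e0 fin(4) in \<open>auto simp: less_imp_le subset_iff\<close>)
    also have "\<dots> = y u * (\<Prod>v\<in>e0 - {u}. y v)" using fine e0 by (simp add: prod.remove)
    also have "(\<Prod>v\<in>e0 - {u}. y v) = (\<Prod>v\<in>e0 - {u}. g0 / \<rho>)"
      by (rule prod.cong) (use y0 rho in \<open>auto simp: field_simps\<close>)
    also have "\<dots> = (g0 / \<rho>) ^ (k-1)" using fine e0 by simp
    finally have "g0 * g0 ^ (k-1) = y u * (g0 / \<rho>) ^ (k-1)" using k0 by (cases k) auto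
    then have "g0 * g0 ^ (k-1) = (y u / \<rho> ^ (k-1)) * g0 ^ (k-1)" by (simp add: power_divide)
    then have "g0 = y u / \<rho> ^ (k-1)"
      using gpos(1) by (metis less_irrefl mult_right_cancel zero_less_power)
    moreover have "\<rho> * c\<^sup>2 = 1 / \<rho> ^ (k-1)" using c(2) kk(1) rho by (simp add: field_simps)
    ultimately show ?thesis using gh by simp
  qed
  have gF': "gF = \<rho> * c * h\<^sup>2"
  proof -
    have "gF ^ k = (\<Prod>v\<in>f1. y v)"
      unfolding gF_def by (rule gmean_pow) (use k0 pos f1E fin(4) in \<open>auto simp: less_imp_le subset_iff\<close>)
    also have "\<dots> = Y * Y * (\<Prod>v\<in>f1 - {p,q}. y v)"
      using fine pq f1(3) yq prod.remove[of f1 p y] prod.remove[of "f1 - {p}" q y]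
      by (simp add: Diff_insert2[symmetric] insert_commute)
    also have "(\<Prod>v\<in>f1 - {p,q}. y v) = (\<Prod>v\<in>f1 - {p,q}. gF / \<rho>)"
      by (rule prod.cong) (use yF rho in \<open>auto simp: field_simps\<close>)
    also have "\<dots> = (gF / \<rho>) ^ (k-2)" using fine pq f1(3) by (simp add: card_Diff_subset numeral_2_eq_2)
    finally have "gF ^ k = Y * Y * (gF / \<rho>) ^ (k-2)" .
    moreover have "gF ^ k = gF\<^sup>2 * gF ^ (k-2)" using k by (metis le_add_diff_inverse power_add k2)
    ultimately have "gF\<^sup>2 * gF ^ (k-2) = (Y * Y / \<rho> ^ (k-2)) * gF ^ (k-2)" by (simp add: power_divide)
    then have "gF\<^sup>2 = Y * Y / \<rho> ^ (k-2)"
      using gpos(2) by (metis less_irrefl mult_right_cancel zero_less_power)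
    moreover have "\<rho>\<^sup>2 * c\<^sup>2 = 1 / \<rho> ^ (k-2)"
      using c(2) kk rho by (simp add: field_simps power2_eq_square)
    ultimately have "gF\<^sup>2 = (\<rho>\<^sup>2 * c\<^sup>2) * (Y * Y)" by simp
    then have "gF\<^sup>2 = (\<rho> * c * h\<^sup>2)\<^sup>2"
      unfolding gh(4) by (simp add: power_mult_distrib power2_eq_square[of Y])
    moreover have "0 \<le> \<rho> * c * h\<^sup>2" using rho c by simp
    ultimately show ?thesis using gpos(2) by (meson less_imp_le power2_eq_iff_nonneg)
  qed
  \<comment> \<open>\<open>E1\<close> and \<open>F1\<close> are the values that \<open>e1\<close>
    (with \<open>u\<close>, \<open>q\<close> and \<open>k - 2\<close> vertices of degree one) and
    \<open>f2\<close> (with \<open>p\<close> and \<open>k - 1\<close> of them) take when the weights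
    of \<open>u\<close>, \<open>p\<close>, \<open>q\<close> are kept.\<close>
  define E1 where "E1 = \<rho> * c * g * h"
  define F1 where "F1 = \<rho> * c\<^sup>2 * h\<^sup>2"
  have EF: "E1 > 0" "F1 > 0" using rho c gh by (auto simp: E1_def F1_def)
  \<comment> \<open>The edge \<open>a\<close> joins \<open>u\<close> to \<open>p\<close>, so
    \<open>u\<close> is heavier than \<open>p\<close> by less than the factor
    \<open>\<rho> ^ k\<close>. Both the gain and its strictness at \<open>u\<close> rest on
    this.\<close>
  have hcg: "c * g < h"
  proof -
    have "y u \<le> \<rho> ^ (k-1) * gmean k y a" by (rule perron_neighbour[OF U k0 y aE])
    also have "\<dots> < \<rho> ^ (k-1) * (\<rho> * Y)" using yp[of p] gpos rho yq by simp
    finally have "g\<^sup>2 < \<rho> ^ k * h\<^sup>2" using kk gh by (simp add: algebra_simps)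
    then have "c\<^sup>2 * g\<^sup>2 < c\<^sup>2 * (\<rho> ^ k * h\<^sup>2)" using c by simp
    also have "\<dots> = h\<^sup>2" using c(2) by (simp add: algebra_simps)
    finally have "(c * g)\<^sup>2 < h\<^sup>2" by (simp add: power_mult_distrib)
    then show ?thesis using gh(2) by (meson less_imp_le power_less_imp_less_base)
  qed
  \<comment> \<open>In the balance of \<open>k\<close> times the edge values against \<rho> times
    the weights, the vertices of degree one leave coefficients 1 and 2 for \<open>g0\<close> and
    \<open>gF\<close>, and 2 and 1 for \<open>E1\<close> and \<open>F1\<close>. The difference of
    the two sides factors as \<open>\<rho> * c * (g - h) * (2 * h - c * (g + h))\<close>.\<close>
  have gain: "g0 + 2 * gF \<le> 2 * E1 + F1"
  proof -
    have "c * (g + h) \<le> 2 * h"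
    proof -
      have "c * h \<le> 1 * h" by (rule mult_right_mono) (use \<open>c < 1\<close> gh in auto)
      then show ?thesis using hcg unfolding distrib_left by linarith
    qed
    then have "(g - h) * (c * (g + h)) \<le> (g - h) * (2 * h)"
      using gh by (intro mult_left_mono) auto
    then have "\<rho> * c * ((g - h) * (c * (g + h))) \<le> \<rho> * c * ((g - h) * (2 * h))"
      by (rule mult_left_mono) (use rho c in simp)
    then show ?thesis unfolding g0' gF' E1_def F1_def
      by (simp add: algebra_simps power2_eq_square)
  qed
  define e1 where "e1 = insert q (e0 - {r})"
  define f2 where "f2 = insert r (f1 - {q})"
  let ?R = "E - {e0, f1}"
  let ?G = "\<lparr>verts = V, edges = insert e1 (insert f2 ?R)\<rparr>"
  have ue: "u \<in> e1" "u \<notin> f2" using e0 r f1E by (auto simp: e1_def f2_def)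
  have e1E: "e1 \<notin> E"
  proof
    assume "e1 \<in> E"
    then have "e1 \<in> star" "q \<in> e1" using ue by (auto simp: e1_def)
    then have "e1 = a" using only_pq[of e1 q] f1E ue by auto
    then have "e0 - {r} \<subseteq> e0 \<inter> a" by (auto simp: e1_def)
    also have "\<dots> = {u}" using star e0 a ae0 by auto
    finally have "card (e0 - {r}) \<le> 1" using card_mono[of "{u}" "e0 - {r}"] by simp
    then show False using fine r k by simp
  qed
  have f2E: "f2 \<notin> E"
  proof
    assume "f2 \<in> E"
    then have "f2 \<in> F" using ue by auto
    moreover have "p \<in> f2" using pq f1(3) by (auto simp: f2_def)
    ultimately have "f2 = f1" using F_disjoint[OF f1(1), of f2] pq by auto
    then show False using rf by (auto simp: f2_def)
  qed
  have e1f2: "e1 \<noteq> f2" using ue by auto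
  have fR: "finite ?R" using fin by simp
  have e0f1: "e0 \<noteq> f1" using e0 f1E by auto
  have "card (insert e1 (insert f2 ?R)) = card ?R + 2" using e1E f2E e1f2 fR by simp
  also have "card ?R = card E - 2"
    using e0 f1E e0f1 fin(2) by (simp add: card_Diff_subset)
  finally have cE: "card (insert e1 (insert f2 ?R)) = card E"
    using e0 f1E e0f1 fin(2) card_mono[of E "{e0,f1}"] by simp
  have U': "uniform_hypergraph k ?G"
    using U V fine r rf ae0 e0 f1E pq k unfolding uniform_hypergraph_def e1_def f2_def
    by (auto simp: card_insert_if)
  have conn': "hg_connected ?G"
  proof (rule hub_connected[of _ u])
    show "\<forall>e\<in>edges ?G. e \<subseteq> verts ?G" using uniform_finite(4)[OF U'] by blast
    show "verts ?G \<subseteq> \<Union>(edges ?G)"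
    proof
      fix v assume v: "v \<in> verts ?G"
      then have "v \<in> S \<union> \<Union>F" using verts_covered by simp
      then obtain e where e: "e \<in> E" "v \<in> e" by auto
      have "a \<in> ?R" using ae0 f1E aE by auto
      then show "v \<in> \<Union>(edges ?G)"
        using e a by (cases "e = e0"; cases "e = f1"; cases "v = r"; cases "v = q")
          (auto simp: e1_def f2_def)
    qed
    show "\<forall>e\<in>edges ?G. u \<in> e \<or> (\<exists>g\<in>edges ?G. u \<in> g \<and> g \<inter> e \<noteq> {})"
    proof
      fix e assume e: "e \<in> edges ?G"
      have aR: "a \<in> ?R" using ae0 f1E aE by auto
      consider "u \<in> e" | "e = f2" | "e \<in> F" "e \<noteq> f1" using e ue by auto
      then show "u \<in> e \<or> (\<exists>g\<in>edges ?G. u \<in> g \<and> g \<inter> e \<noteq> {})"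
      proof cases
        case 2
        then have "a \<inter> e \<noteq> {}" using a pq f1(3) by (auto simp: f2_def)
        then show ?thesis using aR aE by auto
      next
        case 3
        obtain g x where g: "g \<in> star" "x \<in> g" "x \<in> e" by (rule F_meets_star[OF 3(1)])
        then have "g \<noteq> e0" using F_e0[OF 3(1)] by auto
        then have "g \<in> ?R" using g f1E by auto
        then show ?thesis using g by auto
      qed auto
    qed
  qed (use V in auto)
  have "unicyclic k ?G" using U' conn' cE uni by (simp add: unicyclic_def)
  moreover have "hg_matching ?G (insert e1 (insert f2 (F - {f1})))"
    unfolding hg_matching_def
  proof
    show "insert e1 (insert f2 (F - {f1})) \<subseteq> edges ?G" using e0 by auto
    have "disjnt e1 f2" using df rf ae0 r by (auto simp: disjnt_def e1_def f2_def)
    moreover have "disjnt e1 g" "disjnt f2 g" if "g \<in> F - {f1}" for g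
      using F_disjoint[OF f1(1), of g] F_e0[of g] that pq r by (auto simp: disjnt_def e1_def f2_def)
    moreover have "pairwise disjnt (F - {f1})" using M by (rule pairwise_subset) auto
    ultimately show "pairwise disjnt (insert e1 (insert f2 (F - {f1})))"
      by (intro pairwise_disjnt_insertI) auto
  qed
  moreover have "z \<le> card (insert e1 (insert f2 (F - {f1})))"
  proof -
    have "card (insert e1 (insert f2 (F - {f1}))) = card (F - {f1}) + 2"
      using e1E f2E e1f2 finite_star_F(2) by simp
    moreover have "card F = Suc (card (F - {f1}))"
      by (rule card.remove[OF finite_star_F(2) f1(1)])
    ultimately show ?thesis using cardF by simp
  qed
  ultimately have le: "spectral_radius k ?G \<le> \<rho>" by (intro not_better) (auto simp: cardV)
  define T1 where "T1 = e0 - {u, r}"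
  define T2 where "T2 = insert r (f1 - {p, q})"
  \<comment> \<open>Only the vertices of degree one in \<open>e1\<close> and \<open>f2\<close> get
    new weights; \<open>r\<close> is among them, having passed from \<open>e0\<close> to
    \<open>f2\<close>. No other edge contains such a vertex.\<close>
  define y' where "y' = (\<lambda>v. if v \<in> T1 then E1 / \<rho> else if v \<in> T2 then F1 / \<rho> else y v)"
  have T: "finite T1" "finite T2" "T1 \<inter> T2 = {}" "card T1 = k - 2" "card T2 = k - 1"
    using fine df r rf pq f1(3) e0 k by (auto simp: T1_def T2_def card_Diff_subset card_insert_if)
  have Tsub: "T1 \<union> T2 \<subseteq> V" using fin(4)[OF e0(1)] fin(4)[OF f1E(1)] V by (auto simp: T1_def T2_def)
  have TT: "T1 \<union> T2 = (e0 - {u}) \<union> (f1 - {p,q})" using r by (auto simp: T1_def T2_def)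
  have sumT: "(\<Sum>v\<in>V. w v) = (\<Sum>v\<in>V - (T1 \<union> T2). w v) + (\<Sum>v\<in>T1 \<union> T2. w v)" for w :: "'a \<Rightarrow> real"
    by (rule sum.subset_diff[OF Tsub fin(1)])
  have s1: "\<rho> * (\<Sum>v\<in>T1 \<union> T2. y' v) = real (k-2) * E1 + real (k-1) * F1"
  proof -
    have "(\<Sum>v\<in>T1 \<union> T2. y' v) = (\<Sum>v\<in>T1. y' v) + (\<Sum>v\<in>T2. y' v)"
      by (rule sum.union_disjoint) (use T in auto)
    also have "(\<Sum>v\<in>T1. y' v) = (\<Sum>v\<in>T1. E1 / \<rho>)" by (rule sum.cong) (auto simp: y'_def)
    also have "(\<Sum>v\<in>T2. y' v) = (\<Sum>v\<in>T2. F1 / \<rho>)" by (rule sum.cong) (use T in \<open>auto simp: y'_def\<close>)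
    finally show ?thesis using T rho by (simp add: field_simps)
  qed
  have s2: "\<rho> * (\<Sum>v\<in>T1 \<union> T2. y v) = real (k-1) * g0 + real (k-2) * gF"
  proof -
    have "(\<Sum>v\<in>T1 \<union> T2. y v) = (\<Sum>v\<in>e0 - {u}. y v) + (\<Sum>v\<in>f1 - {p,q}. y v)"
      unfolding TT by (rule sum.union_disjoint) (use fine df in auto)
    then have "\<rho> * (\<Sum>v\<in>T1 \<union> T2. y v) = (\<Sum>v\<in>e0 - {u}. \<rho> * y v) + (\<Sum>v\<in>f1 - {p,q}. \<rho> * y v)"
      by (simp add: distrib_left sum_distrib_left)
    also have "(\<Sum>v\<in>e0 - {u}. \<rho> * y v) = real (k-1) * g0" using y0 fine e0 by simp
    also have "(\<Sum>v\<in>f1 - {p,q}. \<rho> * y v) = real (k-2) * gF"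
      using yF fine pq f1(3) by (simp add: card_Diff_subset numeral_2_eq_2)
    finally show ?thesis .
  qed
  have s3: "(\<Sum>v\<in>V - (T1 \<union> T2). y' v) = (\<Sum>v\<in>V - (T1 \<union> T2). y v)"
    by (rule sum.cong) (auto simp: y'_def)
  have gR: "gmean k y' e = gmean k y e" if e: "e \<in> ?R" for e
  proof (rule gmean_cong)
    fix v assume v: "v \<in> e"
    have "v \<notin> e0 - {u}" using only_e0[of e v] e v by auto
    moreover have "v \<notin> f1 - {p,q}" using only_f1[of e v] e v by auto
    ultimately have "v \<notin> T1 \<union> T2" using TT by auto
    then show "y' v = y v" by (simp add: y'_def)
  qed
  have outT: "y' u = y u" "y' p = Y" "y' q = Y"
    using df f1E e0 pq r ae0 yq by (auto simp: y'_def T1_def T2_def)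
  have ge1: "gmean k y' e1 = E1"
  proof (rule gmean_eqI[OF k0])
    have e1T: "e1 = insert u (insert q T1)" using e0 r by (auto simp: e1_def T1_def)
    have "(\<Prod>v\<in>e1. y' v) = y u * (Y * (\<Prod>v\<in>T1. y' v))"
      unfolding e1T using T ae0 f1E pq outT by (subst prod.insert; auto simp: T1_def)+
    also have "(\<Prod>v\<in>T1. y' v) = (\<Prod>v\<in>T1. E1 / \<rho>)" by (rule prod.cong) (auto simp: y'_def)
    also have "\<dots> = (c * g * h) ^ (k-2)" using T rho by (simp add: E1_def mult.assoc)
    also have "y u * (Y * (c * g * h) ^ (k-2)) = (g * h)\<^sup>2 * (c * g * h) ^ (k-2)"
      using gh by (simp add: power_mult_distrib)
    also have "\<dots> = (\<rho> ^ k * c\<^sup>2) * (g * h)\<^sup>2 * (c * g * h) ^ (k-2)" using c by simp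
    also have "\<dots> = \<rho> ^ k * ((c * g * h)\<^sup>2 * (c * g * h) ^ (k-2))" by (simp add: power_mult_distrib)
    also have "(c * g * h)\<^sup>2 * (c * g * h) ^ (k-2) = (c * g * h) ^ k"
      using k by (metis k2 le_add_diff_inverse power_add)
    finally show "(\<Prod>v\<in>e1. y' v) = E1 ^ k" by (simp add: E1_def power_mult_distrib)
  qed (use EF in auto)
  have gf2: "gmean k y' f2 = F1"
  proof (rule gmean_eqI[OF k0])
    have f2T: "f2 = insert p T2" using pq f1(3) by (auto simp: f2_def T2_def)
    have "(\<Prod>v\<in>f2. y' v) = Y * (\<Prod>v\<in>T2. y' v)"
      unfolding f2T using T pq r outT ae0 by (subst prod.insert) (auto simp: T2_def)
    also have "(\<Prod>v\<in>T2. y' v) = (\<Prod>v\<in>T2. F1 / \<rho>)" by (rule prod.cong) (use T in \<open>auto simp: y'_def\<close>)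
    also have "\<dots> = (c\<^sup>2 * h\<^sup>2) ^ (k-1)" using T rho by (simp add: F1_def)
    also have "Y * (c\<^sup>2 * h\<^sup>2) ^ (k-1) = (\<rho> ^ k * c\<^sup>2) * h\<^sup>2 * (c\<^sup>2 * h\<^sup>2) ^ (k-1)" using gh c by simp
    also have "\<dots> = \<rho> ^ k * ((c\<^sup>2 * h\<^sup>2) * (c\<^sup>2 * h\<^sup>2) ^ (k-1))" by simp
    also have "(c\<^sup>2 * h\<^sup>2) * (c\<^sup>2 * h\<^sup>2) ^ (k-1) = (c\<^sup>2 * h\<^sup>2) ^ k" using k0 by (cases k) auto
    finally show "(\<Prod>v\<in>f2. y' v) = F1 ^ k" by (simp add: F1_def power_mult_distrib)
  qed (use EF in auto)
  have tot': "(\<Sum>e\<in>edges ?G. gmean k y' e) = E1 + F1 + (\<Sum>e\<in>?R. gmean k y e)"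
    using e1E f2E e1f2 fR ge1 gf2 gR by simp
  have tot: "(\<Sum>e\<in>E. gmean k y e) = g0 + gF + (\<Sum>e\<in>?R. gmean k y e)"
    using sum.remove[OF fin(2) e0(1), of "gmean k y"] e0f1 f1E fin(2)
      sum.remove[of "E - {e0}" f1 "gmean k y"]
    by (simp add: g0_def gF_def Diff_insert2[symmetric] insert_commute)
  have rk: "real (k-2) = real k - 2" "real (k-1) = real k - 1" using k by auto
  have "\<rho> < spectral_radius k ?G"
  proof (rule spectral_radius_less_test_vector[OF U' k2, of y' _ u])
    show "\<forall>v\<in>verts ?G. 0 < y' v" using pos EF rho by (auto simp: y'_def)
    have "\<rho> * (\<Sum>v\<in>V. y' v) = \<rho> * (\<Sum>v\<in>V. y v) + ((real k - 2) * E1 + (real k - 1) * F1)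
        - ((real k - 1) * g0 + (real k - 2) * gF)"
      using sumT[of y'] sumT[of y] s1 s2 s3 rk by (simp add: algebra_simps)
    also have "\<rho> * (\<Sum>v\<in>V. y v) = real k * (g0 + gF + (\<Sum>e\<in>?R. gmean k y e))"
      using perron_total[OF U y] tot by simp
    finally show "\<rho> * (\<Sum>v\<in>verts ?G. y' v) \<le> real k * (\<Sum>e\<in>edges ?G. gmean k y' e)"
      using gain tot' by (simp add: algebra_simps)
    \<comment> \<open>At \<open>u\<close> only \<open>e0\<close> is replaced by \<open>e1\<close>,
      so the load changes by \<open>E1 - g0\<close>, which is positive by
      \<open>hcg\<close>.\<close>
    have "{e. e \<in> edges ?G \<and> u \<in> e} = insert e1 (star - {e0})" using ue f1E by auto
    then have "load k ?G y' u
        = E1 + (\<Sum>e\<in>star - {e0}. gmean k y' e)"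
      using e1E finite_star_F ge1 by simp
    also have "(\<Sum>e\<in>star - {e0}. gmean k y' e) = (\<Sum>e\<in>star - {e0}. gmean k y e)"
      by (rule sum.cong[OF refl]) (use gR f1E in auto)
    finally have "load k ?G y' u = E1 + (\<rho> * y u - g0)"
      using sum.remove[OF finite_star_F(1), of e0 "gmean k y"] e0 eqn[OF V(3)] by (simp add: g0_def)
    moreover have "E1 - g0 = \<rho> * c * g * (h - c * g)"
      unfolding E1_def g0' by (simp add: algebra_simps power2_eq_square)
    moreover have "\<dots> > 0" using hcg rho c gh by simp
    ultimately show "load k ?G y' u \<noteq> \<rho> * y' u"
      unfolding outT(1) by linarith
  qed (use V in auto)
  then show False using le by simp
qed

end

section \<open>Bouquets\<close>

locale bouquet =
  \<comment> \<open>Star edges \<open>a\<close>, \<open>b\<close> (the 2-cycle) and \<open>C\<close> at \<open>u\<close>; \<open>f w\<close> is the pendant edge at \<open>w \<in> W\<close>.\<close>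
  fixes k :: nat and G :: "'a hypergraph" and u v :: 'a and a b :: "'a set" and C :: "'a set set"
    and W :: "'a set" and f :: "'a \<Rightarrow> 'a set"
  assumes k3: "k \<ge> 3"
    and finC: "finite C" and aC: "a \<notin> C" and bC: "b \<notin> C" and ab_neq: "a \<noteq> b"
    and star: "\<forall>e\<in>insert a (insert b C). card e = k \<and> u \<in> e"
    and ab: "a \<inter> b = {u, v}" and uv: "u \<noteq> v"
    and ab_C: "\<forall>c\<in>C. a \<inter> c = {u} \<and> b \<inter> c = {u}"
    and CC: "\<forall>c\<in>C. \<forall>c'\<in>C. c \<noteq> c' \<longrightarrow> c \<inter> c' = {u}"
    and W: "W \<subseteq> (a \<union> b \<union> \<Union>C) - {u}"
    and f: "\<forall>w\<in>W. card (f w) = k \<and> f w \<inter> (a \<union> b \<union> \<Union>C) = {w}"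
    and ff: "\<forall>w\<in>W. \<forall>w'\<in>W. w \<noteq> w' \<longrightarrow> f w \<inter> f w' = {}"
    and verts_G: "verts G = (a \<union> b \<union> \<Union>C) \<union> \<Union>(f ` W)"
    and edges_G: "edges G = insert a (insert b C) \<union> f ` W"
begin

abbreviation "T \<equiv> a \<union> b \<union> \<Union>C"
abbreviation "St \<equiv> insert a (insert b C)"
abbreviation "fl \<equiv> (if v \<in> W then 1 else 0 :: nat)"
abbreviation "ra \<equiv> card (W \<inter> (a - {u, v}))"
abbreviation "rb \<equiv> card (W \<inter> (b - {u, v}))"

text \<open>Up to the factor \<open>\<rho> / \<rho> ^ k\<close> this is the load of \<open>u\<close>
  in \<open>closed_form\<close>: the square comes from the two cycle edges meeting again in
  \<open>v\<close>, the sum from the other star edges.\<close>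

definition Phi :: "real \<Rightarrow> real" where
  "Phi B = B ^ fl * (sqrt B ^ ra + sqrt B ^ rb)\<^sup>2 + (\<Sum>c\<in>C. B ^ card (W \<inter> c))"

lemma finite_St: "e \<in> St \<Longrightarrow> finite e"
  using star k3 by (metis card.infinite not_numeral_le_zero)

lemma finite_T: "finite T" using finite_St finC by auto

lemma finite_W: "finite W" using W finite_T finite_subset by blast

lemma W_T: "w \<in> W \<Longrightarrow> w \<in> T" "w \<in> W \<Longrightarrow> w \<noteq> u" using W by auto

lemma pend: assumes "w \<in> W" shows "w \<in> f w" "u \<notin> f w" "finite (f w)" "card (f w) = k" "f w \<inter> T = {w}"
proof -
  show 1: "card (f w) = k" "f w \<inter> T = {w}" using f assms by auto
  then show "w \<in> f w" by auto
  show "u \<notin> f w" using 1(2) W_T[OF assms] star by auto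
  show "finite (f w)" using 1(1) k3 by (metis card.infinite not_numeral_le_zero)
qed

lemma inj_f: "inj_on f W"
proof (rule inj_onI)
  fix w w' assume w: "w \<in> W" "w' \<in> W" "f w = f w'"
  then have "f w \<inter> f w' \<noteq> {}" using pend(1)[OF w(1)] by auto
  then show "w = w'" using ff w by blast
qed

lemma pend_not_St: "w \<in> W \<Longrightarrow> f w \<notin> St"
  using pend(2) star by auto

lemma card_edges: "card (edges G) = 2 + card C + card W"
proof -
  have "card (edges G) = card St + card (f ` W)"
    unfolding edges_G by (rule card_Un_disjoint) (use finC finite_W pend_not_St in auto)
  also have "card St = 2 + card C" using finC aC bC ab_neq by simp
  finally show ?thesis using card_image[OF inj_f] by simp
qed

lemma uniform: "uniform_hypergraph k G"
  unfolding uniform_hypergraph_def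
proof
  show "finite (verts G)" unfolding verts_G using finite_T finite_W pend(3) by auto
  show "\<forall>e\<in>edges G. e \<subseteq> verts G \<and> card e = k"
    unfolding edges_G verts_G using star pend(4) by blast
qed

lemma connected: "hg_connected G"
proof (rule hub_connected[of _ u])
  show "\<forall>e\<in>edges G. e \<subseteq> verts G" using uniform by (simp add: uniform_hypergraph_def)
  show "verts G \<subseteq> \<Union>(edges G)" unfolding verts_G edges_G by auto
  show "u \<in> verts G" unfolding verts_G using star by auto
  show "\<forall>e\<in>edges G. u \<in> e \<or> (\<exists>g\<in>edges G. u \<in> g \<and> g \<inter> e \<noteq> {})"
  proof
    fix e assume "e \<in> edges G"
    then consider "e \<in> St" | w where "w \<in> W" "e = f w" unfolding edges_G by auto
    then show "u \<in> e \<or> (\<exists>g\<in>edges G. u \<in> g \<and> g \<inter> e \<noteq> {})"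
    proof cases
      case 2
      then obtain g where "g \<in> St" "w \<in> g" using W_T(1) by blast
      moreover then have "g \<inter> e \<noteq> {}" using 2 pend(1) by auto
      ultimately show ?thesis using star edges_G by blast
    qed (use star in auto)
  qed
qed

text \<open>A star edge free of \<open>W\<close> is disjoint from all pendant edges. This is how a
  redistribution of the pendant edges retains a large matching.\<close>

lemma matching:
  assumes "c \<in> St" "c \<inter> W = {}"
  shows "hg_matching G (insert c (f ` W))" "card (insert c (f ` W)) = Suc (card W)"
proof -
  have "disjnt c (f w)" if "w \<in> W" for w
  proof -
    have "c \<inter> f w \<subseteq> c \<inter> {w}" using pend(5)[OF that] assms(1) by auto
    then show ?thesis using assms(2) that by (auto simp: disjnt_def)
  qed
  moreover have "pairwise disjnt (f ` W)"
    unfolding pairwise_def disjnt_def using ff by (metis imageE)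
  ultimately have "pairwise disjnt (insert c (f ` W))"
    by (intro pairwise_disjnt_insertI) auto
  then show "hg_matching G (insert c (f ` W))"
    using assms edges_G unfolding hg_matching_def by auto
  have "c \<notin> f ` W" using pend_not_St assms(1) by auto
  then show "card (insert c (f ` W)) = Suc (card W)"
    using finite_W card_image[OF inj_f] by simp
qed

lemma St_inter:
  assumes "e \<in> St" "e' \<in> St" "e \<noteq> e'"
  shows "e \<inter> e' \<subseteq> {u, v}" "e \<in> C \<Longrightarrow> e \<inter> e' = {u}"
proof -
  consider "e \<in> C" "e' \<in> C" | "e = a \<or> e = b" "e' \<in> C" | "e \<in> C" "e' = a \<or> e' = b"
    | "e = a" "e' = b" | "e = b" "e' = a" using assms by auto
  then have "e \<inter> e' \<subseteq> {u, v} \<and> (e \<in> C \<longrightarrow> e \<inter> e' = {u})"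
  proof cases
    case 1
    then have "e \<inter> e' = {u}" using CC assms(3) by simp
    then show ?thesis by simp
  next
    case 2
    then have "e \<inter> e' = {u}" using ab_C by auto
    then show ?thesis by simp
  next
    case 3
    then have "e' \<inter> e = {u}" using ab_C by auto
    then have "e \<inter> e' = {u}" by (simp add: Int_commute)
    then show ?thesis by simp
  next
    case 4
    then show ?thesis using ab aC by simp
  next
    case 5
    then show ?thesis using ab bC by (simp add: Int_commute)
  qed
  then show "e \<inter> e' \<subseteq> {u, v}" "e \<in> C \<Longrightarrow> e \<inter> e' = {u}" by simp_all
qed

lemma St_unique:
  assumes "e \<in> St" "e' \<in> St" "x \<in> e" "x \<in> e'" "x \<noteq> u" "x \<noteq> v"
  shows "e = e'"
proof (rule ccontr)
  assume "e \<noteq> e'"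
  then have "e \<inter> e' \<subseteq> {u, v}" by (rule St_inter(1)[OF assms(1,2)])
  then show False using assms by auto
qed

lemma v_St:
  assumes "e \<in> St"
  shows "v \<in> e \<longleftrightarrow> e = a \<or> e = b"
proof
  assume v: "v \<in> e"
  show "e = a \<or> e = b"
  proof (rule ccontr)
    assume "\<not> ?thesis"
    then have "e \<inter> a = {u}" using assms by (intro St_inter(2)) auto
    moreover have "v \<in> a" using ab by auto
    ultimately show False using v uv by auto
  qed
qed (use ab in auto)

lemma pend_edges:
  assumes "x \<in> T"
  shows "{e \<in> f ` W. x \<in> e} = (if x \<in> W then {f x} else {})"
proof -
  have "x = w" if "w \<in> W" "x \<in> f w" for w using pend(5)[OF that(1)] that assms by auto
  then show ?thesis using pend(1) by auto
qed

lemma edges_at_trunk: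
  assumes "x \<in> T"
  shows "{e. e \<in> edges G \<and> x \<in> e} = {e \<in> St. x \<in> e} \<union> (if x \<in> W then {f x} else {})"
  unfolding pend_edges[OF assms, symmetric] edges_G by auto

lemma edges_at_pend:
  assumes "w \<in> W" "x \<in> f w" "x \<notin> T"
  shows "{e. e \<in> edges G \<and> x \<in> e} = {f w}"
proof -
  have uniq: "w' = w" if "w' \<in> W" "x \<in> f w'" for w'
  proof (rule ccontr)
    assume "w' \<noteq> w"
    then have "f w' \<inter> f w = {}" using ff that(1) assms(1) by simp
    then show False using that(2) assms(2) by auto
  qed
  have "e = f w" if e: "e \<in> edges G" "x \<in> e" for e
  proof -
    have "e \<notin> St" using e(2) assms(3) by auto
    then obtain w' where "w' \<in> W" "e = f w'" using e(1) unfolding edges_G by blast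
    then show ?thesis using uniq e(2) by metis
  qed
  moreover have "f w \<in> edges G" unfolding edges_G using assms(1) by simp
  ultimately show ?thesis using assms(2) by blast
qed

lemma prod_if_W:
  fixes B c :: real
  assumes "finite A"
  shows "(\<Prod>x\<in>A. (if x \<in> W then B else 1) * c) = B ^ card (W \<inter> A) * c ^ card A"
proof -
  have "(\<Prod>x\<in>A. if x \<in> W then B else 1) = (\<Prod>x\<in>{x\<in>A. x \<in> W}. B)"
    by (rule prod.inter_filter[symmetric, OF assms])
  also have "{x\<in>A. x \<in> W} = W \<inter> A" by auto
  finally show ?thesis by (simp add: prod.distrib)
qed

text \<open>Starting from \<open>y u = 1\<close>, the eigenvalue equations at all other vertices are
  solved explicitly for any \<open>\<rho> > 1\<close>, whether or not it is the radius. The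
  discrepancy left at \<open>u\<close> is what decides comparisons.\<close>

lemma closed_form:
  assumes rho: "\<rho> > 1"
  obtains y where "\<forall>x\<in>verts G. 0 < y x" "y u = 1"
    "\<forall>x\<in>verts G - {u}. load k G y x = \<rho> * y x"
    "load k G y u = \<rho> / \<rho> ^ k * Phi (1 / (1 - 1 / \<rho> ^ k))"
proof -
  \<comment> \<open>A pendant edge at \<open>w\<close> has value \<open>\<rho> * q * y w\<close>,
    and its other vertices have weight \<open>q * y w\<close>. On a star edge of value K the
    equation at \<open>w\<close>, if \<open>w\<close> is not \<open>v\<close>, is K +
    \<open>\<rho> * q * y w\<close> = \<open>\<rho> * y w\<close>, so \<open>y w\<close> is
    \<open>B\<close> times K / \<rho>.\<close>
  define q where "q = 1 / \<rho> ^ k"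
  define B where "B = 1 / (1 - q)"
  define D where "D = sqrt B"
  have k0: "k > 0" using k3 by simp
  have "\<rho> ^ k > 1" using rho k0 by (simp add: one_less_power)
  then have q: "0 < q" "q < 1" "\<rho> ^ k * q = 1" using rho by (auto simp: q_def)
  have B: "B > 0" "B * (1 - q) = 1" using q by (auto simp: B_def)
  have D: "D > 0" "D * D = B" using B by (auto simp: D_def)
  have DD: "D ^ i * D ^ i = B ^ i" for i using D(2) by (simp flip: power_mult_distrib)
  have rk: "\<rho> ^ k = \<rho> * \<rho> ^ (k-1)" "\<rho> ^ k = \<rho>\<^sup>2 * \<rho> ^ (k-2)"
  proof -
    have "k = Suc (k-1)" "k = 2 + (k-2)" using k3 by auto
    then show "\<rho> ^ k = \<rho> * \<rho> ^ (k-1)" "\<rho> ^ k = \<rho>\<^sup>2 * \<rho> ^ (k-2)" by (metis power_Suc, metis power_add)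
  qed
  have q1: "\<rho> * q = 1 / \<rho> ^ (k-1)" "\<rho>\<^sup>2 * q = 1 / \<rho> ^ (k-2)"
    using q(3) rk rho by (auto simp: field_simps)
  define s where "s = D ^ ra + D ^ rb"
  have s: "s > 0" using D by (simp add: s_def add_pos_pos)
  \<comment> \<open>On an edge of \<open>C\<close> with j pendant edges,
    \<open>K ^ k = B ^ j * (K / \<rho>) ^ (k - 1)\<close> determines the value. On the cycle edges
    the values are proportional to the square root of the weight \<open>yv\<close> of
    \<open>v\<close>, and the equation at \<open>v\<close> then determines
    \<open>yv\<close>.\<close>
  define K where "K = (\<lambda>e. if e = a then \<rho> * q * B ^ fl * (D ^ ra * s)
      else if e = b then \<rho> * q * B ^ fl * (D ^ rb * s) else \<rho> * q * B ^ card (W \<inter> e))"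
  have Kpos: "K e > 0" for e using rho q B D s by (auto simp: K_def)
  define yv where "yv = q * (B ^ fl * s)\<^sup>2"
  have yv: "yv > 0" using q B s by (auto simp: yv_def)
  define wT where "wT = (\<lambda>x. if x = u then 1 else if x = v then yv
      else (if x \<in> W then B else 1) * (K (THE e. e \<in> St \<and> x \<in> e) / \<rho>))"
  define y where "y = (\<lambda>x. if x \<in> T then wT x else q * wT (THE w. w \<in> W \<and> x \<in> f w))"
  have yu: "y u = 1" "y v = yv" using star ab uv by (auto simp: y_def wT_def)
  have yT: "y x = (if x \<in> W then B else 1) * (K e / \<rho>)" if "e \<in> St" "x \<in> e" "x \<noteq> u" "x \<noteq> v" for e x
  proof -
    have "(THE e. e \<in> St \<and> x \<in> e) = e"
    proof (rule the_equality)
      fix e' assume "e' \<in> St \<and> x \<in> e'"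
      then show "e' = e" using St_unique[of e' e x] that by blast
    qed (use that in blast)
    moreover have "x \<in> T" using that(1,2) by blast
    ultimately show ?thesis using that(3,4) by (simp add: y_def wT_def)
  qed
  have yP: "y x = q * y w" if "w \<in> W" "x \<in> f w" "x \<noteq> w" for w x
  proof -
    have xT: "x \<notin> T" using pend(5)[OF that(1)] that by auto
    have uniq: "w' = w" if "w' \<in> W" "x \<in> f w'" for w'
    proof (rule ccontr)
      assume "w' \<noteq> w"
      then have "f w' \<inter> f w = {}" using ff that(1) \<open>w \<in> W\<close> by simp
      then show False using that(2) \<open>x \<in> f w\<close> by auto
    qed
    have "(THE w. w \<in> W \<and> x \<in> f w) = w"
      by (rule the_equality) (use that(1,2) uniq in blast)+
    then show ?thesis using xT W_T(1)[OF that(1)] by (simp add: y_def)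
  qed
  have ypT: "y x > 0" if xT: "x \<in> T" for x
  proof (cases "x = u \<or> x = v")
    case False
    obtain e where "e \<in> St" "x \<in> e" using xT by blast
    then show ?thesis using yT[of e x] False B Kpos rho by simp
  qed (use yu yv in auto)
  have ypos: "\<forall>x\<in>verts G. 0 < y x"
  proof
    fix x assume "x \<in> verts G"
    then consider "x \<in> T" | w where "w \<in> W" "x \<in> f w" "x \<notin> T" unfolding verts_G by auto
    then show "0 < y x"
    proof cases
      case 2
      then have "y x = q * y w" using yP W_T(1) by metis
      then show ?thesis using ypT W_T(1) 2 q by simp
    qed (use ypT in auto)
  qed
  have gm_ab: "gmean k y e = K e"
    if e: "e = a \<or> e = b" and Ke: "K e = \<rho> * q * B ^ fl * (D ^ card (W \<inter> (e - {u,v})) * s)" for e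
  proof (rule gmean_eqI[OF k0 less_imp_le[OF Kpos]])
    have eS: "e \<in> St" "finite e" "card e = k" "u \<in> e" "v \<in> e"
      using e star finite_St ab by auto
    let ?r = "card (W \<inter> (e - {u,v}))"
    have "(\<Prod>x\<in>e. y x) = y u * (y v * (\<Prod>x\<in>e - {u,v}. y x))"
      using eS uv prod.remove[of e u y] prod.remove[of "e - {u}" v y]
      by (simp add: Diff_insert2[symmetric] insert_commute)
    also have "(\<Prod>x\<in>e - {u,v}. y x) = (\<Prod>x\<in>e - {u,v}. (if x \<in> W then B else 1) * (K e / \<rho>))"
    proof (rule prod.cong[OF refl])
      fix x assume "x \<in> e - {u,v}"
      then have "x \<in> e" "x \<noteq> u" "x \<noteq> v" by auto
      then show "y x = (if x \<in> W then B else 1) * (K e / \<rho>)" by (rule yT[OF eS(1)])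
    qed
    also have "\<dots> = B ^ ?r * (K e / \<rho>) ^ card (e - {u,v})" by (rule prod_if_W) (use eS in auto)
    also have "card (e - {u,v}) = k - 2" using eS uv by (simp add: card_Diff_subset)
    finally have "(\<Prod>x\<in>e. y x) = (yv * B ^ ?r / \<rho> ^ (k-2)) * K e ^ (k-2)"
      by (simp add: yu power_divide)
    also have "yv * B ^ ?r / \<rho> ^ (k-2) = (K e)\<^sup>2"
    proof -
      have "yv * B ^ ?r / \<rho> ^ (k-2) = yv * B ^ ?r * (\<rho>\<^sup>2 * q)" using q1 by simp
      also have "\<dots> = (\<rho> * q * B ^ fl * s)\<^sup>2 * (D ^ ?r * D ^ ?r)"
        unfolding DD yv_def by (simp add: power2_eq_square algebra_simps)
      also have "\<dots> = (K e)\<^sup>2" unfolding Ke by (simp add: power2_eq_square algebra_simps)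
      finally show ?thesis .
    qed
    also have "(K e)\<^sup>2 * K e ^ (k-2) = K e ^ k"
    proof -
      have "k = 2 + (k-2)" using k3 by simp
      then show ?thesis by (metis power_add)
    qed
    finally show "(\<Prod>x\<in>e. y x) = K e ^ k" .
  qed
  have gm_a: "gmean k y a = K a" by (rule gm_ab) (auto simp: K_def)
  have gm_b: "gmean k y b = K b" by (rule gm_ab) (use ab_neq in \<open>auto simp: K_def\<close>)
  have gm_C: "gmean k y c = K c" if c: "c \<in> C" for c
  proof (rule gmean_eqI[OF k0 less_imp_le[OF Kpos]])
    have cS: "c \<in> St" "finite c" "card c = k" "u \<in> c" "v \<notin> c"
      using c star finite_St v_St[of c] aC bC by auto
    have Kc: "K c = \<rho> * q * B ^ card (W \<inter> c)" using c aC bC by (auto simp: K_def)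
    have Wc: "W \<inter> (c - {u}) = W \<inter> c" using W by auto
    have "(\<Prod>x\<in>c. y x) = y u * (\<Prod>x\<in>c - {u}. y x)" using cS by (simp add: prod.remove)
    also have "(\<Prod>x\<in>c - {u}. y x) = (\<Prod>x\<in>c - {u}. (if x \<in> W then B else 1) * (K c / \<rho>))"
    proof (rule prod.cong[OF refl])
      fix x assume "x \<in> c - {u}"
      then have "x \<in> c" "x \<noteq> u" "x \<noteq> v" using cS(5) by auto
      then show "y x = (if x \<in> W then B else 1) * (K c / \<rho>)" by (rule yT[OF cS(1)])
    qed
    also have "\<dots> = B ^ card (W \<inter> (c - {u})) * (K c / \<rho>) ^ card (c - {u})" by (rule prod_if_W) (use cS in auto)
    finally have "(\<Prod>x\<in>c. y x) = (\<rho> * q * B ^ card (W \<inter> c)) * K c ^ (k-1)"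
      using cS q1 yu by (simp add: Wc power_divide)
    also have "\<dots> = K c ^ k" unfolding Kc[symmetric] using k0 by (cases k) auto
    finally show "(\<Prod>x\<in>c. y x) = K c ^ k" .
  qed
  have gm_St: "gmean k y e = K e" if "e \<in> St" for e using that gm_a gm_b gm_C by auto
  have gm_f: "gmean k y (f w) = \<rho> * q * y w" if w: "w \<in> W" for w
  proof (rule gmean_eqI[OF k0])
    show "0 \<le> \<rho> * q * y w" using rho q ypT W_T(1)[OF w] by (simp add: less_imp_le)
    have "(\<Prod>x\<in>f w. y x) = y w * (\<Prod>x\<in>f w - {w}. y x)" using pend[OF w] by (simp add: prod.remove)
    also have "(\<Prod>x\<in>f w - {w}. y x) = (\<Prod>x\<in>f w - {w}. q * y w)"
      by (rule prod.cong) (use yP[OF w] in auto)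
    also have "\<dots> = (q * y w) ^ (k-1)" using pend[OF w] by simp
    also have "y w * (q * y w) ^ (k-1) = (\<rho> ^ k * q) * y w * (q * y w) ^ (k-1)" using q by simp
    also have "\<dots> = \<rho> ^ k * ((q * y w) * (q * y w) ^ (k-1))" by simp
    also have "(q * y w) * (q * y w) ^ (k-1) = (q * y w) ^ k" using k0 by (cases k) auto
    finally show "(\<Prod>x\<in>f w. y x) = (\<rho> * q * y w) ^ k" by (simp add: power_mult_distrib)
  qed
  have fS: "f x \<notin> {e \<in> St. x \<in> e}" if "x \<in> W" for x using pend_not_St that by blast
  have finSt: "finite {e \<in> St. x \<in> e}" for x using finC by (auto intro: finite_subset[of _ St])
  have deg: "load k G y x
      = (\<Sum>e\<in>{e \<in> St. x \<in> e}. K e) + (if x \<in> W then \<rho> * q * y x else 0)" if xT: "x \<in> T" for x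
  proof -
    have "(\<Sum>e\<in>{e \<in> St. x \<in> e}. gmean k y e) = (\<Sum>e\<in>{e \<in> St. x \<in> e}. K e)"
      by (rule sum.cong) (use gm_St in auto)
    then show ?thesis
      unfolding edges_at_trunk[OF xT] using fS[of x] finSt[of x] gm_f[of x] by simp
  qed
  have nonroot: "load k G y x = \<rho> * y x" if x: "x \<in> verts G" "x \<noteq> u" for x
  proof -
    \<comment> \<open>\<open>t\<close> stands for the sum over the star edges at \<open>x\<close>; a
      pendant edge at \<open>x\<close> is absorbed by \<open>B * (1 - q) = 1\<close>.\<close>
    have corr: "t + (if x \<in> W then \<rho> * q * y x else 0) = \<rho> * y x"
      if "y x * \<rho> = (if x \<in> W then B else 1) * t" for t
    proof (cases "x \<in> W")
      case True
      then have "\<rho> * y x * (1 - q) = (B * (1 - q)) * t" using that by (simp add: algebra_simps)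
      then have "t = \<rho> * y x * (1 - q)" unfolding B(2) by simp
      then show ?thesis using True by (simp add: algebra_simps)
    qed (use that in \<open>simp add: mult.commute\<close>)
    consider "x = v" | "x \<in> T" "x \<noteq> v" | w where "w \<in> W" "x \<in> f w" "x \<notin> T"
      using x unfolding verts_G by auto
    then show ?thesis
    proof cases
      case 1
      have xT: "x \<in> T" using 1 ab by auto
      have "{e \<in> St. x \<in> e} = {a, b}" using v_St 1 by auto
      then have KK: "(\<Sum>e\<in>{e \<in> St. x \<in> e}. K e) = \<rho> * q * B ^ fl * s\<^sup>2"
        using ab_neq by (simp add: K_def s_def power2_eq_square algebra_simps)
      show ?thesis unfolding deg[OF xT] KK
        by (rule corr) (use 1 yu in \<open>auto simp: yv_def power2_eq_square algebra_simps\<close>)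
    next
      case 2
      then obtain e where e: "e \<in> St" "x \<in> e" by blast
      then have "{e \<in> St. x \<in> e} = {e}" using St_unique[OF _ e(1) _ e(2)] 2 x by blast
      then have KK: "(\<Sum>e\<in>{e \<in> St. x \<in> e}. K e) = K e" by simp
      show ?thesis unfolding deg[OF 2(1)] KK
        by (rule corr) (use yT[OF e x(2) 2(2)] rho in auto)
    next
      case 3
      then have "x \<noteq> w" using W_T(1) by auto
      then have "y x = q * y w" using yP 3 by auto
      then show ?thesis unfolding edges_at_pend[OF 3] using gm_f 3 by simp
    qed
  qed
  have root: "load k G y u = \<rho> / \<rho> ^ k * Phi (1 / (1 - 1 / \<rho> ^ k))"
  proof -
    have uT: "u \<in> T" "u \<notin> W" using star W by auto
    have "{e \<in> St. u \<in> e} = St" using star by auto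
    then have "load k G y u = (\<Sum>e\<in>St. K e)"
      using deg[OF uT(1)] uT(2) by simp
    also have "\<dots> = K a + (K b + (\<Sum>c\<in>C. K c))" using finC aC bC ab_neq by simp
    also have "(\<Sum>c\<in>C. K c) = (\<Sum>c\<in>C. \<rho> * q * B ^ card (W \<inter> c))"
      by (rule sum.cong) (use aC bC in \<open>auto simp: K_def\<close>)
    also have "\<dots> = \<rho> * q * (\<Sum>c\<in>C. B ^ card (W \<inter> c))" by (simp add: sum_distrib_left)
    also have "K a + (K b + \<rho> * q * (\<Sum>c\<in>C. B ^ card (W \<inter> c))) = \<rho> * q * Phi B"
      using ab_neq by (simp add: K_def Phi_def s_def D_def power2_eq_square algebra_simps)
    finally show ?thesis by (simp add: q_def B_def)
  qed
  show ?thesis by (rule that[OF ypos yu(1) _ root]) (use nonroot in auto)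
qed

lemma radius_gt_1: "spectral_radius k G > 1"
proof -
  have k2: "k \<ge> 2" "k > 0" using k3 by auto
  obtain y where y: "perron k G y" by (rule perron_exists[OF uniform k2(1) connected])
  show ?thesis
    by (rule perron_radius_gt_1[OF uniform k2(2) y, of a b u]) (use edges_G ab_neq star in auto)
qed

text \<open>Otherwise the closed-form weights at \<rho> form a supersolution that is strict at
  \<open>u\<close>, and the radius would lie below itself.\<close>

lemma Phi_ge:
  assumes "\<rho> = spectral_radius k G"
  shows "\<rho> ^ k \<le> Phi (1 / (1 - 1 / \<rho> ^ k))"
proof (rule ccontr)
  assume less: "\<not> ?thesis"
  have rho: "\<rho> > 1" using radius_gt_1 assms by simp
  obtain y where y: "\<forall>x\<in>verts G. 0 < y x" "y u = 1"
    "\<forall>x\<in>verts G - {u}. load k G y x = \<rho> * y x"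
    "load k G y u = \<rho> / \<rho> ^ k * Phi (1 / (1 - 1 / \<rho> ^ k))"
    by (rule closed_form[OF rho])
  have "\<rho> / \<rho> ^ k * Phi (1 / (1 - 1 / \<rho> ^ k)) < \<rho> / \<rho> ^ k * \<rho> ^ k"
    using less rho by (intro mult_strict_left_mono) auto
  then have lt: "load k G y u < \<rho> * y u" using y rho by simp
  have "u \<in> verts G" using star verts_G by auto
  then have "spectral_radius k G < \<rho>"
    using lt y k3 by (intro spectral_radius_less_supersolution[OF uniform _ connected y(1) _ _ lt]) (auto, force)
  then show False using assms by simp
qed

text \<open>The closed-form weights satisfy every equation except the one at \<open>u\<close>, where
  the load is too large; so they are a strict test vector.\<close>

lemma spectral_radius_gt:
  assumes rho: "\<rho> > 1" and gt: "\<rho> ^ k < Phi (1 / (1 - 1 / \<rho> ^ k))"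
  shows "\<rho> < spectral_radius k G"
proof -
  obtain y where y: "\<forall>x\<in>verts G. 0 < y x" "y u = 1"
    "\<forall>x\<in>verts G - {u}. load k G y x = \<rho> * y x"
    "load k G y u = \<rho> / \<rho> ^ k * Phi (1 / (1 - 1 / \<rho> ^ k))"
    by (rule closed_form[OF rho])
  have "\<rho> / \<rho> ^ k * \<rho> ^ k < \<rho> / \<rho> ^ k * Phi (1 / (1 - 1 / \<rho> ^ k))"
    using gt rho by (intro mult_strict_left_mono) auto
  then have lt: "\<rho> * y u < load k G y u" using y rho by simp
  have uV: "u \<in> verts G" using star verts_G by auto
  have "\<rho> * (\<Sum>v\<in>verts G. y v) \<le> (\<Sum>v\<in>verts G. \<Sum>e | e \<in> edges G \<and> v \<in> e. gmean k y e)"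
    unfolding sum_distrib_left
  proof (rule sum_mono)
    fix x assume "x \<in> verts G"
    then show "\<rho> * y x \<le> load k G y x"
      using lt y(3) by (cases "x = u") auto
  qed
  then show ?thesis
    using lt k3 uV by (intro spectral_radius_less_test_vector[OF uniform _ y(1), of _ u])
      (auto simp: sum_degree_swap[OF uniform])
qed

end

section \<open>Redistributing pendant edges over a fixed trunk\<close>

context bouquet
begin

lemma card_trunk_subset:
  assumes X: "X \<subseteq> T - {u}"
  shows "card X = (if v \<in> X then 1 else 0) + card (X \<inter> (a - {u, v})) + card (X \<inter> (b - {u, v}))
    + (\<Sum>c\<in>C. card (X \<inter> c))"
proof -
  have fX: "finite X" using X finite_T by (meson finite_Diff finite_subset)
  have vC: "v \<notin> c" if "c \<in> C" for c using that v_St[of c] aC bC by auto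
  let ?A = "X \<inter> {v}" and ?B = "X \<inter> (a - {u, v})" and ?D = "X \<inter> (b - {u, v})" and ?E = "\<Union>c\<in>C. X \<inter> c"
  have eq: "X = ?A \<union> (?B \<union> (?D \<union> ?E))" using X ab by blast
  have d3: "?D \<inter> ?E = {}" using ab_C by blast
  have d2: "?B \<inter> (?D \<union> ?E) = {}"
  proof -
    have "?B \<inter> ?D = {}" using ab by blast
    moreover have "?B \<inter> ?E = {}" using ab_C by blast
    ultimately show ?thesis by blast
  qed
  have d1: "?A \<inter> (?B \<union> (?D \<union> ?E)) = {}" using vC by blast
  have fE: "finite ?E" using fX finC by auto
  have "card X = card ?A + (card ?B + (card ?D + card ?E))"
  proof -
    have "card (?D \<union> ?E) = card ?D + card ?E" by (rule card_Un_disjoint) (use fX fE d3 in auto)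
    moreover have "card (?B \<union> (?D \<union> ?E)) = card ?B + card (?D \<union> ?E)"
      by (rule card_Un_disjoint) (use fX fE d2 in auto)
    moreover have "card (?A \<union> (?B \<union> (?D \<union> ?E))) = card ?A + card (?B \<union> (?D \<union> ?E))"
      by (rule card_Un_disjoint) (use fX fE d1 in auto)
    ultimately show ?thesis using eq by simp
  qed
  moreover have "card ?A = (if v \<in> X then 1 else 0)" by simp
  moreover have "card ?E = (\<Sum>c\<in>C. card (X \<inter> c))"
  proof (rule card_UN_disjoint)
    have "X \<inter> c \<inter> (X \<inter> c') = {}" if "c \<in> C" "c' \<in> C" "c \<noteq> c'" for c c'
    proof -
      have "c \<inter> c' = {u}" using CC that by simp
      then show ?thesis using X by blast
    qed
    then show "\<forall>i\<in>C. \<forall>j\<in>C. i \<noteq> j \<longrightarrow> X \<inter> i \<inter> (X \<inter> j) = {}" by blast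
  qed (use finC fX in auto)
  ultimately show ?thesis by simp
qed

lemma swap: "bouquet k G u v b a C W f"
  by unfold_locales
    (use k3 finC aC bC ab_neq star ab uv ab_C CC W f ff verts_G edges_G in \<open>simp_all add: Int_commute Un_commute insert_commute\<close>)

lemma card_slots:
  "card (a - {u,v}) = k - 2" "card (b - {u,v}) = k - 2" "c \<in> C \<Longrightarrow> card (c - {u}) = k - 1"
proof -
  have "{u,v} \<subseteq> a" "{u,v} \<subseteq> b" using ab by auto
  then show "card (a - {u,v}) = k - 2" "card (b - {u,v}) = k - 2"
    using star uv by (simp_all add: card_Diff_subset numeral_2_eq_2)
  show "c \<in> C \<Longrightarrow> card (c - {u}) = k - 1" using star by simp
qed

text \<open>The pendant edges are re-rooted along a bijection of their roots and keep their other
  vertices. The competitor thus has the same vertex set and can be compared with \<open>G\<close>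
  inside its class.\<close>

lemma realise:
  assumes W': "W' \<subseteq> T - {u}" "card W' = card W"
  obtains G' f' where "bouquet k G' u v a b C W' f'" "verts G' = verts G"
proof -
  have fW': "finite W'" using W' finite_T by (meson finite_Diff finite_subset)
  obtain g where g: "bij_betw g W' W"
    using finite_same_card_bij[OF fW' finite_W W'(2)] by auto
  have gW: "g w \<in> W" if "w \<in> W'" for w using g that by (auto simp: bij_betw_def)
  define f' where "f' = (\<lambda>w. insert w (f (g w) - {g w}))"
  define G' where "G' = \<lparr>verts = T \<union> \<Union>(f' ` W'), edges = St \<union> f' ` W'\<rparr>"
  have out: "(f w - {w}) \<inter> T = {}" if "w \<in> W" for w using pend(5)[OF that] by auto
  have T': "w \<in> T" if "w \<in> W'" for w using W' that by auto
  have "bouquet k G' u v a b C W' f'"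
  proof (unfold_locales)
    show "\<forall>w\<in>W'. card (f' w) = k \<and> f' w \<inter> T = {w}"
    proof
      fix w assume w: "w \<in> W'"
      note p = pend[OF gW[OF w]]
      have "w \<notin> f (g w) - {g w}" using out[OF gW[OF w]] T'[OF w] by blast
      then have "card (f' w) = k" using p k3 by (simp add: f'_def card_insert_if)
      moreover have "f' w \<inter> T = {w}" using out[OF gW[OF w]] T'[OF w] unfolding f'_def by blast
      ultimately show "card (f' w) = k \<and> f' w \<inter> T = {w}" by simp
    qed
    show "\<forall>w\<in>W'. \<forall>w'\<in>W'. w \<noteq> w' \<longrightarrow> f' w \<inter> f' w' = {}"
    proof (intro ballI impI)
      fix w w' assume w: "w \<in> W'" "w' \<in> W'" "w \<noteq> w'"
      then have "g w \<noteq> g w'" using g by (auto simp: bij_betw_def inj_on_def)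
      then have "f (g w) \<inter> f (g w') = {}" using ff gW w by simp
      then show "f' w \<inter> f' w' = {}"
        using w out[OF gW[OF w(1)]] out[OF gW[OF w(2)]] T'[OF w(1)] T'[OF w(2)] unfolding f'_def by blast
    qed
  qed (use k3 finC aC bC ab_neq star ab uv ab_C CC W' in \<open>simp_all add: G'_def\<close>)
  moreover have "verts G' = verts G"
  proof -
    have "T \<union> \<Union>(f' ` W') = T \<union> (\<Union>w\<in>W'. f (g w) - {g w})"
      unfolding f'_def using T' by auto
    also have "(\<Union>w\<in>W'. f (g w) - {g w}) = (\<Union>w\<in>g ` W'. f w - {w})" by auto
    also have "g ` W' = W" using g by (simp add: bij_betw_def)
    also have "T \<union> (\<Union>w\<in>W. f w - {w}) = T \<union> \<Union>(f ` W)" using W_T(1) by auto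
    finally show ?thesis unfolding verts_G by (simp add: G'_def)
  qed
  ultimately show ?thesis by (rule that)
qed

lemma slots_exist:
  assumes "i \<le> 1" "r \<le> k - 2" "s \<le> k - 2" "\<forall>c\<in>C. j c \<le> k - 1"
  obtains W' where "W' \<subseteq> T - {u}" "v \<in> W' \<longleftrightarrow> i = 1" "card (W' \<inter> (a - {u,v})) = r"
    "card (W' \<inter> (b - {u,v})) = s" "\<forall>c\<in>C. card (W' \<inter> c) = j c"
proof -
  obtain A where A: "A \<subseteq> a - {u,v}" "card A = r"
    using obtain_subset_with_card_n[of r "a - {u,v}"] card_slots assms by metis
  obtain B where B: "B \<subseteq> b - {u,v}" "card B = s"
    using obtain_subset_with_card_n[of s "b - {u,v}"] card_slots assms by metis
  have "\<forall>c\<in>C. \<exists>X. X \<subseteq> c - {u} \<and> card X = j c"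
    using obtain_subset_with_card_n card_slots assms by metis
  then obtain D where D: "\<And>c. c \<in> C \<Longrightarrow> D c \<subseteq> c - {u}" "\<And>c. c \<in> C \<Longrightarrow> card (D c) = j c"
    by metis
  define W' where "W' = (if i = 1 then {v} else {}) \<union> A \<union> B \<union> (\<Union>c\<in>C. D c)"
  have vab: "v \<in> a" "v \<in> b" using ab by auto
  have vC: "v \<notin> c" if "c \<in> C" for c using that v_St[of c] aC bC by auto
  have Dab: "D c \<inter> (a \<union> b) = {}" if "c \<in> C" for c using D(1)[OF that] ab_C that by blast
  have UD: "(\<Union>c\<in>C. D c) \<inter> (a \<union> b) = {}" using Dab by blast
  have DD: "D c \<inter> c' = {}" if "c \<in> C" "c' \<in> C" "c \<noteq> c'" for c c'
  proof -
    have "c \<inter> c' = {u}" using CC that by simp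
    then show ?thesis using D(1)[OF that(1)] by blast
  qed
  have AB: "A \<inter> b = {}" "B \<inter> a = {}" using A(1) B(1) ab by blast+
  have ABC: "A \<inter> c = {}" "B \<inter> c = {}" if "c \<in> C" for c using A(1) B(1) ab_C that by blast+
  have "A \<subseteq> T - {u}" "B \<subseteq> T - {u}" "(\<Union>c\<in>C. D c) \<subseteq> T - {u}"
    using A(1) B(1) D(1) by blast+
  then have "W' \<subseteq> T - {u}" unfolding W'_def using vab uv by auto
  moreover have "v \<in> W' \<longleftrightarrow> i = 1"
  proof -
    have "v \<notin> D c" if "c \<in> C" for c using D(1)[OF that] vC[OF that] by auto
    then show ?thesis unfolding W'_def using A(1) B(1) by auto
  qed
  moreover have "W' \<inter> (a - {u,v}) = A"
    unfolding W'_def using A(1) AB UD by auto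
  moreover have "W' \<inter> (b - {u,v}) = B"
    unfolding W'_def using B(1) AB UD by auto
  moreover have "W' \<inter> c = D c" if c: "c \<in> C" for c
  proof -
    have "(\<Union>c'\<in>C. D c') \<inter> c = D c"
    proof
      show "(\<Union>c'\<in>C. D c') \<inter> c \<subseteq> D c"
      proof
        fix x assume "x \<in> (\<Union>c'\<in>C. D c') \<inter> c"
        then obtain c' where "c' \<in> C" "x \<in> D c'" "x \<in> c" by auto
        then show "x \<in> D c" using DD[of c' c] c by (cases "c' = c") auto
      qed
      show "D c \<subseteq> (\<Union>c'\<in>C. D c') \<inter> c" using D(1)[OF c] c by auto
    qed
    then show ?thesis unfolding W'_def using ABC[OF c] vC[OF c] by auto
  qed
  ultimately show ?thesis using that[of W'] A B D(2) by simp
qed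

end

section \<open>Optimal distribution of the pendant edges\<close>

text \<open>A relaxation: the bounds only count the vertices available, and no star edge is asked to
  stay free although a matching of size z needs one. This leaves exchanges unrestricted;
  \<open>optimal_W\<close> recovers a free star edge for the optimum.\<close>

definition conf :: "nat \<Rightarrow> 'c set \<Rightarrow> nat \<Rightarrow> nat \<Rightarrow> nat \<Rightarrow> nat \<Rightarrow> ('c \<Rightarrow> nat) \<Rightarrow> bool" where
  "conf k C Z i r s j \<longleftrightarrow> i \<le> 1 \<and> r \<le> k - 2 \<and> s \<le> k - 2 \<and> (\<forall>c\<in>C. j c \<le> k - 1) \<and>
     i + r + s + (\<Sum>c\<in>C. j c) = Z"

text \<open>This is \<open>Phi (d\<^sup>2)\<close> of a bouquet with pendant numbers \<open>i, r, s, j\<close>.\<close>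

definition Psi :: "real \<Rightarrow> 'c set \<Rightarrow> nat \<Rightarrow> nat \<Rightarrow> nat \<Rightarrow> ('c \<Rightarrow> nat) \<Rightarrow> real" where
  "Psi d C i r s j = (d ^ (i + r) + d ^ (i + s))\<^sup>2 + (\<Sum>c\<in>C. (d\<^sup>2) ^ j c)"

abbreviation optimal :: "real \<Rightarrow> nat \<Rightarrow> 'c set \<Rightarrow> nat \<Rightarrow> nat \<Rightarrow> nat \<Rightarrow> nat \<Rightarrow> ('c \<Rightarrow> nat) \<Rightarrow> bool" where
  "optimal d k C Z i r s j \<equiv>
     \<forall>i' r' s' j'. conf k C Z i' r' s' j' \<longrightarrow> Psi d C i' r' s' j' \<le> Psi d C i r s j"

lemma Psi_swap: "Psi d C i r s j = Psi d C i s r j" and conf_swap: "conf k C Z i r s j = conf k C Z i s r j"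
  unfolding Psi_def conf_def by (auto simp: add.commute)

lemma sum_fun_upd:
  fixes g :: "nat \<Rightarrow> 'b :: ab_group_add"
  assumes "finite C" "c \<in> C"
  shows "(\<Sum>x\<in>C. g ((j(c := t)) x)) = (\<Sum>x\<in>C. g (j x)) - g (j c) + g t"
proof -
  have "(\<Sum>x\<in>C - {c}. g ((j(c := t)) x)) = (\<Sum>x\<in>C - {c}. g (j x))" by (rule sum.cong) auto
  then show ?thesis using sum.remove[OF assms, of "\<lambda>x. g ((j(c := t)) x)"] sum.remove[OF assms, of "\<lambda>x. g (j x)"]
    by simp
qed

lemma sum_fun_upd_nat:
  fixes j :: "'c \<Rightarrow> nat"
  assumes "finite C" "c \<in> C"
  shows "(\<Sum>x\<in>C. (j(c := t)) x) + j c = (\<Sum>x\<in>C. j x) + t"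
proof -
  have "(\<Sum>x\<in>C - {c}. (j(c := t)) x) = (\<Sum>x\<in>C - {c}. j x)" by (rule sum.cong) auto
  then show ?thesis using sum.remove[OF assms, of "j(c := t)"] sum.remove[OF assms, of j] by simp
qed

text \<open>Moving a pendant edge from a cycle edge to \<open>v\<close> keeps the exponent of that
  edge and raises the exponent of the other.\<close>

lemma optimal_conf_centre:
  assumes k: "k \<ge> 3" and d: "d > 1" and C: "finite C" and cf: "conf k C Z i r s j"
    and opt: "optimal d k C Z i r s j"
    and Z: "Z \<ge> 1"
  shows "i = 1"
proof (rule ccontr)
  assume "i \<noteq> 1"
  then have i: "i = 0" using cf by (simp add: conf_def)
  have step: False if "conf k C Z 0 r s j" "r \<ge> 1" "Psi d C 0 r s j = Psi d C i r' s' j"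
    "optimal d k C Z 0 r s j" for r s r' s'
  proof -
    have "conf k C Z 1 (r-1) s j" using that by (auto simp: conf_def)
    then have le: "Psi d C 1 (r-1) s j \<le> Psi d C 0 r s j" using that by blast
    have "d ^ s < d ^ (1 + s)" using d by simp
    then have "(d ^ r + d ^ s)\<^sup>2 < (d ^ r + d ^ (1 + s))\<^sup>2"
      using d by (intro power_strict_mono) (auto intro: add_nonneg_nonneg)
    then show False using le that(2) unfolding Psi_def by simp
  qed
  consider "r \<ge> 1" | "s \<ge> 1" | "r = 0" "s = 0" by linarith
  then show False
  proof cases
    case 1
    then show False using step[of r s r s] cf opt i by simp
  next
    case 2
    have "Psi d C 0 s r j = Psi d C i r s j" using Psi_swap i by metis
    then show False using step[of s r r s] 2 cf opt i conf_swap by metis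
  next
    case 3
    then have "(\<Sum>c\<in>C. j c) \<ge> 1" using cf i Z by (simp add: conf_def)
    then obtain c where c: "c \<in> C" "j c \<ge> 1"
      by (metis One_nat_def Suc_le_eq gr0I less_one not_le sum.neutral zero_less_one)
    \<comment> \<open>With nothing on the cycle, a whole branch is emptied: one of its pendant edges
      goes to \<open>v\<close>, the rest onto one cycle edge. This recreates the old power
      \<open>d ^ j c\<close> inside the square, and the cross term is the gain.\<close>
    let ?j = "j(c := 0)"
    have "(\<Sum>x\<in>C. ?j x) + j c = (\<Sum>x\<in>C. j x)" using sum_fun_upd_nat[OF C c(1), of j 0] by simp
    then have "conf k C Z 1 (j c - 1) 0 ?j"
      using cf c i 3 k unfolding conf_def by auto
    then have le: "Psi d C 1 (j c - 1) 0 ?j \<le> Psi d C 0 0 0 j" using opt i 3 by blast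
    have "(\<Sum>x\<in>C. (d\<^sup>2) ^ (?j x)) = (\<Sum>x\<in>C. (d\<^sup>2) ^ j x) - (d\<^sup>2) ^ j c + 1"
      using sum_fun_upd[OF C c(1), of "\<lambda>n. (d\<^sup>2) ^ n" j 0] by simp
    moreover have "1 + (j c - 1) = j c" using c by simp
    ultimately have "(d ^ j c + d)\<^sup>2 - (d\<^sup>2) ^ j c + 1 \<le> 4"
      using le unfolding Psi_def by simp
    moreover have "(d ^ j c)\<^sup>2 = (d\<^sup>2) ^ j c" by (simp add: mult.commute flip: power_mult)
    ultimately have "2 * d ^ j c * d + d\<^sup>2 + 1 \<le> 4" by (simp add: power2_sum)
    moreover have "d ^ j c * d > 1"
    proof -
      have "d ^ j c * d = d ^ Suc (j c)" by simp
      also have "\<dots> > 1" using d by (simp only: one_less_power)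
      finally show ?thesis .
    qed
    moreover have "d\<^sup>2 > 1" using d by (simp add: one_less_power)
    ultimately show False by linarith
  qed
qed

text \<open>Powers of \<open>d\<close> are convex in the exponent, so a pendant edge moved from the
  less to the more loaded cycle edge increases the sum of the two powers.\<close>

lemma optimal_conf_cycle:
  assumes d: "d > 1" and cf: "conf k C Z 1 r s j"
    and opt: "optimal d k C Z 1 r s j"
    and sr: "s \<le> r"
  shows "s = 0 \<or> r = k - 2"
proof (rule ccontr)
  assume "\<not> ?thesis"
  then have h: "s \<ge> 1" "r < k - 2" using cf by (auto simp: conf_def)
  then have "conf k C Z 1 (r+1) (s-1) j" using cf by (auto simp: conf_def)
  then have "Psi d C 1 (r+1) (s-1) j \<le> Psi d C 1 r s j" using opt by blast
  then have le: "(d ^ (r + 2) + d ^ s)\<^sup>2 \<le> (d ^ (r + 1) + d ^ (s + 1))\<^sup>2"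
    using h unfolding Psi_def by (simp add: numeral_2_eq_2)
  have "d ^ s < d ^ (r+1)" using d sr by (intro power_strict_increasing) auto
  then have "0 < (d - 1) * (d ^ (r+1) - d ^ s)" using d by simp
  then have "d ^ (r + 1) + d ^ (s + 1) < d ^ (r + 2) + d ^ s" by (simp add: algebra_simps)
  then have "(d ^ (r + 1) + d ^ (s + 1))\<^sup>2 < (d ^ (r + 2) + d ^ s)\<^sup>2"
    using d by (intro power_strict_mono) (auto intro: add_nonneg_nonneg)
  then show False using le by simp
qed

text \<open>A cycle edge with room beats a branch because its power also enters the cross term of
  the square.\<close>

lemma optimal_conf_branches_empty:
  assumes k: "k \<ge> 3" and d: "d > 1" and C: "finite C" and cf: "conf k C Z 1 r s j"
    and opt: "optimal d k C Z 1 r s j"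
    and r: "r < k - 2" and c: "c \<in> C"
  shows "j c = 0"
proof (rule ccontr)
  assume "j c \<noteq> 0"
  then have j: "j c \<ge> 1" by simp
  have jk: "j c \<le> k - 1" using cf c by (simp add: conf_def)
  let ?E = "d ^ (1 + s)"
  have sq: "(d ^ t)\<^sup>2 = (d\<^sup>2) ^ t" for t by (simp add: mult.commute flip: power_mult)
  have E: "?E > 0" using d by simp
  show False
  proof (cases "j c > r + 1")
    case True
    \<comment> \<open>The pendant edge at \<open>v\<close> shifts the exponents by one:
      \<open>r + 1\<close> pendant edges go to the branch and \<open>j c - 1\<close> to the cycle
      edge, so the two squares trade places and only the cross term changes.\<close>
    let ?j = "j(c := r + 1)"
    have "(\<Sum>x\<in>C. ?j x) + j c = (\<Sum>x\<in>C. j x) + (r + 1)" by (rule sum_fun_upd_nat[OF C c])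
    then have "conf k C Z 1 (j c - 1) s ?j"
      using cf j jk r k unfolding conf_def by auto
    then have "Psi d C 1 (j c - 1) s ?j \<le> Psi d C 1 r s j" using opt by blast
    moreover have "(\<Sum>x\<in>C. (d\<^sup>2) ^ (?j x)) = (\<Sum>x\<in>C. (d\<^sup>2) ^ j x) - (d\<^sup>2) ^ j c + (d\<^sup>2) ^ (r+1)"
      using sum_fun_upd[OF C c, of "\<lambda>n. (d\<^sup>2) ^ n" j "r+1"] by simp
    ultimately have "(d ^ j c + ?E)\<^sup>2 - (d ^ j c)\<^sup>2 + (d ^ (r+1))\<^sup>2 \<le> (d ^ (r+1) + ?E)\<^sup>2"
      unfolding Psi_def sq using j by simp
    then have "2 * d ^ j c * ?E \<le> 2 * d ^ (r+1) * ?E" by (simp only: power2_sum)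
    then have "2 * d ^ j c \<le> 2 * d ^ (r+1)" using E by (rule mult_right_le_imp_le)
    moreover have "d ^ (r+1) < d ^ j c" using d True by (intro power_strict_increasing) auto
    ultimately show False by linarith
  next
    case False
    let ?j = "j(c := j c - 1)"
    have "(\<Sum>x\<in>C. ?j x) + j c = (\<Sum>x\<in>C. j x) + (j c - 1)" by (rule sum_fun_upd_nat[OF C c])
    then have "conf k C Z 1 (r + 1) s ?j"
      using cf j jk r k unfolding conf_def by auto
    then have "Psi d C 1 (r + 1) s ?j \<le> Psi d C 1 r s j" using opt by blast
    moreover have "(\<Sum>x\<in>C. (d\<^sup>2) ^ (?j x)) = (\<Sum>x\<in>C. (d\<^sup>2) ^ j x) - (d\<^sup>2) ^ j c + (d\<^sup>2) ^ (j c - 1)"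
      using sum_fun_upd[OF C c, of "\<lambda>n. (d\<^sup>2) ^ n" j "j c - 1"] by simp
    ultimately have le: "(d ^ (r+2) + ?E)\<^sup>2 - (d\<^sup>2) ^ j c + (d\<^sup>2) ^ (j c - 1) \<le> (d ^ (r+1) + ?E)\<^sup>2"
      unfolding Psi_def by (simp add: numeral_2_eq_2)
    \<comment> \<open>A single pendant edge is moved. By convexity the square on the cycle grows at
      least as much as the branch term falls, which leaves the cross term as pure gain.\<close>
    have "(d\<^sup>2) ^ (j c - 1) \<le> (d\<^sup>2) ^ (r+1)" using d False by (intro power_increasing) (auto simp: one_le_power)
    then have "(d\<^sup>2) ^ (j c - 1) * (d\<^sup>2 - 1) \<le> (d\<^sup>2) ^ (r+1) * (d\<^sup>2 - 1)"
      using d by (intro mult_right_mono) (auto simp: one_le_power)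
    moreover have "(d\<^sup>2) ^ j c = (d\<^sup>2) ^ (j c - 1) * d\<^sup>2" using j by (metis One_nat_def Suc_le_D diff_Suc_1 power_Suc2)
    moreover have "(d\<^sup>2) ^ (r+2) = (d\<^sup>2) ^ (r+1) * d\<^sup>2" by simp
    ultimately have "(d\<^sup>2) ^ j c - (d\<^sup>2) ^ (j c - 1) \<le> (d ^ (r+2))\<^sup>2 - (d ^ (r+1))\<^sup>2"
      unfolding sq by (simp add: algebra_simps)
    moreover have "(d ^ (r+2))\<^sup>2 + 2 * d ^ (r+2) * ?E - (d\<^sup>2) ^ j c + (d\<^sup>2) ^ (j c - 1)
        \<le> (d ^ (r+1))\<^sup>2 + 2 * d ^ (r+1) * ?E"
      using le by (simp only: power2_sum)
    ultimately have "2 * d ^ (r+2) * ?E \<le> 2 * d ^ (r+1) * ?E" by linarith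
    then have "2 * d ^ (r+2) \<le> 2 * d ^ (r+1)" using E by (rule mult_right_le_imp_le)
    moreover have "d ^ (r+1) < d ^ (r+2)" using d by (intro power_strict_increasing) auto
    ultimately show False by linarith
  qed
qed

text \<open>Convexity again: of two branches the fuller one, if it had room, would take a pendant
  edge from the other.\<close>

lemma optimal_conf_branches:
  assumes d: "d > 1" and C: "finite C" and cf: "conf k C Z i r s j"
    and opt: "optimal d k C Z i r s j"
    and c: "c \<in> C" "c' \<in> C" "c \<noteq> c'" and le: "j c' \<le> j c"
  shows "j c' = 0 \<or> j c = k - 1"
proof (rule ccontr)
  assume "\<not> ?thesis"
  moreover have "j c \<le> k - 1" using cf c(1) by (simp add: conf_def)
  ultimately have h: "j c' \<ge> 1" "j c < k - 1" by auto
  let ?j1 = "j(c := j c + 1)"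
  let ?j = "?j1(c' := j c' - 1)"
  have j1: "?j1 c' = j c'" using c by simp
  have s1: "(\<Sum>x\<in>C. ?j1 x) + j c = (\<Sum>x\<in>C. j x) + (j c + 1)" by (rule sum_fun_upd_nat[OF C c(1)])
  have s2: "(\<Sum>x\<in>C. ?j x) + j c' = (\<Sum>x\<in>C. ?j1 x) + (j c' - 1)"
    using sum_fun_upd_nat[OF C c(2), of ?j1 "j c' - 1"] unfolding j1 .
  have "(\<Sum>x\<in>C. ?j x) = (\<Sum>x\<in>C. j x)" using s1 s2 h(1) by linarith
  moreover have "\<forall>c\<in>C. ?j c \<le> k - 1" using cf h by (auto simp: conf_def)
  ultimately have "conf k C Z i r s ?j" using cf by (auto simp: conf_def)
  then have "Psi d C i r s ?j \<le> Psi d C i r s j" using opt by blast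
  moreover have "(\<Sum>x\<in>C. (d\<^sup>2) ^ (?j x)) = (\<Sum>x\<in>C. (d\<^sup>2) ^ (?j1 x)) - (d\<^sup>2) ^ j c' + (d\<^sup>2) ^ (j c' - 1)"
    using sum_fun_upd[OF C c(2), of "\<lambda>n. (d\<^sup>2) ^ n" ?j1 "j c' - 1"] unfolding j1 .
  moreover have "(\<Sum>x\<in>C. (d\<^sup>2) ^ (?j1 x)) = (\<Sum>x\<in>C. (d\<^sup>2) ^ j x) - (d\<^sup>2) ^ j c + (d\<^sup>2) ^ (j c + 1)"
    using sum_fun_upd[OF C c(1), of "\<lambda>n. (d\<^sup>2) ^ n" j "j c + 1"] .
  ultimately have le2: "(d\<^sup>2) ^ (j c + 1) + (d\<^sup>2) ^ (j c' - 1) \<le> (d\<^sup>2) ^ j c + (d\<^sup>2) ^ j c'"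
    unfolding Psi_def by linarith
  have d2: "d\<^sup>2 > 1" using d by (simp add: one_less_power)
  have "(d\<^sup>2) ^ (j c' - 1) < (d\<^sup>2) ^ j c" using d2 h le by (intro power_strict_increasing) auto
  then have "0 < (d\<^sup>2 - 1) * ((d\<^sup>2) ^ j c - (d\<^sup>2) ^ (j c' - 1))" using d2 by simp
  moreover have "(d\<^sup>2) ^ j c' = (d\<^sup>2) ^ (j c' - 1) * d\<^sup>2" using h by (metis One_nat_def Suc_le_D diff_Suc_1 power_Suc2)
  ultimately show False using le2 by (simp add: algebra_simps)
qed

text \<open>\<open>Psi\<close> depends on \<open>j\<close> only through its restriction to
  \<open>C\<close>, so it takes finitely many values.\<close>

lemma optimal_conf_exists:
  assumes C: "finite C" and cf: "conf k C Z i0 r0 s0 j0"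
  obtains i r s j where "conf k C Z i r s j"
    "optimal d k C Z i r s j"
proof -
  define P where "P = {Psi d C i r s j | i r s j. conf k C Z i r s j}"
  have "P \<subseteq> (\<lambda>(i,r,s,j). Psi d C i r s j) ` ({..1} \<times> {..k} \<times> {..k} \<times> (C \<rightarrow>\<^sub>E {..k}))"
  proof
    fix x assume "x \<in> P"
    then obtain i r s j where x: "x = Psi d C i r s j" "conf k C Z i r s j" unfolding P_def by blast
    have "Psi d C i r s j = Psi d C i r s (restrict j C)"
      unfolding Psi_def by (simp cong: sum.cong)
    moreover have "restrict j C \<in> C \<rightarrow>\<^sub>E {..k}" using x(2) by (fastforce simp: conf_def)
    ultimately show "x \<in> (\<lambda>(i,r,s,j). Psi d C i r s j) ` ({..1} \<times> {..k} \<times> {..k} \<times> (C \<rightarrow>\<^sub>E {..k}))"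
      using x unfolding conf_def by (intro image_eqI[of _ _ "(i,r,s,restrict j C)"]) auto
  qed
  then have fP: "finite P" by (rule finite_subset) (auto intro!: finite_PiE C)
  have "P \<noteq> {}" unfolding P_def using cf by blast
  then have "Max P \<in> P" using fP by simp
  then obtain i r s j where *: "Max P = Psi d C i r s j" "conf k C Z i r s j" unfolding P_def by blast
  have "Psi d C i' r' s' j' \<le> Psi d C i r s j" if "conf k C Z i' r' s' j'" for i' r' s' j'
    unfolding *(1)[symmetric] by (rule Max_ge[OF fP]) (use that in \<open>auto simp: P_def\<close>)
  then show ?thesis using that[OF *(2)] by blast
qed

section \<open>The extremal hypergraph is a bouquet\<close>

lemma (in extremal_star) bouquet_exists:
  obtains v a b C W f where "bouquet k G u v a b C W f" "card W = z - 1"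
    "e0 \<in> insert a (insert b C)" "e0 \<inter> W = {}"
proof -
  note fs = finite_star_F
  let ?d = "\<lambda>x. card {e \<in> star. x \<in> e}"
  have two: "2 \<le> ?d x" if "e \<in> star" "e' \<in> star" "e \<noteq> e'" "x \<in> e" "x \<in> e'" for e e' x
  proof -
    have "card {e, e'} \<le> ?d x"
      by (rule card_mono) (use that fs(1) in \<open>auto intro: finite_subset[OF _ fs(1)]\<close>)
    then show ?thesis using that(3) by simp
  qed
  have uS: "u \<in> e" if "e \<in> star" for e using that by simp
  have fSu: "u \<notin> g" if "g \<in> F" for g using that by simp
  \<comment> \<open>The single excess is either a vertex shared by two star edges or an edge of
    \<open>F\<close> with two vertices in the star.\<close>
  consider (A) "(\<Sum>f\<in>F. card (f \<inter> S) - 1) = 0" "(\<Sum>x\<in>S - {u}. ?d x - 1) = 1"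
    | (B) "(\<Sum>f\<in>F. card (f \<inter> S) - 1) = 1" "(\<Sum>x\<in>S - {u}. ?d x - 1) = 0"
    using excess_count by linarith
  then show ?thesis
  proof cases
    case B
    have d0: "?d x \<le> 1" if "x \<in> S - {u}" for x
    proof -
      have "finite (S - {u})" using fs by simp
      then have "\<forall>x\<in>S - {u}. ?d x - 1 = 0" using B(2) by (simp only: sum_eq_0_iff)
      then have "?d x - 1 = 0" using that by (rule bspec)
      then show ?thesis by simp
    qed
    have st: "e \<inter> e' = {u}" if "e \<in> star" "e' \<in> star" "e \<noteq> e'" for e e'
    proof -
      have "x = u" if "x \<in> e" "x \<in> e'" for x
      proof (rule ccontr)
        assume "x \<noteq> u"
        then have "x \<in> S - {u}" using that \<open>e \<in> star\<close> by blast
        then show False using d0[of x] two[OF \<open>e \<in> star\<close> \<open>e' \<in> star\<close> \<open>e \<noteq> e'\<close> that] by simp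
      qed
      then show ?thesis using uS that(1,2) by blast
    qed
    obtain f1 where f1: "f1 \<in> F" "card (f1 \<inter> S) - 1 = 1"
      using B(1) sum_eq_1_iff[OF fs(2), of "\<lambda>f. card (f \<inter> S) - 1"] by auto
    then have "card (f1 \<inter> S) = 2" by simp
    then obtain p q where pq: "f1 \<inter> S = {p, q}" "p \<noteq> q" by (meson card_2_iff)
    obtain a where a: "a \<in> star" "p \<in> a" using pq by blast
    obtain b where b: "b \<in> star" "q \<in> b" using pq by blast
    have pqf: "p \<in> f1" "q \<in> f1" using pq by blast+
    have pu: "p \<noteq> u" "q \<noteq> u" using pqf fSu[OF f1(1)] by auto
    \<comment> \<open>Through \<open>p\<close> and \<open>q\<close> the edge \<open>f1\<close>
      closes a cycle with one star edge or a triangle with two; both have been excluded.\<close>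
    have False
    proof (cases "a = b")
      case True
      show False by (rule no_cycle_off_centre[of f1 p q a]) (use st f1 pq a b True in blast)+
    next
      case False
      then have ab: "a \<inter> b = {u}" using st a b by blast
      show False
        by (rule no_cycle_of_length_3[OF f1(1) pqf a(1) b(1) False a(2) b(2)]) (use ab pu a b in blast)+
    qed
    then show ?thesis ..
  next
    case A
    have fS: "finite (S - {u})" using fs by simp
    obtain v where v: "v \<in> S - {u}" "?d v - 1 = 1" "\<forall>x\<in>S - {u}. v \<noteq> x \<longrightarrow> ?d x - 1 = 0"
      using A(2) sum_eq_1_iff[OF fS, of "\<lambda>x. ?d x - 1"] by auto
    then have "?d v = 2" by simp
    then obtain a b where ab: "{e \<in> star. v \<in> e} = {a, b}" "a \<noteq> b" by (meson card_2_iff)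
    have "a \<in> {e \<in> star. v \<in> e}" "b \<in> {e \<in> star. v \<in> e}" unfolding ab(1) by simp_all
    then have abv: "a \<in> star" "b \<in> star" "v \<in> a" "v \<in> b" by simp_all
    have common: "x = v" if "e \<in> star" "e' \<in> star" "e \<noteq> e'" "x \<in> e" "x \<in> e'" "x \<noteq> u" for e e' x
    proof (rule ccontr)
      assume "x \<noteq> v"
      have xS: "x \<in> S - {u}" using that by blast
      have "?d x - 1 = 0" using bspec[OF v(3) xS] \<open>x \<noteq> v\<close> by simp
      then show False using two[OF that(1-5)] by simp
    qed
    define C where "C = star - {a, b}"
    have vC: "v \<notin> c" if "c \<in> C" for c
    proof
      assume "v \<in> c"
      then have "c \<in> {e \<in> star. v \<in> e}" using that by (simp add: C_def)
      then show False unfolding ab(1) using that by (simp add: C_def)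
    qed
    have St: "insert a (insert b C) = star" unfolding C_def using abv by blast
    have T: "a \<union> b \<union> \<Union>C = S" using St by blast
    have F1: "\<exists>w. f \<inter> S = {w}" if f: "f \<in> F" for f
    proof -
      have "\<forall>f\<in>F. card (f \<inter> S) - 1 = 0" using A(1) by (simp only: sum_eq_0_iff[OF fs(2)])
      then have "card (f \<inter> S) - 1 = 0" using f by (rule bspec)
      moreover have "f \<inter> S \<noteq> {}"
      proof -
        obtain e x where "e \<in> star" "x \<in> e" "x \<in> f" by (rule F_meets_star[OF f])
        then show ?thesis by blast
      qed
      have "finite (f \<inter> S)" using fs(3) by (rule finite_Int[OF disjI2])
      then have "card (f \<inter> S) > 0" using \<open>f \<inter> S \<noteq> {}\<close> by (simp only: card_gt_0_iff simp_thms)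
      ultimately have "card (f \<inter> S) = 1" by linarith
      then show ?thesis by (meson card_1_singletonE)
    qed
    define W where "W = S \<inter> \<Union>F"
    \<comment> \<open>In this case each edge of \<open>F\<close> meets the star in exactly one
      vertex, and \<open>f\<close> inverts that assignment.\<close>
    define f where "f = (\<lambda>w. THE g. g \<in> F \<and> w \<in> g)"
    have fg: "f w = g" if "g \<in> F" "w \<in> g" for g w
      unfolding f_def
    proof (rule the_equality)
      fix g' assume "g' \<in> F \<and> w \<in> g'"
      then show "g' = g" using F_disjoint[of g' g] that by blast
    qed (use that in blast)
    have fW: "f w \<in> F" "w \<in> f w" "f w \<inter> S = {w}" if w: "w \<in> W" for w
    proof -
      obtain g where g: "g \<in> F" "w \<in> g" using w unfolding W_def by blast
      then show 1: "f w \<in> F" "w \<in> f w" using fg by simp_all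
      obtain w' where "f w \<inter> S = {w'}" using F1 1 by blast
      moreover have "w \<in> f w \<inter> S" using w 1(2) by (simp add: W_def)
      ultimately show "f w \<inter> S = {w}" by simp
    qed
    have img: "f ` W = F"
    proof
      show "f ` W \<subseteq> F" using fW(1) by blast
      show "F \<subseteq> f ` W"
      proof
        fix g assume g: "g \<in> F"
        obtain w where "g \<inter> S = {w}" using F1[OF g] by blast
        then have "w \<in> g" "w \<in> S" by blast+
        then have "w \<in> W" "f w = g" using g fg unfolding W_def by blast+
        then show "g \<in> f ` W" by blast
      qed
    qed
    have inj: "inj_on f W"
    proof (rule inj_onI)
      fix w w' assume w: "w \<in> W" "w' \<in> W" "f w = f w'"
      have "{w} = f w \<inter> S" by (rule fW(3)[OF w(1), symmetric])
      also have "\<dots> = {w'}" unfolding w(3) by (rule fW(3)[OF w(2)])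
      finally show "w = w'" by simp
    qed
    have star_card: "card e = k" if "e \<in> star" for e using that fin(5) by simp
    have C_u: "c \<inter> e = {u}" if "c \<in> C" "e \<in> star" "c \<noteq> e" for c e
    proof -
      have cs: "c \<in> star" using that(1) by (simp add: C_def)
      have "x = u" if "x \<in> c" "x \<in> e" for x
        using common[OF cs \<open>e \<in> star\<close> \<open>c \<noteq> e\<close> that] vC[OF \<open>c \<in> C\<close>] that by blast
      then show ?thesis using uS cs that(2) by blast
    qed
    have ab_uv: "a \<inter> b = {u, v}"
      using common[OF abv(1,2) ab(2)] abv uS by blast
    have "bouquet k G u v a b C W f"
    proof (unfold_locales)
      show "\<forall>c\<in>C. a \<inter> c = {u} \<and> b \<inter> c = {u}"
      proof
        fix c assume c: "c \<in> C"
        then have "c \<noteq> a" "c \<noteq> b" by (auto simp: C_def)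
        then have "c \<inter> a = {u}" "c \<inter> b = {u}" using C_u[OF c] abv by simp_all
        then show "a \<inter> c = {u} \<and> b \<inter> c = {u}" by (simp add: Int_commute)
      qed
      show "\<forall>c\<in>C. \<forall>c'\<in>C. c \<noteq> c' \<longrightarrow> c \<inter> c' = {u}"
      proof (intro ballI impI)
        fix c c' assume "c \<in> C" "c' \<in> C" "c \<noteq> c'"
        moreover then have "c' \<in> star" by (simp add: C_def)
        ultimately show "c \<inter> c' = {u}" using C_u by blast
      qed
      show "\<forall>e\<in>insert a (insert b C). card e = k \<and> u \<in> e" unfolding St using star_card by simp
      show "W \<subseteq> a \<union> b \<union> \<Union>C - {u}" unfolding T W_def by blast
      show "\<forall>w\<in>W. card (f w) = k \<and> f w \<inter> (a \<union> b \<union> \<Union>C) = {w}"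
        unfolding T using fW fin(5) by simp
      show "\<forall>w\<in>W. \<forall>w'\<in>W. w \<noteq> w' \<longrightarrow> f w \<inter> f w' = {}"
      proof (intro ballI impI)
        fix w w' assume w: "w \<in> W" "w' \<in> W" "w \<noteq> w'"
        then have "f w \<noteq> f w'" using inj by (meson inj_onD)
        then show "f w \<inter> f w' = {}" using F_disjoint fW(1) w by blast
      qed
      show "V = a \<union> b \<union> \<Union>C \<union> \<Union>(f ` W)" unfolding T img by (rule verts_covered)
      show "E = insert a (insert b C) \<union> f ` W" unfolding St img by blast
    qed (use k fs(1) ab_uv v ab in \<open>auto simp: C_def\<close>)
    moreover have "card W = z - 1" using card_image[OF inj] img cardF by simp
    moreover have "e0 \<in> insert a (insert b C)" unfolding St using e0 by simp
    moreover have "e0 \<inter> W = {}" unfolding W_def using F_e0 by blast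
    ultimately show ?thesis by (rule that)
  qed
qed

lemma (in bouquet) Phi_eq_Psi:
  assumes "B \<ge> 0"
  shows "Phi B = Psi (sqrt B) C fl ra rb (\<lambda>c. card (W \<inter> c))"
proof -
  have B: "(sqrt B)\<^sup>2 = B" using assms by simp
  have "(sqrt B ^ (fl + ra) + sqrt B ^ (fl + rb))\<^sup>2 = (sqrt B ^ fl * (sqrt B ^ ra + sqrt B ^ rb))\<^sup>2"
    by (simp only: power_add distrib_left)
  also have "\<dots> = ((sqrt B)\<^sup>2) ^ fl * (sqrt B ^ ra + sqrt B ^ rb)\<^sup>2"
    by (simp only: power_mult_distrib power_mult[symmetric] mult.commute)
  finally show ?thesis unfolding Phi_def Psi_def B by simp
qed

lemma (in bouquet) conf_W: "conf k C (card W) fl ra rb (\<lambda>c. card (W \<inter> c))"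
  unfolding conf_def
proof (intro conjI ballI)
  have fin: "finite (a - {u,v})" "finite (b - {u,v})" using finite_St by auto
  show "ra \<le> k - 2" using card_mono[OF fin(1), of "W \<inter> (a - {u,v})"] card_slots by simp
  show "rb \<le> k - 2" using card_mono[OF fin(2), of "W \<inter> (b - {u,v})"] card_slots by simp
  show "fl + ra + rb + (\<Sum>c\<in>C. card (W \<inter> c)) = card W"
    using card_trunk_subset[OF W] by simp
  fix c assume c: "c \<in> C"
  have "W \<inter> c \<subseteq> c - {u}" "finite (c - {u})" using W finite_St c by auto
  then show "card (W \<inter> c) \<le> k - 1" using card_mono card_slots(3)[OF c] by metis
qed auto

lemma (in bouquet) spectral_radius_gt_Psi:
  assumes rho: "\<rho> > 1" and B: "B = 1 / (1 - 1 / \<rho> ^ k)" "B > 1"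
    and gt: "\<rho> ^ k < Psi (sqrt B) C fl ra rb (\<lambda>c. card (W \<inter> c))"
  shows "\<rho> < spectral_radius k G"
proof (rule spectral_radius_gt[OF rho])
  have eq: "Phi B = Psi (sqrt B) C fl ra rb (\<lambda>c. card (W \<inter> c))"
    by (rule Phi_eq_Psi) (use B(2) in simp)
  show "\<rho> ^ k < Phi (1 / (1 - 1 / \<rho> ^ k))"
    using gt unfolding eq[symmetric] unfolding B(1) .
qed

section \<open>Optimality of the distribution in an extremal bouquet\<close>

locale extremal_bouquet = extremal_unicyclic k n z G + bouquet k G u v a b C W f
  for k n z :: nat and G :: "'a hypergraph" and u v a b C W f +
  assumes cW: "card W = z - 1"
begin

abbreviation "pen \<equiv> \<lambda>c. card (W \<inter> c)"

text \<open>Once \<open>v\<close> and both cycle edges are full, \<open>z + 2 - 2 * k\<close>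
  pendant edges remain (none if this is truncated), and \<open>H\<close> says that all edges of
  \<open>C\<close> but one can hold them. The best relaxed distribution therefore leaves an edge of
  \<open>C\<close> free, is realised inside the class, and cannot beat \<open>G\<close> at the
  radius of \<open>G\<close>.\<close>

lemma optimal_W:
  assumes C: "card C \<ge> 1" and H: "z + 2 - 2 * k \<le> (card C - 1) * (k - 1)"
  obtains d where "d > 1" "optimal d k C (z - 1) fl ra rb pen"
proof -
  define B where "B = 1 / (1 - 1 / \<rho> ^ k)"
  define d where "d = sqrt B"
  have rho: "\<rho> > 1" by (rule radius_gt_1)
  have "\<rho> ^ k > 1" using rho k by (simp add: one_less_power)
  then have B: "B > 1" by (simp add: B_def field_simps)
  have d: "d > 1" using B by (simp add: d_def)
  let ?Z = "z - 1"
  have cf0: "conf k C ?Z fl ra rb pen" using conf_W cW by simp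
  obtain i r s j where cf: "conf k C ?Z i r s j"
    and opt: "optimal d k C ?Z i r s j"
    by (rule optimal_conf_exists[OF finC cf0])
  have cfD: "i \<le> 1" "r \<le> k - 2" "s \<le> k - 2" "\<forall>c\<in>C. j c \<le> k - 1" "i + r + s + (\<Sum>c\<in>C. j c) = ?Z"
    using cf by (auto simp: conf_def)
  have Cne: "C \<noteq> {}" using C by auto
  \<comment> \<open>Otherwise the exchanges force \<open>v\<close>, both cycle edges and all edges
    of \<open>C\<close> but one to be full, with something left on the last one: more pendant edges
    than \<open>H\<close> allows.\<close>
  have "\<exists>c\<in>C. j c = 0"
  proof (rule ccontr)
    assume no: "\<not> ?thesis"
    obtain c where c: "c \<in> C" using Cne by auto
    have "j c \<le> (\<Sum>c\<in>C. j c)" by (rule member_le_sum) (use c finC in auto)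
    then have "?Z \<ge> 1" using no c cfD(5) by force
    then have i: "i = 1" by (rule optimal_conf_centre[OF k d finC cf opt])
    have "\<not> r < k - 2" using optimal_conf_branches_empty[OF k d finC _ _ _ c, of ?Z r s j] cf opt i no c by auto
    moreover have "\<not> s < k - 2"
    proof
      assume "s < k - 2"
      moreover have "conf k C ?Z 1 s r j" using cf i conf_swap by metis
      moreover have "optimal d k C ?Z 1 s r j"
        using opt i Psi_swap by metis
      ultimately show False using optimal_conf_branches_empty[OF k d finC _ _ _ c, of ?Z s r j] no c by auto
    qed
    ultimately have rs: "r = k - 2" "s = k - 2" using cfD by auto
    obtain c1 where c1: "c1 \<in> C" "\<forall>c\<in>C. j c1 \<le> j c"
      using ex_min_if_finite[of "j ` C"] finC Cne
      by (metis (no_types, lifting) arg_min_if_finite(1) arg_min_least)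
    have full: "j c = k - 1" if "c \<in> C - {c1}" for c
      using optimal_conf_branches[OF d finC cf opt, of c c1] c1 that no by auto
    have "(\<Sum>c\<in>C. j c) = j c1 + (\<Sum>c\<in>C - {c1}. j c)" using finC c1 by (simp add: sum.remove)
    also have "(\<Sum>c\<in>C - {c1}. j c) = (card C - 1) * (k - 1)" using full c1 by simp
    finally have "(\<Sum>c\<in>C. j c) \<ge> 1 + (card C - 1) * (k - 1)" using no c1 by fastforce
    moreover have "(\<Sum>c\<in>C. j c) = z + 2 - 2 * k" using cfD(5) i rs k z by linarith
    ultimately show False using H by simp
  qed
  then obtain c0 where c0: "c0 \<in> C" "j c0 = 0" by auto
  obtain W' where W': "W' \<subseteq> T - {u}" "v \<in> W' \<longleftrightarrow> i = 1" "card (W' \<inter> (a - {u,v})) = r"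
    "card (W' \<inter> (b - {u,v})) = s" "\<forall>c\<in>C. card (W' \<inter> c) = j c"
    by (rule slots_exist[OF cfD(1-4)])
  have i: "(if v \<in> W' then 1 else 0) = i" using W'(2) cfD(1) by auto
  have cW': "card W' = card W"
    using card_trunk_subset[OF W'(1)] W'(3-5) i cfD(5) cW by simp
  obtain G' f' where bq': "bouquet k G' u v a b C W' f'" and V': "verts G' = V"
    by (rule realise[OF W'(1) cW'])
  note b' = bouquet.uniform[OF bq'] bouquet.connected[OF bq'] bouquet.card_edges[OF bq']
  have "unicyclic k G'"
    using b' card_edges cW' V' uni by (simp add: unicyclic_def)
  moreover have "c0 \<inter> W' = {}"
  proof -
    have "card (W' \<inter> c0) = 0" using W'(5) c0 by simp
    then show ?thesis using bouquet.finite_W[OF bq'] by auto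
  qed
  then have "hg_matching G' (insert c0 (f' ` W'))" "card (insert c0 (f' ` W')) = Suc (card W')"
    using bouquet.matching[OF bq', of c0] c0 by auto
  ultimately have "spectral_radius k G' \<le> \<rho>"
    using not_better[of G' "insert c0 (f' ` W')"] V' cardV cW' cW by simp
  \<comment> \<open>Both distributions are evaluated at the same \<open>d\<close>, taken from
    \<rho>: the competitor does not exceed \<open>\<rho> ^ k\<close>, and \<open>G\<close> reaches
    it.\<close>
  then have "\<not> \<rho> ^ k < Psi d C i r s (\<lambda>c. card (W' \<inter> c))"
    using bouquet.spectral_radius_gt_Psi[OF bq' rho B_def B] unfolding i W'(3,4) d_def by linarith
  moreover have "Psi d C i r s (\<lambda>c. card (W' \<inter> c)) = Psi d C i r s j"
    unfolding Psi_def using W'(5) by simp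
  moreover have "\<rho> ^ k \<le> Psi d C fl ra rb pen"
  proof -
    have eq: "Phi B = Psi d C fl ra rb pen" unfolding d_def by (rule Phi_eq_Psi) (use B in simp)
    show ?thesis unfolding eq[symmetric] B_def by (rule Phi_ge) simp
  qed
  ultimately have "Psi d C i r s j \<le> Psi d C fl ra rb pen" by linarith
  then have "optimal d k C ?Z fl ra rb pen"
    using opt by (meson order_trans)
  then show ?thesis using that d by blast
qed

end

section \<open>Isomorphism with the hypergraphs \<open>\<U>(n,k;f;r,s;t,w)\<close>\<close>

text \<open>\<open>vs ! i\<close> is the vertex that the number \<open>i\<close> stands for. A list
  suits the construction, which always gives new vertices the next free numbers: attaching an edge
  appends to \<open>vs\<close>.\<close>

definition listed :: "'a list \<Rightarrow> 'a set set \<Rightarrow> nat hypergraph \<Rightarrow> bool" where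
  "listed vs E H \<longleftrightarrow> distinct vs \<and> verts H = {..<length vs} \<and>
     (\<forall>e\<in>edges H. e \<subseteq> {..<length vs}) \<and> (\<lambda>e. (!) vs ` e) ` edges H = E"

lemma listed_iso:
  assumes r: "listed vs (edges G) H" and V: "set vs = verts G"
  shows "G \<cong> H"
proof -
  have d: "distinct vs" and vH: "verts H = {..<length vs}"
    and sub: "\<And>e. e \<in> edges H \<Longrightarrow> e \<subseteq> {..<length vs}" and E: "(\<lambda>e. (!) vs ` e) ` edges H = edges G"
    using r by (auto simp: listed_def)
  have bij: "bij_betw ((!) vs) {..<length vs} (verts G)"
    using bij_betw_nth[OF d refl V[symmetric]] by simp
  let ?g = "the_inv_into {..<length vs} ((!) vs)"
  have "bij_betw ?g (verts G) (verts H)" unfolding vH by (rule bij_betw_the_inv_into[OF bij])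
  moreover have "(\<lambda>e. ?g ` e) ` edges G = edges H"
  proof -
    have "?g ` ((!) vs ` e) = e" if "e \<in> edges H" for e
    proof -
      have "?g ((!) vs i) = i" if "i \<in> e" for i
        using the_inv_into_f_f[of "(!) vs" "{..<length vs}" i] bij sub[OF \<open>e \<in> edges H\<close>] that
        by (auto simp: bij_betw_def)
      then show ?thesis by (simp add: image_image)
    qed
    then show ?thesis unfolding E[symmetric] by (simp add: image_image)
  qed
  ultimately show ?thesis unfolding hg_iso_def by blast
qed

lemma listed_attach_edge:
  assumes r: "listed vs E H" and i: "i < length vs" and k: "k \<ge> 1"
    and ns: "distinct ns" "length ns = k - 1" "set ns \<inter> set vs = {}"
  shows "listed (vs @ ns) (insert (insert (vs ! i) (set ns)) E) (attach_edge k i H)"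
proof -
  have d: "distinct vs" and vH: "verts H = {..<length vs}"
    and sub: "\<And>e. e \<in> edges H \<Longrightarrow> e \<subseteq> {..<length vs}" and E: "(\<lambda>e. (!) vs ` e) ` edges H = E"
    using r by (auto simp: listed_def)
  let ?N = "length vs"
  have old: "(!) (vs @ ns) ` e = (!) vs ` e" if "e \<in> edges H" for e
    by (rule image_cong) (use sub[OF that] in \<open>auto simp: nth_append\<close>)
  have new0: "(!) (vs @ ns) ` {?N..<?N + (k-1)} = set ns"
  proof
    show "(!) (vs @ ns) ` {?N..<?N + (k-1)} \<subseteq> set ns" using ns(2) by (auto simp: nth_append)
    show "set ns \<subseteq> (!) (vs @ ns) ` {?N..<?N + (k-1)}"
    proof
      fix x assume "x \<in> set ns"
      then obtain l where "l < length ns" "x = ns ! l" by (metis in_set_conv_nth)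
      then show "x \<in> (!) (vs @ ns) ` {?N..<?N + (k-1)}"
        using ns(2) by (intro image_eqI[of _ _ "?N + l"]) auto
    qed
  qed
  have new: "(!) (vs @ ns) ` insert i {?N..<?N + (k-1)} = insert (vs ! i) (set ns)"
    unfolding image_insert new0 using i by (simp add: nth_append)
  have img: "(\<lambda>e. (!) (vs @ ns) ` e) ` edges H = E"
    unfolding E[symmetric] by (rule image_cong) (use old in auto)
  have "distinct (vs @ ns)" using d ns(1,3) by (simp add: Int_commute[of "set vs"])
  moreover have "verts (attach_edge k i H) = {..<length (vs @ ns)}"
    using vH ns(2) ivl_disj_un_one(2)[of ?N "?N + (k-1)"]
    by (simp add: attach_edge_def Let_def)
  moreover have E': "edges (attach_edge k i H) = insert (insert i {?N..<?N + (k-1)}) (edges H)"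
    using vH by (simp add: attach_edge_def Let_def)
  moreover have "\<forall>e\<in>edges (attach_edge k i H). e \<subseteq> {..<length (vs @ ns)}"
    unfolding E' using sub i ns(2) by fastforce
  ultimately show ?thesis
    unfolding listed_def by (simp only: image_insert[of "\<lambda>e. (!) (vs @ ns) ` e"] new img simp_thms)
qed

text \<open>The construction puts pendant edges on an initial run of numbers, so the vertices of
  \<open>W\<close> have to be listed first.\<close>

lemma list_with_prefix:
  assumes "finite A"
  obtains xs where "distinct xs" "set xs = A" "set (take (card (W \<inter> A)) xs) = W \<inter> A"
proof -
  obtain ws where ws: "set ws = W \<inter> A" "distinct ws"
    using finite_distinct_list[of "W \<inter> A"] assms by auto
  obtain rs where rs: "set rs = A - W" "distinct rs"
    using finite_distinct_list[of "A - W"] assms by auto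
  have "card (W \<inter> A) = length ws" using ws distinct_card[of ws] by simp
  then show ?thesis using that[of "ws @ rs"] ws rs by auto
qed

section \<open>Rebuilding a bouquet along the steps of \<open>hypergraph_U\<close>\<close>

context bouquet
begin

text \<open>\<open>H\<close> is a copy, numbered by \<open>vs\<close>, of the part of \<open>G\<close> formed by the star edges \<open>X\<close> and the
  pendant edges at \<open>Y\<close>.\<close>

definition st :: "'a set set \<Rightarrow> 'a set \<Rightarrow> 'a list \<Rightarrow> nat hypergraph \<Rightarrow> bool" where
  "st X Y vs H \<longleftrightarrow> listed vs (X \<union> f ` Y) H \<and> set vs = \<Union>X \<union> \<Union>(f ` Y) \<and> vs \<noteq> [] \<and> vs ! 0 = u \<and>
     X \<subseteq> St \<and> X \<noteq> {} \<and> Y \<subseteq> W \<inter> \<Union>X"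

lemma st_pendant:
  assumes s: "st X Y vs H" and i: "i < length vs" "vs ! i \<in> W" "vs ! i \<in> \<Union>X" "vs ! i \<notin> Y"
  obtains ns where "st X (insert (vs ! i) Y) (vs @ ns) (attach_edge k i H)"
proof -
  let ?w = "vs ! i"
  note p = pend[OF i(2)]
  have vs: "set vs = \<Union>X \<union> \<Union>(f ` Y)" and X: "X \<subseteq> St" and Y: "Y \<subseteq> W" using s by (auto simp: st_def)
  obtain ns where ns: "set ns = f ?w - {?w}" "distinct ns"
    using finite_distinct_list[of "f ?w - {?w}"] p(3) by auto
  have len: "length ns = k - 1" using distinct_card[OF ns(2)] ns(1) p by simp
  have fX: "(f ?w - {?w}) \<inter> \<Union>X = {}"
  proof -
    have "\<Union>X \<subseteq> T" using X by blast
    then show ?thesis using p(5) by blast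
  qed
  have fY: "f ?w \<inter> f y = {}" if "y \<in> Y" for y
  proof -
    have y: "y \<in> W" "?w \<noteq> y" using that Y i(4) by auto
    show ?thesis using bspec[OF bspec[OF ff i(2)] y(1)] y(2) by simp
  qed
  have "f ?w \<inter> \<Union>(f ` Y) = {}" unfolding Int_UN_distrib using fY by simp
  then have dis: "set ns \<inter> set vs = {}" unfolding ns vs using fX by blast
  have k1: "k \<ge> 1" using k3 by simp
  have "insert ?w (set ns) = f ?w" using ns p(1) by auto
  moreover have "listed vs (X \<union> f ` Y) H" using s by (simp add: st_def)
  ultimately have "listed (vs @ ns) (insert (f ?w) (X \<union> f ` Y)) (attach_edge k i H)"
    using listed_attach_edge[OF _ i(1) k1 ns(2) len dis] by metis
  then have L: "listed (vs @ ns) (X \<union> f ` insert ?w Y) (attach_edge k i H)" by simp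
  have S: "set (vs @ ns) = \<Union>X \<union> \<Union>(f ` insert ?w Y)"
  proof -
    have "set (vs @ ns) = set vs \<union> f ?w"
      unfolding set_append ns(1) using p(1) nth_mem[OF i(1)] by blast
    then show ?thesis unfolding vs by (simp add: Un_ac)
  qed
  have comp: "vs \<noteq> []" "vs ! 0 = u" "X \<noteq> {}" "Y \<subseteq> W \<inter> \<Union>X" using s by (simp_all add: st_def)
  have "(vs @ ns) ! 0 = u" "vs @ ns \<noteq> []" using comp(1,2) by (simp_all add: nth_append)
  moreover have "insert ?w Y \<subseteq> W \<inter> \<Union>X" using comp(4) i(2,3) by blast
  ultimately have "st X (insert ?w Y) (vs @ ns) (attach_edge k i H)"
    unfolding st_def using L S X comp(3) by blast
  then show ?thesis by (rule that)
qed

lemma st_pendants: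
  assumes "st X Y vs H" "distinct is"
    "\<forall>i\<in>set is. i < length vs \<and> vs ! i \<in> W \<and> vs ! i \<in> \<Union>X \<and> vs ! i \<notin> Y"
  shows "\<exists>ns. st X (Y \<union> (!) vs ` set is) (vs @ ns) (fold (attach_edge k) is H)"
  using assms
proof (induction "is" arbitrary: Y vs H)
  case Nil
  then show ?case by (auto intro: exI[of _ "[]"])
next
  case (Cons i "is")
  then have i: "i < length vs" "vs ! i \<in> W" "vs ! i \<in> \<Union>X" "vs ! i \<notin> Y" by simp_all
  obtain ns where ns: "st X (insert (vs ! i) Y) (vs @ ns) (attach_edge k i H)"
    by (rule st_pendant[OF Cons.prems(1) i])
  have dvs: "distinct vs" using Cons.prems(1) by (simp add: st_def listed_def)
  have nth: "(vs @ ns) ! l = vs ! l" if "l \<in> set is" for l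
    using that Cons.prems(3) by (simp add: nth_append)
  have "\<forall>l\<in>set is. l < length (vs @ ns) \<and> (vs @ ns) ! l \<in> W \<and> (vs @ ns) ! l \<in> \<Union>X
      \<and> (vs @ ns) ! l \<notin> insert (vs ! i) Y"
  proof
    fix l assume l: "l \<in> set is"
    then have "l \<noteq> i" "l < length vs" "i < length vs" using Cons.prems by auto
    then have "vs ! l \<noteq> vs ! i" using dvs nth_eq_iff_index_eq by blast
    then show "l < length (vs @ ns) \<and> (vs @ ns) ! l \<in> W \<and> (vs @ ns) ! l \<in> \<Union>X
      \<and> (vs @ ns) ! l \<notin> insert (vs ! i) Y"
      using l Cons.prems(3) nth[OF l] by auto
  qed
  then obtain ns' where "st X (insert (vs ! i) Y \<union> (!) (vs @ ns) ` set is) ((vs @ ns) @ ns')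
      (fold (attach_edge k) is (attach_edge k i H))"
    using Cons.IH[OF ns] Cons.prems(2) by auto
  moreover have "insert (vs ! i) Y \<union> (!) (vs @ ns) ` set is = Y \<union> (!) vs ` set (i # is)"
    using nth by auto
  ultimately show ?case by auto
qed

text \<open>\<open>card (verts H)\<close> is \<open>length vs\<close>, so the new vertices of
  \<open>c\<close> are numbered from there on; listing those in \<open>W\<close> first makes the
  first \<open>card (W \<inter> c)\<close> numbers exactly the roots in \<open>c\<close>.\<close>

lemma st_branch:
  assumes s: "st X Y vs H" and c: "c \<in> C" "c \<notin> X"
  obtains vs' where "st (insert c X) (Y \<union> (W \<inter> c)) vs' (attach_branch k (card (W \<inter> c)) 0 H)"
proof -
  have rep: "listed vs (X \<union> f ` Y) H" and vs: "set vs = \<Union>X \<union> \<Union>(f ` Y)" and X: "X \<subseteq> St" "X \<noteq> {}"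
    and Y: "Y \<subseteq> W" "Y \<subseteq> \<Union>X" and v0: "vs \<noteq> []" "vs ! 0 = u"
    using s by (auto simp: st_def)
  have N: "card (verts H) = length vs" using rep by (simp add: listed_def)
  have cS: "finite c" "card c = k" "u \<in> c" using c finite_St star by auto
  have cX: "c \<inter> e = {u}" if "e \<in> X" for e
  proof (rule St_inter(2))
    show "e \<in> St" by (rule subsetD[OF X(1) that])
    show "c \<noteq> e" using that c by auto
  qed (use c in simp_all)
  have cXu: "(c - {u}) \<inter> \<Union>X = {}" using cX by blast
  have YC: "Y \<inter> c = {}"
  proof -
    have "Y \<inter> c \<subseteq> {u}" using Y(2) cXu by blast
    then show ?thesis using W Y(1) by blast
  qed
  have cf: "c \<inter> f y = {}" if "y \<in> Y" for y
  proof -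
    have "y \<in> W" using that Y by blast
    then have "c \<inter> f y \<subseteq> {y}" using pend(5)[of y] c by blast
    then show ?thesis using YC that by blast
  qed
  obtain ns where ns: "distinct ns" "set ns = c - {u}" "set (take (card (W \<inter> (c - {u}))) ns) = W \<inter> (c - {u})"
    using list_with_prefix[of "c - {u}" W] cS(1) by auto
  have Wc: "W \<inter> (c - {u}) = W \<inter> c" using W by blast
  let ?j = "card (W \<inter> c)"
  have len: "length ns = k - 1" using distinct_card[OF ns(1)] ns(2) cS by simp
  have jk: "?j \<le> length ns"
    using len card_slots(3)[OF c(1)] card_mono[of "c - {u}" "W \<inter> c"] Wc cS(1) by (metis Int_lower2 finite_Diff)
  have "c \<inter> \<Union>(f ` Y) = {}" unfolding Int_UN_distrib using cf by simp
  then have dis: "set ns \<inter> set vs = {}" unfolding ns(2) vs using cXu by blast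
  have "listed (vs @ ns) (insert (insert (vs ! 0) (set ns)) (X \<union> f ` Y)) (attach_edge k 0 H)"
    by (rule listed_attach_edge[OF rep _ _ ns(1) len dis]) (use v0 k3 in auto)
  moreover have "insert (vs ! 0) (set ns) = c" using v0 ns(2) cS(3) by auto
  ultimately have L: "listed (vs @ ns) (insert c X \<union> f ` Y) (attach_edge k 0 H)" by simp
  have S: "set (vs @ ns) = \<Union>(insert c X) \<union> \<Union>(f ` Y)"
  proof -
    have "u \<in> \<Union>X" using X star by blast
    then show ?thesis unfolding set_append vs ns(2) by auto
  qed
  have "(vs @ ns) ! 0 = u" "vs @ ns \<noteq> []" using v0 by (simp_all add: nth_append)
  moreover have "insert c X \<subseteq> St" using X(1) c(1) by simp
  moreover have "Y \<subseteq> W \<inter> \<Union>(insert c X)" using Y by auto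
  moreover have "insert c X \<noteq> {}" by simp
  ultimately have s1: "st (insert c X) Y (vs @ ns) (attach_edge k 0 H)"
    unfolding st_def using L S by - (intro conjI; assumption)
  have nth: "(vs @ ns) ! (length vs + l) = ns ! l" for l by simp
  have img: "(!) (vs @ ns) ` set [length vs..<length vs + ?j] = W \<inter> c"
  proof -
    have "set [length vs..<length vs + ?j] = (+) (length vs) ` {0..<?j}"
      by (simp only: set_upt image_add_atLeastLessThan add_0 add.commute)
    then have "(!) (vs @ ns) ` set [length vs..<length vs + ?j] = (!) ns ` {0..<?j}"
      by (simp only: image_image nth)
    also have "\<dots> = W \<inter> c" using nth_image[OF jk] ns(3) unfolding Wc by simp
    finally show ?thesis .
  qed
  have "\<forall>i\<in>set [length vs..<length vs + ?j]. i < length (vs @ ns) \<and> (vs @ ns) ! i \<in> W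
      \<and> (vs @ ns) ! i \<in> \<Union>(insert c X) \<and> (vs @ ns) ! i \<notin> Y"
  proof
    fix i assume i: "i \<in> set [length vs..<length vs + ?j]"
    then have "(vs @ ns) ! i \<in> W \<inter> c" using img by blast
    then show "i < length (vs @ ns) \<and> (vs @ ns) ! i \<in> W
      \<and> (vs @ ns) ! i \<in> \<Union>(insert c X) \<and> (vs @ ns) ! i \<notin> Y" using YC i jk by auto
  qed
  from st_pendants[OF s1 distinct_upt this] obtain ns' where
    "st (insert c X) (Y \<union> (!) (vs @ ns) ` set [length vs..<length vs + ?j]) ((vs @ ns) @ ns')
      (fold (attach_edge k) [length vs..<length vs + ?j] (attach_edge k 0 H))" by auto
  then show ?thesis using that unfolding img attach_branch_def N Let_def by blast
qed

lemma st_branches: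
  assumes "finite D" "D \<subseteq> C" "D \<inter> X = {}" "\<forall>c\<in>D. card (W \<inter> c) = j" "st X Y vs H"
  shows "\<exists>vs'. st (D \<union> X) (Y \<union> (W \<inter> \<Union>D)) vs' ((attach_branch k j 0 ^^ card D) H)"
  using assms
proof (induction D rule: finite_induct)
  case empty
  then show ?case by auto
next
  case (insert c D)
  then obtain vs' where s: "st (D \<union> X) (Y \<union> (W \<inter> \<Union>D)) vs' ((attach_branch k j 0 ^^ card D) H)" by auto
  have "c \<in> C" "c \<notin> D \<union> X" using insert by auto
  from st_branch[OF s this] obtain vs'' where
    "st (insert c (D \<union> X)) (Y \<union> (W \<inter> \<Union>D) \<union> (W \<inter> c)) vs''
      (attach_branch k (card (W \<inter> c)) 0 ((attach_branch k j 0 ^^ card D) H))" by blast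
  moreover have "Y \<union> (W \<inter> \<Union>D) \<union> (W \<inter> c) = Y \<union> (W \<inter> \<Union>(insert c D))" by auto
  moreover have "card (W \<inter> c) = j" using insert by simp
  ultimately show ?case using insert(1,2) by auto
qed

text \<open>The order \<open>u\<close>, \<open>v\<close>, rest of \<open>a\<close>, rest of
  \<open>b\<close> reproduces the numbering fixed in \<open>two_cycle\<close>.\<close>

lemma st_cycle:
  obtains vs where "st {a, b} {} vs (two_cycle k)" "length vs = 2 * k - 2"
    "vs ! 1 = v" "(!) vs ` {2..<2 + ra} = W \<inter> (a - {u, v})" "(!) vs ` {k..<k + rb} = W \<inter> (b - {u, v})"
proof -
  have fin: "finite (a - {u,v})" "finite (b - {u,v})" using finite_St by auto
  obtain as where as: "distinct as" "set as = a - {u,v}" "set (take ra as) = W \<inter> (a - {u,v})"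
    using list_with_prefix[OF fin(1), of W] by auto
  obtain bs where bs: "distinct bs" "set bs = b - {u,v}" "set (take rb bs) = W \<inter> (b - {u,v})"
    using list_with_prefix[OF fin(2), of W] by auto
  have la: "length as = k - 2" using distinct_card[OF as(1)] as(2) card_slots(1) by simp
  have lb: "length bs = k - 2" using distinct_card[OF bs(1)] bs(2) card_slots(2) by simp
  have ra: "ra \<le> k - 2" "rb \<le> k - 2" using conf_W by (auto simp: conf_def)
  let ?vs = "[u, v] @ as @ bs"
  have len: "length ?vs = 2 * k - 2" using la lb k3 by simp
  have na: "?vs ! (2 + l) = as ! l" if "l < k - 2" for l using that la by (simp add: nth_append)
  have nb: "?vs ! (k + l) = bs ! l" for l
  proof -
    have "k + l = 2 + (length as + l)" using la k3 by simp
    then show ?thesis by (metis append_Cons append_Nil add_2_eq_Suc nth_Cons_Suc nth_append_length_plus)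
  qed
  have ia: "(!) ?vs ` {2..<2 + n} = set (take n as)" if "n \<le> k - 2" for n
  proof -
    have "{2..<2 + n} = (+) 2 ` {0..<n}" by (simp only: image_add_atLeastLessThan add_0 add.commute)
    then have "(!) ?vs ` {2..<2 + n} = (\<lambda>l. ?vs ! (2 + l)) ` {0..<n}" by (simp only: image_image)
    also have "\<dots> = (!) as ` {0..<n}" by (rule image_cong) (use na that in auto)
    finally show ?thesis using nth_image[of n as] la that by simp
  qed
  have ib: "(!) ?vs ` {k..<k + n} = set (take n bs)" if "n \<le> k - 2" for n
  proof -
    have "{k..<k + n} = (+) k ` {0..<n}" by (simp only: image_add_atLeastLessThan add_0 add.commute)
    then have "(!) ?vs ` {k..<k + n} = (\<lambda>l. ?vs ! (k + l)) ` {0..<n}" by (simp only: image_image)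
    also have "\<dots> = (!) bs ` {0..<n}" by (rule image_cong) (use nb in auto)
    finally show ?thesis using nth_image[of n bs] lb that by simp
  qed
  have uvab: "u \<in> a" "v \<in> a" "u \<in> b" "v \<in> b" using ab by auto
  have k2: "2 + (k - 2) = k" "k + (k - 2) = 2 * k - 2" using k3 by auto
  have "(!) ?vs ` ({0, 1} \<union> {2..<k}) = {u, v} \<union> set (take (k-2) as)"
    using ia[of "k-2"] k2 by (simp add: image_Un)
  then have ea: "(!) ?vs ` ({0, 1} \<union> {2..<k}) = a" using as(2) la uvab by auto
  have "(!) ?vs ` ({0, 1} \<union> {k..<2 * k - 2}) = {u, v} \<union> set (take (k-2) bs)"
    using ib[of "k-2"] k2 by (simp add: image_Un)
  then have eb: "(!) ?vs ` ({0, 1} \<union> {k..<2 * k - 2}) = b" using bs(2) lb uvab by auto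
  have "distinct ?vs" using as bs uv ab by auto
  then have "listed ?vs {a, b} (two_cycle k)"
    unfolding listed_def two_cycle_def len using ea eb k3 by auto
  moreover have "set ?vs = a \<union> b" using as(2) bs(2) uvab by auto
  ultimately have "st {a, b} {} ?vs (two_cycle k)" by (auto simp: st_def)
  moreover have "?vs ! 1 = v" by simp
  ultimately show ?thesis using that[of ?vs] len ia[OF ra(1)] ib[OF ra(2)] as(3) bs(3) by simp
qed

text \<open>The star edges off the cycle are sorted into full ones, at most one partial one, and
  those without pendant edges. The last kind are themselves pendant edges at \<open>u\<close>,
  attached in the final step of the construction.\<close>

lemma iso_to_U_intro:
  assumes n: "n = card (verts G)" "card (verts G) = (k - 1) * card (edges G)"
    and C1: "C1 \<subseteq> C" "\<forall>c\<in>C1. card (W \<inter> c) = k - 1"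
    and C2: "C2 \<subseteq> C - C1" "card C2 = (if w = 0 then 0 else 1)" "\<forall>c\<in>C2. card (W \<inter> c) = w"
    and C3: "\<forall>c\<in>C - C1 - C2. W \<inter> c = {}" and w: "w \<le> k - 2"
  shows "iso_to_U G n k fl ra rb (card C1) w"
proof -
  have ceil: "nat \<lceil>real w / real (k - 1)\<rceil> = (if w = 0 then 0 else 1)"
  proof (cases "w = 0")
    case False
    then have "0 < real w / real (k-1)" "real w / real (k-1) \<le> 1" using w k3 by auto
    then have "\<lceil>real w / real (k-1)\<rceil> = 1" by (intro ceiling_unique) auto
    then show ?thesis using False by simp
  qed simp
  define C3 where "C3 = C - C1 - C2"
  have fC: "finite C1" "finite C2" "finite C3" using finC C1(1) C2(1) by (auto simp: C3_def intro: finite_subset)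
  have Cp: "C = C1 \<union> (C2 \<union> C3)" "C1 \<inter> (C2 \<union> C3) = {}" "C2 \<inter> C3 = {}"
    using C1(1) C2(1) by (auto simp: C3_def)
  have w3: "card (W \<inter> c) = 0" if "c \<in> C3" for c using that C3 by (simp add: C3_def)
  have "(\<Sum>c\<in>C. card (W \<inter> c)) = (\<Sum>c\<in>C1. card (W \<inter> c)) + ((\<Sum>c\<in>C2. card (W \<inter> c)) + (\<Sum>c\<in>C3. card (W \<inter> c)))"
    unfolding Cp(1) using fC Cp by (simp add: sum.union_disjoint)
  also have "\<dots> = card C1 * (k - 1) + w" using C1 C2 w3 by simp
  finally have sumC: "(\<Sum>c\<in>C. card (W \<inter> c)) = card C1 * (k - 1) + w" .
  have cC: "card C = card C1 + card C2 + card C3" using Cp fC by (simp add: card_Un_disjoint)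
  have cW: "card W = fl + ra + rb + (card C1 * (k-1) + w)" using card_trunk_subset[OF W] sumC by simp
  have m: "n div (k-1) = card (edges G)" "(k - 1) dvd n" using n k3 by auto
  \<comment> \<open>So the subtraction of natural numbers in \<open>hypergraph_U\<close> is exact
    and leaves \<open>card C3\<close> pendant edges for the centre.\<close>
  have used: "used_edges_U k fl ra rb (card C1) w + card C3 = card (edges G)"
    unfolding used_edges_U_def ceil card_edges cW cC using C2(2) by simp
  have cf: "ra \<le> k - 2" "rb \<le> k - 2" using conf_W by (auto simp: conf_def)
  have adm: "admissible_U n k fl ra rb (card C1) w"
    unfolding admissible_U_def using cf w m used by auto
  obtain vs where s0: "st {a, b} {} vs (two_cycle k)" and len: "length vs = 2 * k - 2"
    and v1: "vs ! 1 = v" and ia: "(!) vs ` {2..<2 + ra} = W \<inter> (a - {u, v})"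
    and ib: "(!) vs ` {k..<k + rb} = W \<inter> (b - {u, v})"
    by (rule st_cycle)
  define Y1 where "Y1 = (if v \<in> W then {v} else {})"
  define G1 where "G1 = (attach_edge k 1 ^^ fl) (two_cycle k)"
  obtain n1 where s1: "st {a, b} Y1 (vs @ n1) G1"
  proof (cases "v \<in> W")
    case True
    have "1 < length vs" using len k3 by simp
    then obtain ns where "st {a, b} (insert (vs ! 1) {}) (vs @ ns) (attach_edge k 1 (two_cycle k))"
      using st_pendant[OF s0, of 1] True v1 ab by auto
    then show ?thesis using that[of ns] True v1 by (simp add: Y1_def G1_def)
  next
    case False
    then show ?thesis using that[of "[]"] s0 by (simp add: Y1_def G1_def)
  qed
  define G2 where "G2 = fold (attach_edge k) [2..<2 + ra] G1"
  have l2: "i < length vs" if "i \<in> {2..<2 + ra}" for i using that cf len k3 by auto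
  have n2: "(vs @ xs) ! i = vs ! i" if "i \<in> {2..<2 + ra}" for i xs using l2[OF that] by (simp add: nth_append)
  have "\<forall>i\<in>set [2..<2 + ra]. i < length (vs @ n1) \<and> (vs @ n1) ! i \<in> W \<and> (vs @ n1) ! i \<in> \<Union>{a, b} \<and> (vs @ n1) ! i \<notin> Y1"
  proof
    fix i assume "i \<in> set [2..<2 + ra]"
    then have i: "i \<in> {2..<2 + ra}" by (simp only: set_upt)
    have "vs ! i \<in> W \<inter> (a - {u, v})" using imageI[OF i, of "(!) vs"] unfolding ia .
    then show "i < length (vs @ n1) \<and> (vs @ n1) ! i \<in> W \<and> (vs @ n1) ! i \<in> \<Union>{a, b} \<and> (vs @ n1) ! i \<notin> Y1"
      unfolding n2[OF i] using l2[OF i] by (auto simp: Y1_def)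
  qed
  from st_pendants[OF s1 distinct_upt this] obtain n2' where
    s2: "st {a, b} (Y1 \<union> (!) (vs @ n1) ` set [2..<2 + ra]) ((vs @ n1) @ n2') G2"
    unfolding G2_def by blast
  define Y2 where "Y2 = Y1 \<union> (W \<inter> (a - {u, v}))"
  have "(!) (vs @ n1) ` set [2..<2 + ra] = (!) vs ` {2..<2 + ra}"
    unfolding set_upt by (rule image_cong) (use n2 in auto)
  then have s2: "st {a, b} Y2 (vs @ (n1 @ n2')) G2" using s2 unfolding Y2_def ia by simp
  define G3 where "G3 = fold (attach_edge k) [k..<k + rb] G2"
  let ?vs = "vs @ (n1 @ n2')"
  have l3: "i < length vs" if "i \<in> {k..<k + rb}" for i using that cf len k3 by auto
  have n3: "?vs ! i = vs ! i" if "i \<in> {k..<k + rb}" for i using l3[OF that] by (simp add: nth_append)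
  have "\<forall>i\<in>set [k..<k + rb]. i < length ?vs \<and> ?vs ! i \<in> W \<and> ?vs ! i \<in> \<Union>{a, b} \<and> ?vs ! i \<notin> Y2"
  proof
    fix i assume "i \<in> set [k..<k + rb]"
    then have i: "i \<in> {k..<k + rb}" by (simp only: set_upt)
    have x: "vs ! i \<in> W \<inter> (b - {u, v})" using imageI[OF i, of "(!) vs"] unfolding ib .
    moreover have "vs ! i \<notin> a" using ab x by blast
    ultimately show "i < length ?vs \<and> ?vs ! i \<in> W \<and> ?vs ! i \<in> \<Union>{a, b} \<and> ?vs ! i \<notin> Y2"
      unfolding n3[OF i] using l3[OF i] x by (auto simp: Y1_def Y2_def)
  qed
  from st_pendants[OF s2 distinct_upt this] obtain n3' where
    s3: "st {a, b} (Y2 \<union> (!) ?vs ` set [k..<k + rb]) (?vs @ n3') G3"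
    unfolding G3_def by blast
  have "(!) ?vs ` set [k..<k + rb] = (!) vs ` {k..<k + rb}"
    unfolding set_upt by (rule image_cong) (use n3 in auto)
  moreover define Y3 where "Y3 = Y2 \<union> (W \<inter> (b - {u, v}))"
  ultimately have s3: "st {a, b} Y3 (?vs @ n3') G3" using s3 unfolding ib by simp
  have dC: "D \<inter> {a, b} = {}" if "D \<subseteq> C" for D using that aC bC by blast
  obtain vs4 where s4: "st (C1 \<union> {a, b}) (Y3 \<union> (W \<inter> \<Union>C1)) vs4 ((attach_branch k (k-1) 0 ^^ card C1) G3)"
    using st_branches[OF fC(1) C1(1) dC[OF C1(1)] C1(2) s3] by blast
  have C2C: "C2 \<subseteq> C" "C2 \<inter> (C1 \<union> {a, b}) = {}" using C2(1) dC[of C2] by blast+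
  obtain vs5 where s5: "st (C2 \<union> (C1 \<union> {a, b})) (Y3 \<union> (W \<inter> \<Union>C1) \<union> (W \<inter> \<Union>C2)) vs5
      ((attach_branch k w 0 ^^ card C2) ((attach_branch k (k-1) 0 ^^ card C1) G3))"
    using st_branches[OF fC(2) C2C C2(3) s4] by blast
  have C3C: "C3 \<subseteq> C" "C3 \<inter> (C2 \<union> (C1 \<union> {a, b})) = {}" using dC[of C3] by (auto simp: C3_def)
  obtain vs6 where s6: "st (C3 \<union> (C2 \<union> (C1 \<union> {a, b}))) (Y3 \<union> (W \<inter> \<Union>C1) \<union> (W \<inter> \<Union>C2) \<union> (W \<inter> \<Union>C3)) vs6
      ((attach_branch k 0 0 ^^ card C3) ((attach_branch k w 0 ^^ card C2) ((attach_branch k (k-1) 0 ^^ card C1) G3)))"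
    using st_branches[OF fC(3) C3C _ s5, of 0] w3 by blast
  have X: "C3 \<union> (C2 \<union> (C1 \<union> {a, b})) = St" using Cp(1) by blast
  have Y: "Y3 \<union> (W \<inter> \<Union>C1) \<union> (W \<inter> \<Union>C2) \<union> (W \<inter> \<Union>C3) = W"
  proof -
    have C: "(W \<inter> \<Union>C1) \<union> (W \<inter> \<Union>C2) \<union> (W \<inter> \<Union>C3) = W \<inter> \<Union>C"
      unfolding Cp(1) by (simp add: Int_Un_distrib Un_assoc)
    have "Y3 \<subseteq> W" by (simp add: Y3_def Y2_def Y1_def)
    moreover have "W \<subseteq> Y3 \<union> (W \<inter> \<Union>C)"
    proof
      fix x assume x: "x \<in> W"
      have "x \<in> a \<or> x \<in> b \<or> x \<in> \<Union>C" using W_T(1)[OF x] by (simp only: Un_iff disj_assoc)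
      then show "x \<in> Y3 \<union> (W \<inter> \<Union>C)"
        using x W_T(2)[OF x] unfolding Y3_def Y2_def Y1_def by (cases "x = v") simp_all
    qed
    ultimately have "Y3 \<union> (W \<inter> \<Union>C) = W" by (simp add: subset_antisym)
    then show ?thesis unfolding C[symmetric] by (simp only: Un_assoc)
  qed
  \<comment> \<open>A branch without pendant edges is a single attached edge, so
    \<open>st_branches\<close> with \<open>j = 0\<close> also covers the final step.\<close>
  have br0: "attach_branch k 0 0 = attach_edge k 0"
    by (rule ext) (simp add: attach_branch_def)
  have "n div (k-1) - used_edges_U k fl ra rb (card C1) w = card C3" using m used by simp
  then have "hypergraph_U n k fl ra rb (card C1) w
      = (attach_branch k 0 0 ^^ card C3) ((attach_branch k w 0 ^^ card C2) ((attach_branch k (k-1) 0 ^^ card C1) G3))"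
    unfolding hypergraph_U_def Let_def br0 G3_def G2_def G1_def ceil using C2(2) by simp
  then have "st St W vs6 (hypergraph_U n k fl ra rb (card C1) w)" using s6 unfolding X Y by simp
  then have "listed vs6 (edges G) (hypergraph_U n k fl ra rb (card C1) w)" "set vs6 = verts G"
    unfolding st_def edges_G verts_G by auto
  then have "G \<cong> hypergraph_U n k fl ra rb (card C1) w" by (rule listed_iso)
  then show ?thesis unfolding iso_to_U_def using adm by simp
qed

end

section \<open>The extremal hypergraphs\<close>

context extremal_bouquet
begin

text \<open>Without further star edges the free edge is the cycle edge \<open>a\<close>. It contains
  \<open>v\<close>, so every pendant edge sits on the rest of \<open>b\<close>.\<close>

lemma iso_to_U_tight:
  assumes C: "C = {}" and a: "a \<inter> W = {}"
  shows "iso_to_U G n k 0 0 (z - 1) 0 0"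
proof -
  have "v \<in> a" using ab by auto
  then have v: "v \<notin> W" using a by auto
  have ra: "W \<inter> (a - {u, v}) = {}" using a by auto
  then have rb: "rb = z - 1" using card_trunk_subset[OF W] v cW C by simp
  have "iso_to_U G n k fl ra rb (card ({} :: 'a set set)) 0"
    by (rule iso_to_U_intro[of n "{}" "{}" 0]) (use cardV count C in auto)
  then show ?thesis using v ra rb by simp
qed

text \<open>The exchanges leave a single distribution up to isomorphism. The ranges of
  \<open>z\<close> record at which stage of the filling the \<open>z - 1\<close> pendant edges run
  out.\<close>

lemma iso_to_U_loose:
  assumes C: "card C \<ge> 1" and H: "z + 2 - 2 * k \<le> (card C - 1) * (k - 1)" and rs: "rb \<le> ra"
  shows "(1 \<le> z \<and> z \<le> 2 \<longrightarrow> iso_to_U G n k (z - 1) 0 0 0 0) \<and>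
    (3 \<le> z \<and> z \<le> k \<longrightarrow> iso_to_U G n k 1 (z - 2) 0 0 0) \<and>
    (k + 1 \<le> z \<and> z \<le> 2 * k - 2 \<longrightarrow> iso_to_U G n k 1 (k - 2) (z - k) 0 0) \<and>
    (2 * k - 1 \<le> z \<longrightarrow> iso_to_U G n k 1 (k - 2) (k - 2) ((z + 2 - 2 * k) div (k - 1))
       ((z + 2 - 2 * k) - (z + 2 - 2 * k) div (k - 1) * (k - 1)))"
proof -
  define j where "j = (\<lambda>c. card (W \<inter> c))"
  obtain d where d: "d > 1" and opt: "optimal d k C (z - 1) fl ra rb j"
    unfolding j_def by (rule optimal_W[OF C H])
  have cf: "conf k C (z - 1) fl ra rb j" using conf_W cW unfolding j_def by simp
  then have cfD: "ra \<le> k - 2" "rb \<le> k - 2" "\<forall>c\<in>C. j c \<le> k - 1"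
      "fl + ra + rb + (\<Sum>c\<in>C. j c) = z - 1"
    by (auto simp: conf_def)
  have jW: "W \<inter> c = {}" if "j c = 0" for c using that finite_W by (simp add: j_def)
  have iso0: "iso_to_U G n k fl ra rb 0 0" if "\<forall>c\<in>C. j c = 0"
    using iso_to_U_intro[of n "{}" "{}" 0] cardV count jW that by simp
  show ?thesis
  proof (cases "z = 1")
    case True
    then have "\<forall>c\<in>C. j c = 0" using cfD(4) finC by simp
    moreover have "\<not> 2 * k - 1 \<le> z" using True k by simp
    ultimately show ?thesis using iso0 True cfD(4) k by simp
  next
    case False
    then have z2: "z \<ge> 2" using z by simp
    have fl: "fl = 1" using optimal_conf_centre[OF k d finC cf opt] z2 by simp
    have cf1: "conf k C (z - 1) 1 ra rb j"
      and opt1: "optimal d k C (z - 1) 1 ra rb j"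
      using cf opt unfolding fl by blast+
    have cyc: "rb = 0 \<or> ra = k - 2" by (rule optimal_conf_cycle[OF d cf1 opt1 rs])
    have sum: "1 + ra + rb + (\<Sum>c\<in>C. j c) = z - 1" using cfD(4) unfolding fl .
    show ?thesis
    proof (cases "rb < k - 2")
      case True
      \<comment> \<open>The room is on \<open>b\<close>, so the cycle edges exchange roles before
        the branches are shown to be empty.\<close>
      have cf2: "conf k C (z - 1) 1 rb ra j" using cf1 by (simp only: conf_swap)
      have opt2: "optimal d k C (z - 1) 1 rb ra j"
        using opt1 Psi_swap[of d C 1 ra rb j] by simp
      have j0: "\<forall>c\<in>C. j c = 0"
        using optimal_conf_branches_empty[OF k d finC cf2 opt2 True] by blast
      have iso: "iso_to_U G n k 1 ra rb 0 0" using iso0[OF j0] unfolding fl .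
      have s: "ra + rb = z - 2" using sum j0 by simp
      have A: "ra = z - 2 \<and> rb = 0" if "z \<le> k" using cyc s cfD(1) that by linarith
      have B: "ra = k - 2 \<and> rb = z - k" if "k + 1 \<le> z" using cyc s cfD(1) that k by linarith
      have "\<not> 2 * k - 1 \<le> z" using s cfD(1) True k by linarith
      moreover have "z \<le> 2 \<longrightarrow> iso_to_U G n k (z - 1) 0 0 0 0"
      proof
        assume "z \<le> 2"
        then have "z = 2" using z2 by simp
        then show "iso_to_U G n k (z - 1) 0 0 0 0" using iso s by simp
      qed
      moreover have "z \<le> k \<longrightarrow> iso_to_U G n k 1 (z - 2) 0 0 0" using iso A by metis
      moreover have "k + 1 \<le> z \<longrightarrow> iso_to_U G n k 1 (k - 2) (z - k) 0 0" using iso B by metis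
      ultimately show ?thesis by simp
    next
      case False
      then have rb: "rb = k - 2" "ra = k - 2" using cfD rs by auto
      define Z where "Z = z + 2 - 2 * k"
      have SZ: "(\<Sum>c\<in>C. j c) = Z" "z + 2 \<ge> 2 * k" using sum rb k unfolding Z_def by linarith+
      define C1 where "C1 = {c \<in> C. j c = k - 1}"
      define C2 where "C2 = {c \<in> C - C1. j c \<noteq> 0}"
      have fin: "finite C1" "finite C2" using finC by (auto simp: C1_def C2_def)
      \<comment> \<open>Of two partial branches, the fuller one could still take a pendant edge from
        the other.\<close>
      have uniq: "c = c'" if "c \<in> C2" "c' \<in> C2" for c c'
      proof (rule ccontr)
        assume ne: "c \<noteq> c'"
        have c: "c \<in> C" "c' \<in> C" "j c \<noteq> 0" "j c' \<noteq> 0" "j c \<noteq> k - 1" "j c' \<noteq> k - 1"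
          using that by (auto simp: C1_def C2_def)
        show False
          using optimal_conf_branches[OF d finC cf opt c(1,2) ne]
            optimal_conf_branches[OF d finC cf opt c(2,1) ne[symmetric]] c by linarith
      qed
      define w where "w = (\<Sum>c\<in>C2. j c)"
      have "card C2 = (if w = 0 then 0 else 1) \<and> (\<forall>c\<in>C2. j c = w) \<and> w < k - 1"
      proof (cases "C2 = {}")
        case True
        then show ?thesis using k by (simp add: w_def)
      next
        case False
        then obtain c where "c \<in> C2" by auto
        then have C2: "C2 = {c}" using uniq by auto
        then have "j c \<noteq> 0" "j c \<noteq> k - 1" "c \<in> C" by (auto simp: C2_def C1_def)
        moreover then have "j c \<le> k - 1" using cfD(3) by auto
        ultimately show ?thesis using C2 by (simp add: w_def)
      qed
      then have w: "card C2 = (if w = 0 then 0 else 1)" "\<forall>c\<in>C2. j c = w" "w < k - 1" by auto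
      have "Z = card C1 * (k - 1) + w"
      proof -
        have "(\<Sum>c\<in>C. j c) = (\<Sum>c\<in>C1 \<union> C2. j c)"
          by (rule sum.mono_neutral_right) (use finC in \<open>auto simp: C1_def C2_def\<close>)
        also have "\<dots> = (\<Sum>c\<in>C1. j c) + (\<Sum>c\<in>C2. j c)"
          by (rule sum.union_disjoint) (use fin in \<open>auto simp: C2_def\<close>)
        also have "(\<Sum>c\<in>C1. j c) = card C1 * (k - 1)" by (simp add: C1_def)
        finally show ?thesis using SZ by (simp add: w_def)
      qed
      then have t: "Z div (k - 1) = card C1" "Z - Z div (k - 1) * (k - 1) = w"
        using w(3) k by auto
      have iso: "iso_to_U G n k fl ra rb (card C1) w"
      proof (rule iso_to_U_intro)
        show "\<forall>c\<in>C - C1 - C2. W \<inter> c = {}" using jW by (auto simp: C2_def)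
        show "w \<le> k - 2" using w(3) by simp
      qed (use cardV count w(1,2) in \<open>auto simp: C1_def C2_def j_def\<close>)
      have iso: "iso_to_U G n k 1 (k - 2) (k - 2) (Z div (k - 1)) (Z - Z div (k - 1) * (k - 1))"
        using iso unfolding fl rb t(2) unfolding t(1) .
      \<comment> \<open>Only the boundary value \<open>z = 2 * k - 2\<close> arises here: the cycle
        is just full, nothing is left for the branches, and both descriptions agree.\<close>
      moreover have "iso_to_U G n k 1 (k - 2) (z - k) 0 0" if "z \<le> 2 * k - 2"
      proof -
        have "Z = 0" "z - k = k - 2" using that SZ(2) k by (auto simp: Z_def)
        then show ?thesis using iso by simp
      qed
      moreover have "\<not> z \<le> k" using SZ(2) k by simp
      ultimately show ?thesis unfolding Z_def using k by simp
    qed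
  qed
qed

end

theorem theorem1p3:
  fixes k n z m :: nat and G :: "'a hypergraph"
  assumes "k \<ge> 3" and "z \<ge> 1"
    and "G \<in> unicyclic_matching_class n k z"
    and "\<forall>G' \<in> (unicyclic_matching_class n k z :: 'a hypergraph set).
           spectral_radius k G' \<le> spectral_radius k G"
    and "m = card (edges G)"
  shows "m \<ge> z + 1 \<and>
    (m = z + 1 \<longrightarrow> iso_to_U G n k 0 0 (z - 1) 0 0) \<and>
    (m \<ge> z + 2 \<and> 1 \<le> z \<and> z \<le> 2 \<longrightarrow> iso_to_U G n k (z - 1) 0 0 0 0) \<and>
    (m \<ge> z + 2 \<and> 3 \<le> z \<and> z \<le> k \<longrightarrow> iso_to_U G n k 1 (z - 2) 0 0 0) \<and>
    (m \<ge> z + 2 \<and> k + 1 \<le> z \<and> z \<le> 2 * k - 2 \<longrightarrow> iso_to_U G n k 1 (k - 2) (z - k) 0 0) \<and>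
    (m \<ge> z + 2 \<and> 2 * k - 1 \<le> z \<and>
       int z \<le> int m - 2 - \<lceil>(real m - 2 * real k) / (real k - 1)\<rceil> \<longrightarrow>
       (let t = (z + 2 - 2 * k) div (k - 1);
            w = (z + 2 - 2 * k) - t * (k - 1)
        in iso_to_U G n k 1 (k - 2) (k - 2) t w))"
proof -
  have k: "k \<ge> 3" by (fact assms(1))
  have ex: "extremal_unicyclic k n z G" by unfold_locales (fact assms)+
  obtain y u e0 where star: "perron k G y" "u \<in> verts G" "\<forall>v\<in>verts G. y v \<le> y u"
    "e0 \<in> edges G" "u \<in> e0" "pairwise disjnt (insert e0 {e \<in> edges G. u \<notin> e})"
    "card {e \<in> edges G. u \<notin> e} = z - 1"
    by (rule extremal_unicyclic.star_structure[OF ex])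
  have "extremal_star k n z G y u e0"
    by (intro extremal_star.intro extremal_star_axioms.intro) (fact ex star)+
  then obtain v a b C W f where bq: "bouquet k G u v a b C W f" and cW: "card W = z - 1"
    and e0C: "e0 \<in> insert a (insert b C)" and e0W: "e0 \<inter> W = {}"
    by (rule extremal_star.bouquet_exists)
  have eb: "extremal_bouquet k n z G u v a b C W f"
    by (intro extremal_bouquet.intro extremal_bouquet_axioms.intro) (fact ex bq cW)+
  have eb': "extremal_bouquet k n z G u v b a C W f"
    by (intro extremal_bouquet.intro extremal_bouquet_axioms.intro) (fact ex bouquet.swap[OF bq] cW)+
  \<comment> \<open>These are the \<open>z - 1\<close> pendant edges, the two cycle edges and
    \<open>C\<close>; so m = z+1 means that \<open>C\<close> is empty.\<close>
  have m: "m = card C + z + 1"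
    using bouquet.card_edges[OF bq] cW assms(2,5) by simp
  have small: "iso_to_U G n k 0 0 (z - 1) 0 0" if "m = z + 1"
  proof -
    have C: "C = {}" using that m bouquet.finC[OF bq] by simp
    then consider "e0 = a" | "e0 = b" using e0C by auto
    then show ?thesis
    proof cases
      case 1
      then show ?thesis using extremal_bouquet.iso_to_U_tight[OF eb C] e0W by simp
    next
      case 2
      then show ?thesis using extremal_bouquet.iso_to_U_tight[OF eb' C] e0W by simp
    qed
  qed
  let ?Z = "z + 2 - 2 * k"
  have large: "(1 \<le> z \<and> z \<le> 2 \<longrightarrow> iso_to_U G n k (z - 1) 0 0 0 0) \<and>
    (3 \<le> z \<and> z \<le> k \<longrightarrow> iso_to_U G n k 1 (z - 2) 0 0 0) \<and>
    (k + 1 \<le> z \<and> z \<le> 2 * k - 2 \<longrightarrow> iso_to_U G n k 1 (k - 2) (z - k) 0 0) \<and>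
    (2 * k - 1 \<le> z \<longrightarrow> iso_to_U G n k 1 (k - 2) (k - 2) (?Z div (k - 1)) (?Z - ?Z div (k - 1) * (k - 1)))"
    if "m \<ge> z + 2" and H: "?Z \<le> (card C - 1) * (k - 1)"
  proof -
    have C: "card C \<ge> 1" using that m by simp
    \<comment> \<open>Either cycle edge may be the fuller one; \<open>eb'\<close> covers the
      exchanged order.\<close>
    show ?thesis
      using extremal_bouquet.iso_to_U_loose[OF eb C H] extremal_bouquet.iso_to_U_loose[OF eb' C H] linear
      by metis
  qed
  \<comment> \<open>In this range \<open>?Z\<close> is 0 by truncated subtraction.\<close>
  have H0: "?Z \<le> (card C - 1) * (k - 1)" if "z \<le> 2 * k - 2" using that k by simp
  have H1: "?Z \<le> (card C - 1) * (k - 1)"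
    if z: "m \<ge> z + 2" "2 * k - 1 \<le> z"
      and ceil: "int z \<le> int m - 2 - \<lceil>(real m - 2 * real k) / (real k - 1)\<rceil>"
  proof -
    \<comment> \<open>Since m-2-z is \<open>?N\<close> and m-2k is \<open>?N + ?Z\<close>, the
      ceiling condition amounts to \<open>?N + ?Z \<le> ?N * (k - 1)\<close>, from which the
      capacity bound follows.\<close>
    let ?N = "card C - 1"
    have N: "int m - 2 - int z = int ?N" using m z(1) by simp
    then have "\<lceil>(real m - 2 * real k) / (real k - 1)\<rceil> \<le> int ?N" using ceil by simp
    then have "(real m - 2 * real k) / (real k - 1) \<le> real ?N" by (simp add: ceiling_le_iff)
    then have "real m - 2 * real k \<le> real ?N * (real k - 1)" using k by (simp add: pos_divide_le_eq)
    moreover have "real ?Z = real z + 2 - 2 * real k" using z(2) k by simp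
    moreover have "real m = real ?N + real z + 2" using m z(1) by simp
    ultimately have "real ?Z \<le> real ?N * (real k - 1)" by simp
    also have "\<dots> = real (?N * (k - 1))" using k by simp
    finally show ?thesis by (simp only: of_nat_le_iff)
  qed
  have z_le_k: "z \<le> 2 * k - 2" if "z \<le> k" using that k by simp
  have z_le_2: "z \<le> 2 * k - 2" if "z \<le> 2" using that k by simp
  have "z + 1 \<le> m" using m by simp
  then show ?thesis
    unfolding Let_def using small large H0 H1 z_le_k z_le_2 by blast
qed

end
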